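(* Let $p$ be a prime, $q = p^s$, $r = q^t$ with integers $s,t\ge1$, let $k\ge 0$ and $d\ge 2$ be integers, and let $\lambda \in \mathbb{F}_q^{*}$ with $\lambda \neq 1$; if $p\neq 2$ assume moreover $\lambda\neq 2$ and put $\mu := 2-\lambda$. Define $\Theta_k^t(\lambda)\in\mathbb{F}_q((T^{-1}))$ by the continued fraction \[ \Theta_k^t(\lambda) = \begin{cases} [0, T^{[k]}, \bigoplus_{i\ge1}\big(T, (\lambda T, \mu T)^{[(r^i-1)/2]}\big)^{[k+1]}] & \text{if } p\neq 2,\\ [0, T^{[k]}, \bigoplus_{i\ge1}\big(T, (\lambda T)^{[r^i-1]}\big)^{[k+1]}] & \text{if } p = 2.\end{cases} \] Then \[ w_2^*(\Theta_k^t(\lambda)) \ge \max\left\{\frac{r-1}{k+1},\ r-1-\frac{r(r-1)(r-4)}{2r(k+1)+(r-1)(r-2)}\right\}, \] \[ w_2(\Theta_k^t(\lambda)) \ge \max\left\{\frac{r-1}{k+1}+1,\ r-\frac{r(r-1)(r-3)}{2r(k+1)+(r-1)(r-2)}\right\}. \] If \[ k \le \frac{2(r-1)}{d+\sqrt{d^2+4(2r-1)d+4}} - 1, \] then $w_n^*(\Theta_k^t(\lambda)) = \frac{r-1}{k+1}$ and $w_n(\Theta_k^t(\lambda)) = \frac{r-1}{k+1}+1$ for all integers $2\le n\le d$. If \[ 2rd \le \left(r-2-\frac{r(r-1)(r-4)}{2r(k+1)+(r-1)(r-2)}\right)\left(r-d-\frac{r(r-1)(r-4)}{2r(k+1)+(r-1)(r-2)}\right),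 \] then for all integers $2\le n\le d$, \[ w_n^*(\Theta_k^t(\lambda)) = r-1-\frac{r(r-1)(r-4)}{2r(k+1)+(r-1)(r-2)},\qquad w_n(\Theta_k^t(\lambda)) = r-\frac{r(r-1)(r-3)}{2r(k+1)+(r-1)(r-2)}. \]
   Context: $\mathbb{F}_q((T^{-1}))$ is the field of Laurent series $\xi=\sum_{m\ge N} a_m T^{-m}$ ($a_m\in\mathbb{F}_q$) with absolute value $|\xi|=q^{-N}$ when $a_N\ne0$, $|0|=0$, extended uniquely to an algebraic closure. Every $\xi$ has a continued fraction expansion $[a_0,a_1,a_2,\dots]$ with $a_i\in\mathbb{F}_q[T]$ and $\deg_T a_m\ge1$ for $m\ge1$. For finite words $W,V$ of partial quotients, $W\bigoplus V$ (or simply writing them separated by commas) denotes concatenation, $W^{[n]}$ is $W$ repeated $n$ times ($W^{[0]}$ empty), and $\bigoplus_{i\ge1}W_i$ is the infinite concatenation $W_1 W_2\cdots$. The height $H(P)$ of $P\in(\mathbb{F}_q[T])[X]$ is the maximum absolute value of its coefficients. For $\alpha$ algebraic over $\mathbb{F}_q(T)$, its minimal polynomial is the unique non-constant irreducible primitive $P\in(\mathbb{F}_q[T])[X]$ with leading coefficient monic in $T$ and $P(\alpha)=0$; $H(\alpha):=H(P)$, $\deg\alpha:=\deg P$. For $n\ge1$, $w_n(\xi)$ is the supremum of real $w$ with $0<|P(\xi)|\le H(P)^{-w}$ for infinitely many $P\in(\mathbb{F}_q[T])[X]$ of degree $\le n$, and $w_n^*(\xi)$ is the supremum of real $w^*$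 with $0<|\xi-\alpha|\le H(\alpha)^{-w^*-1}$ for infinitely many algebraic $\alpha$ of degree $\le n$. *)

theory Defs
  imports "HOL-Computational_Algebra.Computational_Algebra" "HOL-Library.Cardinality" "HOL-Library.Extended_Real"
begin

text \<open>An element xi = sum_(m >= N) a_m T^(-m) is the formal Laurent series sum a_m X^m
  in the variable X = T^(-1).  Its absolute value is q^(-N), N the subdegree,
  where q = CARD('a).\<close>

definition fls_abs :: "'a::{finite,field} fls \<Rightarrow> real" where
  "fls_abs x = (if x = 0 then 0 else real CARD('a) powr (- real_of_int (fls_subdegree x)))"

definition poly_to_fls :: "'a::field poly \<Rightarrow> 'a fls" where
  "poly_to_fls c = poly (map_poly fls_const c) fls_X_inv"

definition poly_abs :: "'a::{finite,field} poly \<Rightarrow> real" where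
  "poly_abs c = (if c = 0 then 0 else real CARD('a) ^ degree c)"

definition height :: "'a::{finite,field} poly poly \<Rightarrow> real" where
  "height P = Max (insert 0 (poly_abs ` set (coeffs P)))"

definition eval_fls :: "'a::field poly poly \<Rightarrow> 'a fls \<Rightarrow> 'a fls" where
  "eval_fls P \<xi> = poly (map_poly poly_to_fls P) \<xi>"

primrec cf_fin :: "nat \<Rightarrow> (nat \<Rightarrow> 'a::field poly) \<Rightarrow> 'a fls" where
  "cf_fin 0 a = poly_to_fls (a 0)"
| "cf_fin (Suc n) a = poly_to_fls (a 0) + inverse (cf_fin n (\<lambda>i. a (Suc i)))"

definition has_cf :: "'a::{finite,field} fls \<Rightarrow> (nat \<Rightarrow> 'a poly) \<Rightarrow> bool" where
  "has_cf \<xi> a \<longleftrightarrow> (\<lambda>n. fls_abs (\<xi> - cf_fin n a)) \<longlonglongrightarrow> 0"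

definition word_ends :: "(nat \<Rightarrow> 'b list) \<Rightarrow> nat \<Rightarrow> nat" where
  "word_ends W i = (\<Sum>j<i. length (W j))"

definition inf_concat :: "(nat \<Rightarrow> 'b list) \<Rightarrow> nat \<Rightarrow> 'b" where
  "inf_concat W m = (let i = (LEAST i. m < word_ends W (Suc i)) in W i ! (m - word_ends W i))"

definition prepend :: "'b list \<Rightarrow> (nat \<Rightarrow> 'b) \<Rightarrow> nat \<Rightarrow> 'b" where
  "prepend u w m = (if m < length u then u ! m else w (m - length u))"

definition theta_unit :: "nat \<Rightarrow> nat \<Rightarrow> 'a::field \<Rightarrow> nat \<Rightarrow> 'a poly list" where
  "theta_unit p r lam i =
     [:0, 1:] # (if p \<noteq> 2 then concat (replicate ((r ^ i - 1) div 2) [[:0, lam:], [:0, 2 - lam:]])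
                 else replicate (r ^ i - 1) [:0, lam:])"

definition theta_pq :: "nat \<Rightarrow> nat \<Rightarrow> nat \<Rightarrow> 'a::field \<Rightarrow> nat \<Rightarrow> 'a poly" where
  "theta_pq p r k lam =
     prepend (0 # replicate k [:0, 1:])
       (inf_concat (\<lambda>j. concat (replicate (k + 1) (theta_unit p r lam (Suc j)))))"

definition w_exp :: "nat \<Rightarrow> 'a::{finite,field} fls \<Rightarrow> ereal" where
  "w_exp n \<xi> = Sup {ereal w | w. infinite {P :: 'a poly poly. degree P \<le> n \<and>
       0 < fls_abs (eval_fls P \<xi>) \<and> fls_abs (eval_fls P \<xi>) \<le> height P powr (- w)}}"

text \<open>Algebraic elements are taken in an algebraically closed field 'k, given with
  a field embedding emb of F_q((T^-1)) and an absolute value av on 'k extending the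
  absolute value of F_q((T^-1)) (such an extension to the algebraic closure is unique).\<close>

definition ext_setting :: "('a::{finite,field} fls \<Rightarrow> 'k::field) \<Rightarrow> ('k \<Rightarrow> real) \<Rightarrow> bool" where
  "ext_setting emb av \<longleftrightarrow>
     (\<forall>x y. emb (x + y) = emb x + emb y) \<and> (\<forall>x y. emb (x * y) = emb x * emb y) \<and> emb 1 = 1 \<and>
     (\<forall>f :: 'k poly. degree f \<ge> 1 \<longrightarrow> (\<exists>z. poly f z = 0)) \<and>
     (\<forall>x. av x \<ge> 0) \<and> (\<forall>x. av x = 0 \<longleftrightarrow> x = 0) \<and>
     (\<forall>x y. av (x * y) = av x * av y) \<and> (\<forall>x y. av (x + y) \<le> av x + av y) \<and>
     (\<forall>x. av (emb x) = fls_abs x)"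

definition is_minpoly :: "('a::{finite,field} fls \<Rightarrow> 'k::field) \<Rightarrow> 'k \<Rightarrow> 'a poly poly \<Rightarrow> bool" where
  "is_minpoly emb \<alpha> P \<longleftrightarrow> degree P \<ge> 1 \<and> irreducible P \<and>
     (\<forall>c. (\<forall>i. c dvd coeff P i) \<longrightarrow> is_unit c) \<and>
     lead_coeff (lead_coeff P) = 1 \<and>
     poly (map_poly (emb \<circ> poly_to_fls) P) \<alpha> = 0"

definition w_star_exp :: "('a::{finite,field} fls \<Rightarrow> 'k::field) \<Rightarrow> ('k \<Rightarrow> real) \<Rightarrow> nat \<Rightarrow> 'a fls \<Rightarrow> ereal" where
  "w_star_exp emb av n \<xi> = Sup {ereal w | w. infinite {\<alpha> :: 'k. \<exists>P. is_minpoly emb \<alpha> P \<and> degree P \<le> n \<and>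
       0 < av (emb \<xi> - \<alpha>) \<and> av (emb \<xi> - \<alpha>) \<le> height P powr (- w - 1)}}"

end

theory Submission
  imports Defs
begin

text \<open>Truncating the expansion and continuing it periodically gives two families of quadratic
  approximations: one switches to the period (lam T, mu T) after the first letter of a new block, the
  other repeats the block just read. The form of a product of continued fraction matrices gives the
  value at the point, the discriminant and the leading coefficient of the corresponding quadratic
  polynomials in closed form; the heights grow like powers of r.

  Such a sequence determines the exponents. A polynomial of degree at most d which shares no root with
  any member is bounded below through the integrality of its norm at a suitably chosen member. One that
  shares a root is divisible by that member, by Gauss's lemma, and is bounded by induction on the
  degree.\<close>

section \<open>Ultrametric absolute values and polynomials over a finite field\<close>

text \<open>Three growth rates decide everything. Let the leading coefficients, the inverse values
  at the point and the square roots of the discriminants of a family grow like \<open>q\<close> to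
  the powers \<open>A\<close>, \<open>B\<close>, \<open>D\<close> times \<rho>^j. The two roots are
  then about \<open>H powr (D / A - 1)\<close> apart, and the value is \<open>H\<close> times the
  product of the distances to both roots. So polynomials give the exponent \<open>B / A\<close> and
  roots give \<open>(B + D) / A - 1\<close>; bounded discriminants mean a gap of 1 between the two,
  growing ones a smaller gap. The delicate quantity is the leading coefficient of the repeating
  family. The repeated unit and the unit before it end in the same alternating letters, so
  conjugation by the convergent at the start of the group cancels: the size drops by the factor
  \<open>q ^ (2 * r ^ Suc j)\<close>, which is the term \<open>- 2 * r\<close> in the rate
  \<open>A\<close> of that family. The two characteristics merge into one argument, because 2 -
  \<lambda> = \<lambda> when p = 2; the parity of \<open>r\<close> matters only when the two
  alternating letters differ.\<close>

locale ultrametric =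
  fixes v :: "'f::field \<Rightarrow> real"
  assumes nonneg: "v x \<ge> 0"
    and zero_iff: "v x = 0 \<longleftrightarrow> x = 0"
    and mult: "v (x * y) = v x * v y"
    and ultra: "v (x + y) \<le> max (v x) (v y)"
begin

lemma zero [simp]: "v 0 = 0" using zero_iff by simp

lemma one [simp]: "v 1 = 1"
proof -
  have "v 1 * v 1 = v 1" using mult[of 1 1] by simp
  moreover have "v 1 \<noteq> 0" using zero_iff by simp
  ultimately show ?thesis by simp
qed

lemma minus [simp]: "v (- x) = v x"
proof -
  have "v (-1) * v (-1) = 1" using mult[of "-1" "-1"] by simp
  then have "(v (-1))\<^sup>2 = 1" by (simp add: power2_eq_square)
  then have "v (-1) = 1" using nonneg[of "-1"] by (auto simp: power2_eq_1_iff)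
  then show ?thesis using mult[of "-1" x] by simp
qed

lemma ultra_diff: "v (x - y) \<le> max (v x) (v y)"
  using ultra[of x "- y"] by simp

lemma diff_commute: "v (x - y) = v (y - x)"
  using minus[of "x - y"] by simp

lemma power: "v (x ^ n) = v x ^ n"
  by (induction n) (simp_all add: mult)

lemma inverse: "v (inverse x) = inverse (v x)"
proof (cases "x = 0")
  case False
  then have "v x * v (inverse x) = 1" using mult[of x "inverse x"] by simp
  then show ?thesis by (simp add: inverse_unique)
qed simp

lemma divide: "v (x / y) = v x / v y"
  by (simp add: divide_inverse mult inverse)

lemma add_eq: "v y < v x \<Longrightarrow> v (x + y) = v x"
  using ultra[of x y] ultra_diff[of "x + y" y] by auto

lemma add_eq': "v x < v y \<Longrightarrow> v (x + y) = v y"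
  using add_eq[of x y] by (simp add: add.commute)

lemma diff_eq: "v y < v x \<Longrightarrow> v (x - y) = v x"
  using add_eq[of "- y" x] by simp

lemma diff_eq': "v x < v y \<Longrightarrow> v (x - y) = v y"
  using diff_eq[of x y] diff_commute[of x y] by simp

lemma sum_le: "(\<And>i. i \<in> A \<Longrightarrow> v (f i) \<le> B) \<Longrightarrow> 0 \<le> B \<Longrightarrow> v (sum f A) \<le> B"
proof (induction A rule: infinite_finite_induct)
  case (insert a A)
  have "v (sum f (insert a A)) \<le> max (v (f a)) (v (sum f A))"
    using insert.hyps ultra by simp
  with insert show ?case by (metis insertCI max.bounded_iff order_trans)
qed auto

lemma power_diff_le: 
  assumes "v x \<le> 1" "v y \<le> 1"
  shows "v (x ^ n - y ^ n) \<le> v (x - y)"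
proof (induction n)
  case (Suc n)
  have "x ^ Suc n - y ^ Suc n = x * (x ^ n - y ^ n) + (x - y) * y ^ n"
    by (simp add: algebra_simps)
  also have "v \<dots> \<le> max (v x * v (x ^ n - y ^ n)) (v (x - y) * v y ^ n)"
    using ultra[of "x * (x ^ n - y ^ n)" "(x - y) * y ^ n"] by (simp add: mult power)
  also have "\<dots> \<le> v (x - y)"
  proof -
    have "v x * v (x ^ n - y ^ n) \<le> 1 * v (x - y)"
      using Suc assms nonneg by (intro mult_mono) auto
    moreover have "v (x - y) * v y ^ n \<le> v (x - y) * 1"
      using assms nonneg by (intro mult_left_mono power_le_one) auto
    ultimately show ?thesis by simp
  qed
  finally show ?case .
qed (simp add: nonneg)

end

text \<open>An absolute value bounded on the integers is ultrametric because the binomial expansion bounds v (x + y) ^ n by (n + 1) * max (v x) (v y) ^ n.\<close>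

lemma ultrametric_of_triangle:
  fixes v :: "'f::field \<Rightarrow> real"
  assumes nonneg: "\<And>x. v x \<ge> 0" and zero_iff: "\<And>x. v x = 0 \<longleftrightarrow> x = 0"
    and mult: "\<And>x y. v (x * y) = v x * v y" and tri: "\<And>x y. v (x + y) \<le> v x + v y"
    and nat: "\<And>n. v (of_nat n) \<le> 1"
  shows "ultrametric v"
proof
  fix x y
  show "v x \<ge> 0" "v x = 0 \<longleftrightarrow> x = 0" "v (x * y) = v x * v y" by fact+
  define M where "M = max (v x) (v y)"
  have M0: "M \<ge> 0" using nonneg[of x] by (simp add: M_def)
  have one: "v 1 = 1" using mult[of 1 1] zero_iff[of 1] by simp
  have pow: "v (z ^ n) = v z ^ n" for z n by (induction n) (simp_all add: one mult)
  have vsum: "v (sum f A) \<le> (\<Sum>i\<in>A. v (f i))" if "finite A" for f and A :: "nat set"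
    using that
  proof induction
    case empty
    then show ?case using zero_iff[of 0] by simp
  next
    case (insert a A)
    then show ?case using tri[of "f a" "sum f A"] by simp
  qed
  have key: "v (x + y) ^ n \<le> real (n + 1) * M ^ n" for n
  proof -
    have "v (x + y) ^ n = v (\<Sum>k\<le>n. of_nat (n choose k) * x ^ k * y ^ (n - k))"
      by (simp add: pow[symmetric] binomial_ring)
    also have "\<dots> \<le> (\<Sum>k\<le>n. v (of_nat (n choose k) * x ^ k * y ^ (n - k)))"
      by (rule vsum) simp
    also have "\<dots> \<le> (\<Sum>k\<le>n. M ^ n)"
    proof (rule sum_mono)
      fix k assume "k \<in> {..n}"
      then have k: "k \<le> n" by simp
      have "v (of_nat (n choose k) * x ^ k * y ^ (n - k))
          = v (of_nat (n choose k)) * (v x ^ k * v y ^ (n - k))"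
        by (simp add: mult pow)
      also have "\<dots> \<le> 1 * (M ^ k * M ^ (n - k))"
        using nonneg nat M0 by (intro mult_mono power_mono) (auto simp: M_def)
      also have "\<dots> = M ^ n" using k by (simp add: power_add[symmetric])
      finally show "v (of_nat (n choose k) * x ^ k * y ^ (n - k)) \<le> M ^ n" .
    qed
    finally show ?thesis by simp
  qed
  show "v (x + y) \<le> max (v x) (v y)"
  proof (rule ccontr)
    assume "\<not> ?thesis"
    then have lt: "M < v (x + y)" unfolding M_def by linarith
    show False
    proof (cases "M = 0")
      case True
      then show False using key[of 1] lt by simp
    next
      case False
      then have Mp: "M > 0" using M0 by simp
      define c where "c = v (x + y) / M"
      have c1: "c > 1" using lt Mp by (simp add: c_def)
      have "c ^ n \<le> real (n + 1)" for n
        using key[of n] Mp by (simp add: c_def power_divide divide_le_eq)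
      moreover have "(\<lambda>n. real n / c ^ n) \<longlonglongrightarrow> 0"
        using lim_n_over_pown[of c] c1 by simp
      moreover have "(\<lambda>n. 1 / c ^ n) \<longlonglongrightarrow> 0"
        using LIMSEQ_inverse_realpow_zero[of c] c1 by (simp add: inverse_eq_divide)
      ultimately have "\<exists>n. real n / c ^ n + 1 / c ^ n < 1"
      proof -
        assume "(\<lambda>n. real n / c ^ n) \<longlonglongrightarrow> 0" "(\<lambda>n. 1 / c ^ n) \<longlonglongrightarrow> 0"
        from tendsto_add[OF this] have "eventually (\<lambda>n. real n / c ^ n + 1 / c ^ n < 1) sequentially"
          by (intro order_tendstoD(2)) auto
        then show ?thesis by (rule eventually_happens'[rotated]) simp
      qed
      then obtain n where "real n / c ^ n + 1 / c ^ n < 1" by blast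
      then have "real (n + 1) < c ^ n" using c1 by (simp add: field_simps)
      with \<open>\<And>n. c ^ n \<le> real (n + 1)\<close> show False by (meson not_less)
    qed
  qed
qed

section \<open>The absolute value on Laurent series and on polynomials\<close>

lemma card_ge2: "CARD('a::{finite,field}) \<ge> 2"
proof -
  have "card {0, 1::'a} \<le> CARD('a)" by (rule card_mono) auto
  then show ?thesis by simp
qed

lemma fls_abs_ultrametric: "ultrametric (fls_abs :: 'a::{finite,field} fls \<Rightarrow> real)"
proof
  fix x y :: "'a fls"
  have q: "real CARD('a) > 1" using card_ge2[where 'a='a] by simp
  show "fls_abs x \<ge> 0" "fls_abs x = 0 \<longleftrightarrow> x = 0" by (auto simp: fls_abs_def)
  show "fls_abs (x * y) = fls_abs x * fls_abs y"
    by (auto simp: fls_abs_def powr_add[symmetric])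
  show "fls_abs (x + y) \<le> max (fls_abs x) (fls_abs y)"
  proof (cases "x = 0 \<or> y = 0 \<or> x + y = 0")
    case True
    then show ?thesis by (auto simp: fls_abs_def le_max_iff_disj)
  next
    case False
    then have "fls_subdegree (x + y) \<ge> min (fls_subdegree x) (fls_subdegree y)"
      by (meson fls_plus_subdegree)
    then have "fls_subdegree (x + y) \<ge> fls_subdegree x \<or> fls_subdegree (x + y) \<ge> fls_subdegree y"
      by auto
    then show ?thesis using False q by (auto simp: fls_abs_def le_max_iff_disj)
  qed
qed

interpretation fls: ultrametric "fls_abs :: 'a::{finite,field} fls \<Rightarrow> real"
  by (rule fls_abs_ultrametric)

lemma poly_to_fls_0 [simp]: "poly_to_fls 0 = 0"
  by (simp add: poly_to_fls_def)

lemma poly_to_fls_pCons: "poly_to_fls (pCons a p) = fls_const a + fls_X_inv * poly_to_fls p"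
  by (simp add: poly_to_fls_def map_poly_pCons)

lemma poly_to_fls_add: "poly_to_fls (a + b) = poly_to_fls a + poly_to_fls b"
  by (induction a b rule: poly_induct2)
    (simp_all add: poly_to_fls_pCons algebra_simps fls_plus_const)

lemma poly_to_fls_smult: "poly_to_fls (smult c p) = fls_const c * poly_to_fls p"
  by (induction p) (simp_all add: poly_to_fls_pCons algebra_simps fls_const_mult_const)

lemma poly_to_fls_mult: "poly_to_fls (a * b) = poly_to_fls a * poly_to_fls b"
  by (induction a) (simp_all add: poly_to_fls_pCons poly_to_fls_add poly_to_fls_smult algebra_simps)

lemma poly_to_fls_1 [simp]: "poly_to_fls 1 = 1"
  by (simp add: one_pCons poly_to_fls_pCons del: pCons_one)

lemma poly_abs_0 [simp]: "poly_abs 0 = 0" by (simp add: poly_abs_def)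

lemma poly_abs_1 [simp]: "poly_abs 1 = 1" by (simp add: poly_abs_def)

lemma fls_abs_const: "fls_abs (fls_const a :: 'a::{finite,field} fls) = (if a = 0 then 0 else 1)"
  by (simp add: fls_abs_def)

lemma fls_abs_X_inv: "fls_abs (fls_X_inv :: 'a::{finite,field} fls) = real CARD('a)"
  by (simp add: fls_abs_def)

lemma fls_abs_poly: "fls_abs (poly_to_fls c) = poly_abs (c :: 'a::{finite,field} poly)"
proof (induction c)
  case (pCons a p)
  have q: "real CARD('a) > 1" using card_ge2[where 'a='a] by simp
  show ?case
  proof (cases "p = 0")
    case True
    then show ?thesis by (simp add: poly_to_fls_pCons fls_abs_const poly_abs_def)
  next
    case False
    have "real CARD('a) * real CARD('a) ^ degree p > 1"
      using q by (metis less_1_mult mult.right_neutral one_less_power zero_less_iff_neq_zero power_0)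
    then have "fls_abs (fls_const a) < fls_abs (fls_X_inv * poly_to_fls p)"
      using pCons.IH False by (simp add: fls_abs_const fls.mult fls_abs_X_inv poly_abs_def)
    then show ?thesis using pCons.IH False
      by (simp add: poly_to_fls_pCons fls.add_eq' fls.mult fls_abs_X_inv poly_abs_def)
  qed
qed (simp add: fls_abs_def)

lemma poly_abs_mult: "poly_abs (a * b) = poly_abs a * poly_abs b"
  by (metis fls_abs_poly fls.mult poly_to_fls_mult)

lemma poly_abs_nonneg [simp]: "poly_abs a \<ge> 0"
  by (simp add: poly_abs_def)

lemma poly_abs_ge_1: "a \<noteq> 0 \<Longrightarrow> poly_abs a \<ge> 1"
  unfolding poly_abs_def using card_ge2[where 'a='a] by (simp add: one_le_power)

lemma poly_abs_eq_0 [simp]: "poly_abs a = 0 \<longleftrightarrow> a = 0"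
  using poly_abs_ge_1[of a] by (auto simp: poly_abs_def)

section \<open>Heights and Northcott finiteness\<close>

lemma coeff_le_height: "poly_abs (coeff P i) \<le> height P"
proof (cases "coeff P i = 0")
  case True
  then show ?thesis unfolding height_def by (simp add: Max_ge)
next
  case False
  then have "coeff P i \<in> set (coeffs P)"
    using range_coeff by fastforce
  then show ?thesis unfolding height_def by (intro Max_ge) auto
qed

lemma height_leI: "0 \<le> B \<Longrightarrow> (\<And>i. poly_abs (coeff P i) \<le> B) \<Longrightarrow> height P \<le> B"
  unfolding height_def by (auto simp: coeffs_def)

lemma height_attained: "P \<noteq> 0 \<Longrightarrow> \<exists>i. poly_abs (coeff P i) = height P"
proof -
  assume "P \<noteq> 0"
  have "height P \<in> insert 0 (poly_abs ` set (coeffs P))"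
    unfolding height_def by (rule Max_in) auto
  then consider "height P = 0" | "height P \<in> poly_abs ` set (coeffs P)" by auto
  then show ?thesis
  proof cases
    case 1
    with coeff_le_height[of P "degree P"] \<open>P \<noteq> 0\<close> show ?thesis
      by (metis leading_coeff_0_iff poly_abs_eq_0 poly_abs_nonneg order_antisym)
  next
    case 2
    then show ?thesis by (auto simp: coeffs_def split: if_splits)
  qed
qed

lemma height_ge_1: "P \<noteq> 0 \<Longrightarrow> height P \<ge> 1"
  by (metis coeff_le_height leading_coeff_0_iff order_trans poly_abs_ge_1)

lemma finite_degree_le: "finite {c :: 'a::{finite,zero} poly. degree c \<le> n}"
proof -
  have "{c :: 'a poly. degree c \<le> n} \<subseteq> Poly ` {xs. set xs \<subseteq> UNIV \<and> length xs \<le> Suc n}"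
  proof
    fix c :: "'a poly" assume "c \<in> {c. degree c \<le> n}"
    then have "length (coeffs c) \<le> Suc n" by (cases "c = 0") (auto simp: length_coeffs)
    then show "c \<in> Poly ` {xs. set xs \<subseteq> UNIV \<and> length xs \<le> Suc n}"
      by (intro image_eqI[of _ _ "coeffs c"]) auto
  qed
  then show ?thesis using finite_lists_length_le[of "UNIV :: 'a set" "Suc n"]
    by (meson finite finite_imageI finite_subset)
qed

lemma finite_poly_abs_le: "finite {c :: 'a::{finite,field} poly. poly_abs c \<le> B}"
proof -
  have q: "real CARD('a) > 1" using card_ge2[where 'a='a] by simp
  obtain n where n: "B < real CARD('a) ^ n" using real_arch_pow[OF q] by blast
  have "{c :: 'a poly. poly_abs c \<le> B} \<subseteq> {c. degree c \<le> n}"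
  proof safe
    fix c :: "'a poly" assume c: "poly_abs c \<le> B"
    show "degree c \<le> n"
    proof (cases "c = 0")
      case False
      then have "real CARD('a) ^ degree c < real CARD('a) ^ n" using c n by (simp add: poly_abs_def)
      then show ?thesis using q by (meson less_imp_le power_less_imp_less_exp)
    qed simp
  qed
  then show ?thesis using finite_degree_le finite_subset by blast
qed

text \<open>Northcott's property. It turns every lower bound for values or distances in terms of the
  height into finiteness of the sets behind the exponents.\<close>

lemma finite_height_le: "finite {P :: 'a::{finite,field} poly poly. degree P \<le> n \<and> height P \<le> B}"
proof -
  let ?S = "{c :: 'a poly. poly_abs c \<le> B}"
  have "{P :: 'a poly poly. degree P \<le> n \<and> height P \<le> B}
      \<subseteq> Poly ` {xs. set xs \<subseteq> ?S \<and> length xs \<le> Suc n}"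
  proof
    fix P :: "'a poly poly" assume P: "P \<in> {P. degree P \<le> n \<and> height P \<le> B}"
    then have "length (coeffs P) \<le> Suc n" by (cases "P = 0") (auto simp: length_coeffs)
    moreover have "set (coeffs P) \<subseteq> ?S"
    proof
      fix c assume "c \<in> set (coeffs P)"
      then obtain i where "c = coeff P i" by (auto simp: coeffs_def split: if_splits)
      then show "c \<in> ?S" using P coeff_le_height[of P i] by auto
    qed
    ultimately show "P \<in> Poly ` {xs. set xs \<subseteq> ?S \<and> length xs \<le> Suc n}"
      by (intro image_eqI[of _ _ "coeffs P"]) auto
  qed
  moreover have "finite {xs. set xs \<subseteq> ?S \<and> length xs \<le> Suc n}"
    by (rule finite_lists_length_le[OF finite_poly_abs_le])
  ultimately show ?thesis by (rule finite_subset[OF _ finite_imageI])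
qed

section \<open>Primitive polynomials and Gauss's lemma\<close>

definition primitive :: "'a::comm_ring_1 poly \<Rightarrow> bool" where
  "primitive P \<longleftrightarrow> (\<forall>c. (\<forall>i. c dvd coeff P i) \<longrightarrow> c dvd 1)"

text \<open>Gauss's lemma in divisibility form. The constant \<open>c\<close> is stripped of one
  irreducible factor at a time: such a factor stays prime as a constant polynomial, cannot divide
  the primitive \<open>R\<close>, and therefore divides the cofactor.\<close>

lemma dvd_of_dvd_smult:
  fixes P R :: "'a::field poly poly"
  assumes "primitive R" "c \<noteq> 0" "R dvd smult c P"
  shows "R dvd P"
  using assms(2,3)
proof (induction "degree c" arbitrary: c P rule: less_induct)
  case less
  show ?case
  proof (cases "degree c = 0")
    case True
    then obtain a where a: "c = [:a:]" "a \<noteq> 0" using less.prems(1) by (auto elim: degree_eq_zeroE)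
    have "smult [:inverse a:] (smult c P) = P" using a by (simp add: pCons_one)
    moreover have "R dvd smult [:inverse a:] (smult c P)"
      using less.prems(2) by (rule dvd_smult)
    ultimately show ?thesis by metis
  next
    case False
    \<comment> \<open>A divisor of \<open>c\<close> of least positive degree is irreducible, since a
      proper factor of it would be a smaller one.\<close>
    define e where "e = (LEAST n. \<exists>b. b dvd c \<and> degree b = n \<and> n > 0)"
    have ex: "\<exists>n. \<exists>b. b dvd c \<and> degree b = n \<and> n > 0"
      using False by (intro exI[of _ "degree c"] exI[of _ c]) auto
    from LeastI_ex[OF ex] obtain \<pi> where \<pi>: "\<pi> dvd c" "degree \<pi> = e" "e > 0"
      unfolding e_def by blast
    have least: "e \<le> degree b" if "b dvd c" "degree b > 0" for b
      unfolding e_def using that by (intro Least_le) auto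
    have \<pi>0: "\<pi> \<noteq> 0" using \<pi> by auto
    have "irreducible \<pi>"
    proof (rule irreducibleI)
      show "\<pi> \<noteq> 0" by fact
      show "\<not> \<pi> dvd 1" using \<pi> \<pi>0 by (simp add: is_unit_iff_degree)
      fix a b assume ab: "\<pi> = a * b"
      show "a dvd 1 \<or> b dvd 1"
      proof (rule ccontr)
        assume "\<not> ?thesis"
        moreover have "a \<noteq> 0" "b \<noteq> 0" using ab \<pi>0 by auto
        ultimately have "degree a > 0" "degree b > 0" by (auto simp: is_unit_iff_degree)
        moreover have "degree \<pi> = degree a + degree b"
          using ab \<open>a \<noteq> 0\<close> \<open>b \<noteq> 0\<close> by (simp add: degree_mult_eq)
        moreover have "a dvd c" using ab \<pi>(1) by (metis dvd_mult_left)
        ultimately show False using least[of a] \<pi>(2) by simp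
      qed
    qed
    then have "prime_elem \<pi>" by (rule field_poly_irreducible_imp_prime)
    then have pr: "prime_elem [:\<pi>:]" by (rule lift_prime_elem_poly)
    obtain c' where c': "c = \<pi> * c'" using \<pi>(1) by (elim dvdE)
    obtain Q where Q: "smult c P = R * Q" using less.prems(2) by (elim dvdE)
    have "[:\<pi>:] dvd smult c P" by (simp add: const_poly_dvd_iff c')
    then have "[:\<pi>:] dvd R \<or> [:\<pi>:] dvd Q" using Q pr by (simp add: prime_elem_dvd_mult_iff)
    moreover have "\<not> [:\<pi>:] dvd R"
    proof
      assume "[:\<pi>:] dvd R"
      then have "\<pi> dvd 1" using assms(1) by (simp add: primitive_def const_poly_dvd_iff)
      then show False using \<pi> is_unit_iff_degree[OF \<pi>0] by simp
    qed
    ultimately have "[:\<pi>:] dvd Q" by blast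
    then obtain Q' where Q': "Q = [:\<pi>:] * Q'" by (elim dvdE)
    have "smult \<pi> (smult c' P - R * Q') = 0" using Q unfolding Q' c' by (simp add: smult_diff_right)
    then have "smult c' P = R * Q'" using \<pi>0 by simp
    then have "R dvd smult c' P" by simp
    moreover have "c' \<noteq> 0" using c' less.prems(1) by auto
    moreover have "degree c' < degree c"
      using c' \<pi> \<pi>0 \<open>c' \<noteq> 0\<close> by (simp add: degree_mult_eq)
    ultimately show ?thesis using less.hyps by blast
  qed
qed

text \<open>The content is taken as a common divisor of greatest degree; a non-unit common divisor
  of the quotient would raise that degree.\<close>

lemma primitive_part_exists:
  fixes P :: "'a::field poly poly"
  assumes "P \<noteq> 0"
  obtains g R where "g \<noteq> 0" "P = smult g R" "primitive R"
proof -
  let ?D = "\<lambda>c. \<forall>i. c dvd coeff P i"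
  obtain i0 where i0: "coeff P i0 \<noteq> 0" using assms by (metis leading_coeff_0_iff)
  have bound: "degree c \<le> degree (coeff P i0)" if "?D c" for c
    using that i0 by (auto intro: dvd_imp_degree_le)
  have "?D 1" by simp
  then obtain g where g: "?D g" "\<And>c. ?D c \<Longrightarrow> degree c \<le> degree g"
    using ex_has_greatest_nat[of ?D 1 degree "Suc (degree (coeff P i0))"] bound
    by (meson less_Suc_eq_le)
  have g0: "g \<noteq> 0" using g(1) i0 by auto
  from g(1) have "[:g:] dvd P" by (simp add: const_poly_dvd_iff)
  then obtain R where R: "P = smult g R" by (auto elim: dvdE)
  have "primitive R" unfolding primitive_def
  proof safe
    fix c assume c: "\<forall>i. c dvd coeff R i"
    then have "?D (g * c)" using R by (simp add: mult_dvd_mono)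
    then have "degree (g * c) \<le> degree g" by (rule g(2))
    moreover have "c \<noteq> 0" using c i0 R by auto
    ultimately show "is_unit c" using g0 by (simp add: degree_mult_eq is_unit_iff_degree)
  qed
  with g0 R show ?thesis using that by blast
qed

section \<open>Polynomials over an extension with absolute value\<close>

text \<open>Two instances are intended: the Laurent series field with \<open>poly_to_fls\<close>,
  where values at the point are computed, and the algebraically closed field with
  \<open>poly_emb\<close>, where the roots live.\<close>

locale poly_valued = ultrametric v for v :: "'k::field \<Rightarrow> real" +
  fixes \<iota> :: "'a::{finite,field} poly \<Rightarrow> 'k"
  assumes \<iota>_add: "\<iota> (a + b) = \<iota> a + \<iota> b"
    and \<iota>_mult: "\<iota> (a * b) = \<iota> a * \<iota> b"
    and \<iota>_1 [simp]: "\<iota> 1 = 1"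
    and v_\<iota>: "v (\<iota> c) = poly_abs c"
begin

lemma \<iota>_0 [simp]: "\<iota> 0 = 0"
  by (metis \<iota>_add add_0 add_cancel_right_right)

lemma \<iota>_minus: "\<iota> (- a) = - \<iota> a"
  using \<iota>_add[of a "- a"] by (simp add: eq_neg_iff_add_eq_0 add.commute)

lemma \<iota>_diff: "\<iota> (a - b) = \<iota> a - \<iota> b"
  using \<iota>_add[of a "- b"] by (simp add: \<iota>_minus)

lemma \<iota>_power: "\<iota> (a ^ n) = \<iota> a ^ n"
  by (induction n) (simp_all add: \<iota>_mult)

lemma \<iota>_eq_0_iff [simp]: "\<iota> a = 0 \<longleftrightarrow> a = 0"
  using v_\<iota>[of a] by (metis poly_abs_eq_0 zero_iff)

lemma \<iota>_of_nat: "\<iota> (of_nat n) = of_nat n"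
  by (induction n) (simp_all add: \<iota>_add)

lemma \<iota>_numeral: "\<iota> (numeral n) = numeral n"
  using \<iota>_of_nat[of "numeral n"] by simp

definition ev :: "'a poly poly \<Rightarrow> 'k \<Rightarrow> 'k" where
  "ev P z = poly (map_poly \<iota> P) z"

lemma ev_0 [simp]: "ev 0 z = 0" by (simp add: ev_def)

lemma ev_pCons [simp]: "ev (pCons a P) z = \<iota> a + z * ev P z"
  by (simp add: ev_def map_poly_pCons)

lemma ev_add: "ev (P + Q) z = ev P z + ev Q z"
  by (induction P Q rule: poly_induct2) (simp_all add: \<iota>_add algebra_simps)

lemma ev_smult: "ev (smult c P) z = \<iota> c * ev P z"
  by (induction P) (simp_all add: \<iota>_mult algebra_simps)

lemma ev_mult: "ev (P * Q) z = ev P z * ev Q z"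
  by (induction P) (simp_all add: ev_add ev_smult algebra_simps)

lemma degree_map_\<iota>: "degree (map_poly \<iota> P) = degree P"
  by (rule degree_map_poly) simp

lemma ev_sum: "ev P z = (\<Sum>i\<le>degree P. \<iota> (coeff P i) * z ^ i)"
  by (simp add: ev_def poly_altdef degree_map_\<iota> coeff_map_poly)

lemma height_nonneg [simp]: "height (P :: 'a poly poly) \<ge> 0"
  using coeff_le_height[of P 0] poly_abs_nonneg order_trans by blast

text \<open>On the unit ball all differences of powers are at most the difference of the arguments,
  so the height is a Lipschitz constant; the strong triangle inequality avoids any factor depending
  on the degree.\<close>

lemma v_ev_diff_le:
  assumes "v z \<le> 1" "v y \<le> 1"
  shows "v (ev P z - ev P y) \<le> height P * v (z - y)"
proof -
  have "ev P z - ev P y = (\<Sum>i\<le>degree P. \<iota> (coeff P i) * (z ^ i - y ^ i))"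
    by (simp add: ev_sum sum_subtractf right_diff_distrib)
  moreover have "v (\<Sum>i\<le>degree P. \<iota> (coeff P i) * (z ^ i - y ^ i)) \<le> height P * v (z - y)"
  proof (rule sum_le)
    fix i
    show "v (\<iota> (coeff P i) * (z ^ i - y ^ i)) \<le> height P * v (z - y)"
      unfolding mult v_\<iota> using assms coeff_le_height nonneg
      by (intro mult_mono power_diff_le) auto
  qed (simp add: nonneg)
  ultimately show ?thesis by simp
qed

section \<open>Integrality of traces and norms of a quadratic element\<close>

text \<open>Newton's recursion for the power sums of \<alpha> and \<beta>, multiplied through by
  \<open>l ^ e\<close>; the hypotheses are Vieta's formulas for \<open>[:c, b, l:]\<close>.\<close>

lemma trace_integral:
  assumes b: "\<iota> b = - (\<iota> l * (\<alpha> + \<beta>))" and c: "\<iota> c = \<iota> l * (\<alpha> * \<beta>)"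
  shows "\<exists>N. \<iota> N = \<iota> l ^ e * (\<alpha> ^ e + \<beta> ^ e)"
proof (induction e rule: less_induct)
  case (less e)
  consider "e = 0" | "e = 1" | e' where "e = Suc (Suc e')"
    by (metis One_nat_def not0_implies_Suc)
  then show ?case
  proof cases
    case 1
    have "\<iota> 2 = 2" by (rule \<iota>_numeral)
    then show ?thesis using 1 by auto
  next
    case 2
    have "\<iota> (- b) = \<iota> l ^ e * (\<alpha> ^ e + \<beta> ^ e)" using 2 b by (simp add: \<iota>_minus)
    then show ?thesis by blast
  next
    case 3
    obtain N1 N0 where N: "\<iota> N1 = \<iota> l ^ Suc e' * (\<alpha> ^ Suc e' + \<beta> ^ Suc e')"
      "\<iota> N0 = \<iota> l ^ e' * (\<alpha> ^ e' + \<beta> ^ e')"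
      using less 3 by (metis lessI less_SucI)
    have "\<iota> (- b * N1 - l * c * N0) = \<iota> l ^ e * (\<alpha> ^ e + \<beta> ^ e)"
      unfolding \<iota>_diff \<iota>_mult \<iota>_minus b c N 3 by (simp add: algebra_simps)
    then show ?thesis by blast
  qed
qed

text \<open>The extra factors \<open>\<alpha> ^ e\<close> and \<open>\<beta> ^ e\<close> absorb the
  multiplication by the argument that each Horner step of the induction produces.\<close>

lemma trace_poly_integral:
  assumes bc: "\<iota> b = - (\<iota> l * (\<alpha> + \<beta>))" "\<iota> c = \<iota> l * (\<alpha> * \<beta>)"
    and "degree P + e \<le> M"
  shows "\<exists>N. \<iota> N = \<iota> l ^ M * (\<alpha> ^ e * ev P \<alpha> + \<beta> ^ e * ev P \<beta>)"
  using assms(3)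
proof (induction P arbitrary: e)
  case 0
  have "\<iota> 0 = \<iota> l ^ M * (\<alpha> ^ e * ev 0 \<alpha> + \<beta> ^ e * ev 0 \<beta>)" by simp
  then show ?case by blast
next
  case (pCons a P)
  have "\<exists>N. \<iota> N = \<iota> l ^ M * (\<alpha> ^ Suc e * ev P \<alpha> + \<beta> ^ Suc e * ev P \<beta>)"
  proof (cases "P = 0")
    case True
    have "\<iota> 0 = \<iota> l ^ M * (\<alpha> ^ Suc e * ev P \<alpha> + \<beta> ^ Suc e * ev P \<beta>)" using True by simp
    then show ?thesis by blast
  next
    case False
    then show ?thesis using pCons by (intro pCons.IH) auto
  qed
  then obtain N1 where N1: "\<iota> N1 = \<iota> l ^ M * (\<alpha> ^ Suc e * ev P \<alpha> + \<beta> ^ Suc e * ev P \<beta>)" ..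
  obtain N0 where N0: "\<iota> N0 = \<iota> l ^ e * (\<alpha> ^ e + \<beta> ^ e)" using trace_integral[OF bc] by blast
  obtain f where M: "M = e + f" using pCons.prems by (metis add_leD2 le_Suc_ex)
  have "\<iota> (a * l ^ f * N0 + N1) = \<iota> l ^ M * (\<alpha> ^ e * ev (pCons a P) \<alpha> + \<beta> ^ e * ev (pCons a P) \<beta>)"
    unfolding \<iota>_add \<iota>_mult N0 N1 \<iota>_power M by (simp add: algebra_simps power_add)
  then show ?case by blast
qed

text \<open>One Horner step multiplies out (a + \<alpha> P(\<alpha>)) (a + \<beta> P(\<beta>)): the
  mixed term is a trace, the last one is \<alpha>\<beta> times a norm of lower degree.
  \<open>M\<close> may exceed the degree, so that one power of \<open>l\<close> serves all
  polynomials of degree at most \<open>d\<close>.\<close>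

lemma norm_integral:
  assumes bc: "\<iota> b = - (\<iota> l * (\<alpha> + \<beta>))" "\<iota> c = \<iota> l * (\<alpha> * \<beta>)"
    and "degree P \<le> M"
  shows "\<exists>N. \<iota> N = \<iota> l ^ M * (ev P \<alpha> * ev P \<beta>)"
  using assms(3)
proof (induction P arbitrary: M)
  case 0
  have "\<iota> 0 = \<iota> l ^ M * (ev 0 \<alpha> * ev 0 \<beta>)" by simp
  then show ?case by blast
next
  case (pCons a P)
  show ?case
  proof (cases "P = 0")
    case True
    have "\<iota> (l ^ M * a * a) = \<iota> l ^ M * (ev (pCons a P) \<alpha> * ev (pCons a P) \<beta>)"
      using True by (simp add: \<iota>_mult \<iota>_power)
    then show ?thesis by blast
  next
    case False
    then obtain M' where M: "M = Suc M'" using pCons.prems by (cases M) auto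
    obtain N2 where N2: "\<iota> N2 = \<iota> l ^ M' * (ev P \<alpha> * ev P \<beta>)"
      using pCons.IH[of M'] pCons.prems False M by auto
    have "degree P + 1 \<le> M" using pCons.prems False by simp
    then obtain N1 where N1: "\<iota> N1 = \<iota> l ^ M * (\<alpha> ^ 1 * ev P \<alpha> + \<beta> ^ 1 * ev P \<beta>)"
      using trace_poly_integral[OF bc] by blast
    have "\<iota> (l ^ M * a * a + a * N1 + c * N2) = \<iota> l ^ M * (ev (pCons a P) \<alpha> * ev (pCons a P) \<beta>)"
      unfolding \<iota>_add \<iota>_mult N1 N2 \<iota>_power bc M by (simp add: algebra_simps)
    then show ?thesis by blast
  qed
qed

text \<open>An irreducible quadratic polynomial divides every polynomial with which it shares a root:
  otherwise pseudo-division would produce a linear factor.\<close>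

lemma dvd_of_common_root:
  assumes R: "degree R = 2" "irreducible R" "primitive R" and "ev R \<alpha> = 0" and "ev P \<alpha> = 0"
  shows "R dvd P"
proof -
  have R0: "R \<noteq> 0" using R by auto
  obtain Q S where QS: "pseudo_divmod P R = (Q, S)" by fastforce
  define m where "m = coeff R (degree R) ^ (Suc (degree P) - degree R)"
  have eq: "smult m P = R * Q + S" and dS: "S = 0 \<or> degree S < degree R"
    using pseudo_divmod[OF R0 QS] by (auto simp: m_def)
  have m0: "m \<noteq> 0" using R0 by (simp add: m_def)
  have evS: "ev S \<alpha> = 0"
    using arg_cong[OF eq, of "\<lambda>p. ev p \<alpha>"] assms by (simp add: ev_smult ev_add ev_mult)
  show ?thesis
  proof (cases "S = 0")
    case True
    then have "R dvd smult m P" using eq by simp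
    then show ?thesis by (rule dvd_of_dvd_smult[OF R(3) m0])
  next
    case False
    obtain g S0 where S0: "g \<noteq> 0" "S = smult g S0" "primitive S0"
      using primitive_part_exists[OF False] by blast
    have S00: "S0 \<noteq> 0" using False S0 by auto
    have ev0: "ev S0 \<alpha> = 0" using evS S0 by (simp add: ev_smult)
    have "degree S0 \<noteq> 0"
    proof
      assume "degree S0 = 0"
      then obtain a where "S0 = [:a:]" by (auto elim: degree_eq_zeroE)
      then show False using ev0 S00 by simp
    qed
    then have d1: "degree S0 = 1" using dS False S0 R by auto
    \<comment> \<open>Dividing \<open>R\<close> by the linear \<open>S0\<close> leaves a constant
      remainder, which vanishes because \<alpha> is a common root.\<close>
    obtain Q' S' where QS': "pseudo_divmod R S0 = (Q', S')" by fastforce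
    define n where "n = coeff S0 (degree S0) ^ (Suc (degree R) - degree S0)"
    have eq': "smult n R = S0 * Q' + S'" and dS': "S' = 0 \<or> degree S' < degree S0"
      using pseudo_divmod[OF S00 QS'] by (auto simp: n_def)
    have n0: "n \<noteq> 0" using S00 by (simp add: n_def)
    have "ev S' \<alpha> = 0"
      using arg_cong[OF eq', of "\<lambda>p. ev p \<alpha>"] assms ev0 by (simp add: ev_smult ev_add ev_mult)
    moreover obtain a where "S' = [:a:]" using dS' d1 by (auto elim: degree_eq_zeroE)
    ultimately have "S' = 0" by simp
    then have "S0 dvd smult n R" using eq' by simp
    then have "S0 dvd R" by (rule dvd_of_dvd_smult[OF S0(3) n0])
    then obtain T where T: "R = S0 * T" by (elim dvdE)
    then have "S0 dvd 1 \<or> T dvd 1" using irreducibleD[OF R(2)] by blast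
    moreover have "degree T = 1" using T R d1 R0 by (auto simp: degree_mult_eq)
    ultimately have False using d1 by (auto simp: is_unit_poly_iff)
    then show ?thesis ..
  qed
qed

text \<open>Half of the multiplicativity of the Gauss norm. At the last index \<open>i\<close> where
  \<open>Q\<close> attains its height, the coefficient \<open>i + 2\<close> of the product is
  dominated by the leading coefficient of \<open>R\<close> times that of \<open>Q\<close>.\<close>

lemma height_mult_ge:
  assumes "degree R = 2" "height R = poly_abs (lead_coeff R)" "Q \<noteq> (0 :: 'a poly poly)"
  shows "height Q * height R \<le> height (Q * R)"
proof -
  have H0: "height Q > 0" using height_ge_1[OF assms(3)] by simp
  have R0: "height R > 0"
  proof -
    have "R \<noteq> 0" using assms by auto
    then show ?thesis using height_ge_1[of R] by simp
  qed
  let ?S = "{i. poly_abs (coeff Q i) = height Q}"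
  have "?S \<subseteq> {..degree Q}"
    using H0 by (auto intro!: le_degree)
  then have fin: "finite ?S" using finite_subset by blast
  have ne: "?S \<noteq> {}" using height_attained[OF assms(3)] by blast
  define i where "i = Max ?S"
  have i: "poly_abs (coeff Q i) = height Q" using Max_in[OF fin ne] by (simp add: i_def)
  have less: "poly_abs (coeff Q j) < height Q" if "j > i" for j
  proof -
    have "j \<notin> ?S" using that Max_ge[OF fin] unfolding i_def by (meson leD)
    then show ?thesis using coeff_le_height[of Q j] by simp
  qed
  obtain l b c where Rc: "R = [:c, b, l:]"
  proof -
    have "R = [:coeff R 0, coeff R 1, coeff R 2:]"
      by (rule poly_eqI) (use assms(1) in \<open>auto simp: coeff_pCons numeral_2_eq_2 coeff_eq_0 split: nat.splits\<close>)
    then show ?thesis using that by blast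
  qed
  have l: "poly_abs l = height R" using assms(1,2) Rc by (auto simp: numeral_2_eq_2 split: if_splits)
  have bc: "poly_abs b \<le> height R" "poly_abs c \<le> height R"
    using coeff_le_height[of R 1] coeff_le_height[of R 0] Rc by auto
  have "Q * R = smult c Q + pCons 0 (smult b Q + pCons 0 (smult l Q))"
    unfolding Rc by (simp add: algebra_simps mult.commute[of Q])
  then have co: "coeff (Q * R) (Suc (Suc i)) = c * coeff Q (Suc (Suc i)) + (b * coeff Q (Suc i) + l * coeff Q i)"
    by simp
  have lt: "poly_abs (s * coeff Q j) < poly_abs (l * coeff Q i)" if "poly_abs s \<le> height R" "j > i" for s j
  proof -
    have "poly_abs s * poly_abs (coeff Q j) \<le> height R * poly_abs (coeff Q j)"
      using that by (intro mult_right_mono) auto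
    also have "\<dots> < height R * height Q" using less[OF that(2)] R0 by simp
    finally show ?thesis by (simp add: poly_abs_mult l i)
  qed
  have "v (\<iota> (coeff (Q * R) (Suc (Suc i)))) = v (\<iota> (l * coeff Q i))"
  proof -
    have "v (\<iota> (b * coeff Q (Suc i)) + \<iota> (l * coeff Q i)) = v (\<iota> (l * coeff Q i))"
      by (rule add_eq') (use lt[of b "Suc i"] bc in \<open>simp add: v_\<iota>\<close>)
    then show ?thesis unfolding co \<iota>_add
      by (subst add_eq') (use lt[of c "Suc (Suc i)"] bc in \<open>simp_all add: v_\<iota>\<close>)
  qed
  then have "poly_abs (coeff (Q * R) (Suc (Suc i))) = height Q * height R"
    by (simp add: v_\<iota> poly_abs_mult l i)
  then show ?thesis using coeff_le_height[of "Q * R" "Suc (Suc i)"] by simp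
qed

end

section \<open>Approximation by a sequence of quadratic elements\<close>

definition quad_disc :: "'a::comm_ring_1 poly \<Rightarrow> 'a" where
  "quad_disc R = coeff R 1 ^ 2 - 4 * coeff R 2 * coeff R 0"

text \<open>\<open>w\<close> is to be the exponent for roots and \<open>w + 1 - \<gamma>\<close> the
  one for values: the discriminant places the two roots at distance about
  \<open>H powr (\<gamma> - 1)\<close>. The exponent \<rho> limits the gaps between consecutive
  heights, and \<open>K\<close> collects all bounded factors. Requiring the leading coefficient to
  attain the height keeps the roots in the unit ball.\<close>

locale quad_approx = poly_valued v \<iota> for v :: "'k::field \<Rightarrow> real"
    and \<iota> :: "'a::{finite,field} poly \<Rightarrow> 'k" +
  fixes x :: 'k and R :: "nat \<Rightarrow> 'a poly poly" and w \<gamma> \<rho> K :: real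
  assumes alg_closed: "degree (f :: 'k poly) \<ge> 1 \<Longrightarrow> \<exists>z. poly f z = 0"
    and x_le_1: "v x \<le> 1"
    and degree_R: "degree (R j) = 2"
    and irred_R: "irreducible (R j)"
    and primitive_R: "primitive (R j)"
    and monic_R: "lead_coeff (lead_coeff (R j)) = 1"
    and height_R: "height (R j) = poly_abs (lead_coeff (R j))"
    and K: "K \<ge> 1" and \<rho>: "\<rho> > 0" and \<gamma>: "0 \<le> \<gamma>" "\<gamma> \<le> 1" and w: "w > 0"
    and growth: "height (R (Suc j)) \<le> K * height (R j) powr \<rho>"
    and height_inf: "filterlim (\<lambda>j. height (R j)) at_top sequentially"
    and value_le: "v (ev (R j) x) \<le> K * height (R j) powr (- (w + 1 - \<gamma>))"
    and value_ge: "height (R j) powr (- (w + 1 - \<gamma>)) / K \<le> v (ev (R j) x)"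
    and disc_le: "poly_abs (quad_disc (R j)) \<le> (K * height (R j) powr \<gamma>)\<^sup>2"
    and disc_ge: "(height (R j) powr \<gamma> / K)\<^sup>2 \<le> poly_abs (quad_disc (R j))"
begin

abbreviation "H j \<equiv> height (R j)"

lemma H_ge_1: "H j \<ge> 1"
  using degree_R[of j] by (intro height_ge_1) auto

lemma coeff2_nonzero [simp]: "coeff (R j) 2 \<noteq> 0"
  using degree_R[of j] by (metis degree_0 leading_coeff_0_iff zero_neq_numeral)

lemma R_coeffs: "R j = [:coeff (R j) 0, coeff (R j) 1, coeff (R j) 2:]"
  by (rule poly_eqI)
    (use degree_R[of j] in \<open>auto simp: coeff_pCons numeral_2_eq_2 coeff_eq_0 split: nat.splits\<close>)

lemma lead_H: "poly_abs (coeff (R j) 2) = H j"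
  using height_R[of j] degree_R[of j] by simp

section \<open>The two roots of each member and their distances to the point\<close>

lemma roots_exist:
  "\<exists>\<alpha> \<beta>. \<iota> (coeff (R j) 1) = - (\<iota> (coeff (R j) 2) * (\<alpha> + \<beta>)) \<and>
     \<iota> (coeff (R j) 0) = \<iota> (coeff (R j) 2) * (\<alpha> * \<beta>) \<and> v (x - \<alpha>) \<le> v (x - \<beta>)"
proof -
  define l b c where "l = coeff (R j) 2" "b = coeff (R j) 1" "c = coeff (R j) 0"
  have l0: "\<iota> l \<noteq> 0" by (auto simp: l_b_c_def)
  obtain \<alpha> where \<alpha>: "poly (map_poly \<iota> (R j)) \<alpha> = 0"
    using alg_closed[of "map_poly \<iota> (R j)"] degree_R[of j] by (auto simp: degree_map_\<iota>)
  then have "ev (R j) \<alpha> = 0" by (simp add: ev_def)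
  then have eq: "\<iota> c + \<alpha> * (\<iota> b + \<alpha> * \<iota> l) = 0"
    by (subst (asm) R_coeffs) (simp add: l_b_c_def)
  \<comment> \<open>The second root is read off from Vieta's formula, which also covers a double
    root.\<close>
  define \<beta> where "\<beta> = - \<iota> b / \<iota> l - \<alpha>"
  have 1: "\<iota> b = - (\<iota> l * (\<alpha> + \<beta>))" using l0 by (simp add: \<beta>_def field_simps)
  have "\<iota> c = - (\<alpha> * (\<iota> b + \<alpha> * \<iota> l))" using eq by (simp add: eq_neg_iff_add_eq_0)
  also have "\<dots> = \<iota> l * (\<alpha> * \<beta>)" unfolding 1 by (simp add: algebra_simps)
  finally have 2: "\<iota> c = \<iota> l * (\<alpha> * \<beta>)" .
  show ?thesis
  proof (cases "v (x - \<alpha>) \<le> v (x - \<beta>)")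
    case True
    then show ?thesis using 1 2 by (auto simp: l_b_c_def)
  next
    case False
    then show ?thesis using 1 2
      by (intro exI[of _ \<beta>] exI[of _ \<alpha>]) (auto simp: l_b_c_def algebra_simps)
  qed
qed

definition roots :: "nat \<Rightarrow> 'k \<times> 'k" where
  "roots j = (SOME (\<alpha>, \<beta>). \<iota> (coeff (R j) 1) = - (\<iota> (coeff (R j) 2) * (\<alpha> + \<beta>)) \<and>
     \<iota> (coeff (R j) 0) = \<iota> (coeff (R j) 2) * (\<alpha> * \<beta>) \<and> v (x - \<alpha>) \<le> v (x - \<beta>))"

definition "rt j = fst (roots j)"
definition "rt' j = snd (roots j)"

lemma vieta:
  "\<iota> (coeff (R j) 1) = - (\<iota> (coeff (R j) 2) * (rt j + rt' j))"
  "\<iota> (coeff (R j) 0) = \<iota> (coeff (R j) 2) * (rt j * rt' j)"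
  and rt_le: "v (x - rt j) \<le> v (x - rt' j)"
proof -
  have "\<exists>p. case p of (\<alpha>, \<beta>) \<Rightarrow> \<iota> (coeff (R j) 1) = - (\<iota> (coeff (R j) 2) * (\<alpha> + \<beta>)) \<and>
     \<iota> (coeff (R j) 0) = \<iota> (coeff (R j) 2) * (\<alpha> * \<beta>) \<and> v (x - \<alpha>) \<le> v (x - \<beta>)"
    using roots_exist[of j] by auto
  from someI_ex[OF this] show
    "\<iota> (coeff (R j) 1) = - (\<iota> (coeff (R j) 2) * (rt j + rt' j))"
    "\<iota> (coeff (R j) 0) = \<iota> (coeff (R j) 2) * (rt j * rt' j)"
    "v (x - rt j) \<le> v (x - rt' j)"
    unfolding rt_def rt'_def roots_def by (auto split: prod.splits)
qed

lemma ev_R: "ev (R j) z = \<iota> (coeff (R j) 2) * (z - rt j) * (z - rt' j)"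
  by (subst R_coeffs) (simp add: vieta[unfolded One_nat_def] algebra_simps)

lemma ev_R_eq_0_iff: "ev (R j) z = 0 \<longleftrightarrow> z = rt j \<or> z = rt' j"
  by (auto simp: ev_R)

lemma value_eq: "v (ev (R j) x) = H j * v (x - rt j) * v (x - rt' j)"
  by (simp add: ev_R mult v_\<iota> lead_H)

lemma disc_eq: "poly_abs (quad_disc (R j)) = (H j * v (rt j - rt' j))\<^sup>2"
proof -
  have "\<iota> (quad_disc (R j)) = (\<iota> (coeff (R j) 2) * (rt j - rt' j))\<^sup>2"
    unfolding quad_disc_def \<iota>_diff \<iota>_mult \<iota>_power \<iota>_numeral vieta
    by (simp add: power2_eq_square algebra_simps)
  then show ?thesis by (metis v_\<iota> mult power lead_H)
qed

lemma rt_diff_le: "v (rt j - rt' j) \<le> K * H j powr (\<gamma> - 1)"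
proof -
  have "H j * v (rt j - rt' j) \<le> K * H j powr \<gamma>"
    using disc_le[of j] K unfolding disc_eq by (simp add: power2_le_iff_abs_le nonneg abs_of_nonneg mult)
  also have "\<dots> = H j * (K * H j powr (\<gamma> - 1))"
    using H_ge_1[of j] by (simp add: powr_diff)
  finally show ?thesis using H_ge_1[of j] by simp
qed

lemma rt_diff_ge: "H j powr (\<gamma> - 1) / K \<le> v (rt j - rt' j)"
proof -
  have "H j * (H j powr (\<gamma> - 1) / K) = H j powr \<gamma> / K"
    using H_ge_1[of j] by (simp add: powr_diff)
  also have "\<dots> \<le> H j * v (rt j - rt' j)"
    using H_ge_1[of j] nonneg
    by (intro power2_le_imp_le[OF disc_ge[of j, unfolded disc_eq]]) auto
  finally show ?thesis by (rule mult_left_le_imp_le) (use H_ge_1[of j] in auto)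
qed

text \<open>The separation of the roots is at most the larger of the two distances, and
  \<open>rt' j\<close> is the farther root.\<close>

lemma dist_rt'_ge: "H j powr (\<gamma> - 1) / K \<le> v (x - rt' j)"
proof -
  have "rt j - rt' j = (x - rt' j) - (x - rt j)" by simp
  then have "v (rt j - rt' j) \<le> max (v (x - rt' j)) (v (x - rt j))" by (metis ultra_diff)
  then show ?thesis using rt_diff_ge[of j] rt_le[of j] by auto
qed

text \<open>The value is \<open>H j\<close> times both distances; dividing it by \<open>H j\<close>
  times the lower bound for the farther root changes the exponent from
  \<open>- (w + 1 - \<gamma>)\<close> to \<open>- w - 1\<close> and costs a second factor
  \<open>K\<close>.\<close>

lemma dist_rt_le: "v (x - rt j) \<le> K\<^sup>2 * H j powr (- w - 1)"
proof -
  have pos: "H j > 0" using H_ge_1[of j] by simp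
  have "v (x - rt j) * (H j * (H j powr (\<gamma> - 1) / K)) \<le> v (x - rt j) * (H j * v (x - rt' j))"
    using dist_rt'_ge[of j] pos nonneg by (intro mult_left_mono) auto
  also have "\<dots> = v (ev (R j) x)" by (simp add: value_eq)
  also have "\<dots> \<le> K * H j powr (- (w + 1 - \<gamma>))" by (rule value_le)
  finally have "v (x - rt j) * (H j powr \<gamma> / K) \<le> K * H j powr (- (w + 1 - \<gamma>))"
    using pos by (simp add: powr_diff)
  then have "v (x - rt j) \<le> K * H j powr (- (w + 1 - \<gamma>)) / (H j powr \<gamma> / K)"
    using pos K by (simp add: field_simps)
  also have "\<dots> = K\<^sup>2 * (H j powr (- (w + 1 - \<gamma>)) / H j powr \<gamma>)" by (simp add: power2_eq_square)
  also have "H j powr (- (w + 1 - \<gamma>)) / H j powr \<gamma> = H j powr (- w - 1)"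
    by (simp add: powr_diff[symmetric])
  finally show ?thesis .
qed

lemma dist_rt'_le: "v (x - rt' j) \<le> K\<^sup>2 * H j powr (\<gamma> - 1)"
proof -
  have "x - rt' j = (x - rt j) + (rt j - rt' j)" by simp
  then have "v (x - rt' j) \<le> max (v (x - rt j)) (v (rt j - rt' j))" by (metis ultra)
  moreover have "v (x - rt j) \<le> K\<^sup>2 * H j powr (\<gamma> - 1)"
    by (rule order_trans[OF dist_rt_le mult_left_mono[OF powr_mono]])
      (use H_ge_1[of j] w \<gamma> in auto)
  moreover have "v (rt j - rt' j) \<le> K\<^sup>2 * H j powr (\<gamma> - 1)"
  proof -
    have "K \<le> K\<^sup>2" using K by (simp add: power2_eq_square)
    then show ?thesis using rt_diff_le[of j] by (smt (verit) mult_right_mono powr_ge_zero)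
  qed
  ultimately show ?thesis by simp
qed

lemma dist_rt_ge: "H j powr (- w - 1) / K ^ 3 \<le> v (x - rt j)"
proof -
  have pos: "H j > 0" using H_ge_1[of j] by simp
  have "H j powr (- (w + 1 - \<gamma>)) / K \<le> v (ev (R j) x)" by (rule value_ge)
  also have "\<dots> = H j * v (x - rt j) * v (x - rt' j)" by (rule value_eq)
  also have "\<dots> \<le> H j * v (x - rt j) * (K\<^sup>2 * H j powr (\<gamma> - 1))"
    using dist_rt'_le[of j] nonneg pos by (intro mult_left_mono) auto
  also have "\<dots> = v (x - rt j) * K\<^sup>2 * H j powr \<gamma>" using pos by (simp add: powr_diff)
  finally have "H j powr (- (w + 1 - \<gamma>)) / H j powr \<gamma> \<le> v (x - rt j) * K\<^sup>2 * K"
    using pos K by (simp add: field_simps)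
  also have "H j powr (- (w + 1 - \<gamma>)) / H j powr \<gamma> = H j powr (- w - 1)"
    by (simp add: powr_diff[symmetric])
  finally show ?thesis using K by (simp add: field_simps power3_eq_cube power2_eq_square)
qed

text \<open>Outside the unit ball the quadratic term dominates, because the leading coefficient
  attains the height. This makes \<open>v_ev_diff_le\<close> applicable at the roots.\<close>

lemma v_root_le_1:
  assumes "ev (R j) z = 0"
  shows "v z \<le> 1"
proof (rule ccontr)
  assume "\<not> ?thesis"
  then have z: "v z > 1" by simp
  define l b c where "l = coeff (R j) 2" "b = coeff (R j) 1" "c = coeff (R j) 0"
  have pos: "H j > 0" using H_ge_1[of j] by simp
  have bc: "v (\<iota> b) \<le> H j" "v (\<iota> c) \<le> H j"
    using coeff_le_height by (auto simp: v_\<iota> l_b_c_def)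
  have lz: "v (z * \<iota> l) > H j" using z pos lead_H[of j] by (simp add: mult v_\<iota> l_b_c_def)
  then have "v (\<iota> b + z * \<iota> l) = v (z * \<iota> l)" using bc by (intro add_eq') auto
  then have "v (z * (\<iota> b + z * \<iota> l)) = v z * v (z * \<iota> l)" by (simp add: mult)
  moreover have "v z * v (z * \<iota> l) > 1 * H j"
    using z lz pos by (intro mult_strict_mono) auto
  ultimately have "v (\<iota> c + z * (\<iota> b + z * \<iota> l)) > 0"
    using bc pos add_eq'[of "\<iota> c" "z * (\<iota> b + z * \<iota> l)"] by simp
  moreover have "ev (R j) z = \<iota> c + z * (\<iota> b + z * \<iota> l)"
    by (subst R_coeffs) (simp add: l_b_c_def)
  ultimately show False using assms by simp
qed

text \<open>Liouville's argument: with l the leading coefficient of R j, the norm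
  l ^ d * P (rt j) * P (rt' j) is a nonzero element of the polynomial ring.\<close>

lemma resultant_ge_1:
  assumes "degree P \<le> d" "ev P (rt j) \<noteq> 0" "ev P (rt' j) \<noteq> 0"
  shows "1 \<le> H j ^ d * v (ev P (rt j)) * v (ev P (rt' j))"
proof -
  obtain N where N: "\<iota> N = \<iota> (coeff (R j) 2) ^ d * (ev P (rt j) * ev P (rt' j))"
    using norm_integral[OF vieta assms(1)] by blast
  have "\<iota> (coeff (R j) 2) \<noteq> 0" by simp
  then have "\<iota> N \<noteq> 0" unfolding N using assms by simp
  then have "1 \<le> v (\<iota> N)" using poly_abs_ge_1[of N] by (simp add: v_\<iota>)
  then show ?thesis unfolding N by (simp add: mult power v_\<iota> lead_H mult.assoc)
qed

text \<open>The norm inequality \<open>resultant_ge_1\<close> is used at the first member whose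
  height exceeds a power of \<open>height P\<close>. There the value of \<open>P\<close> at the
  nearer root is no larger than its value at \<open>x\<close>, while minimality and
  \<open>growth\<close> keep \<open>H j\<close> bounded by a power of
  \<open>height P\<close>.\<close>

lemma coprime_bound:
  fixes d :: nat
  assumes d: "d \<ge> 1" and wd: "w + 1 - d > 0" and main: "2 * \<rho> * d \<le> (w - 1) * (w + 1 - d)"
  shows "\<exists>c>0. \<forall>P. P \<noteq> 0 \<longrightarrow> degree P \<le> d \<longrightarrow> (\<forall>j. ev P (rt j) \<noteq> 0 \<and> ev P (rt' j) \<noteq> 0) \<longrightarrow>
           v (ev P x) \<ge> c * height P powr (- w)"
proof -
  \<comment> \<open>If the Lipschitz terms controlled \<open>P\<close> at both roots, its norm would
    be at most \<open>K ^ 4 * h\<^sup>2 * H j powr (- e)\<close>: collect the exponents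
    \<open>d\<close>, \<open>- w - 1\<close> and \<open>\<gamma> - 1\<close>.\<close>
  define e where "e = w + 2 - \<gamma> - d"
  \<comment> \<open>\<open>H 0\<close> serves the case in which already the first member is large
    enough; the other term is what \<open>growth\<close> gives from the preceding member.\<close>
  define C where "C = max (H 0) (K * (K ^ 4) powr (\<rho> / e))"
  have e: "e \<ge> w + 1 - d" "e > 0" using wd \<gamma> by (auto simp: e_def)
  have w1: "w \<ge> 1"
  proof (rule ccontr)
    assume "\<not> ?thesis"
    then have "(w - 1) * (w + 1 - d) < 0" using wd by (simp add: mult_neg_pos)
    moreover have "2 * \<rho> * d \<ge> 0" using \<rho> by simp
    ultimately show False using main by linarith
  qed
  have main': "2 * \<rho> * d \<le> (w - 1) * e"
    using main mult_left_mono[OF e(1), of "w - 1"] w1 by linarith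
  have C: "C \<ge> 1" using H_ge_1[of 0] by (simp add: C_def)
  have e1: "\<rho> * d / e \<le> w"
  proof -
    have "\<rho> * d \<le> 2 * \<rho> * d" using \<rho> by simp
    also have "\<dots> \<le> w * e" using main' e by (simp add: algebra_simps)
    finally show ?thesis using e by (simp add: divide_le_eq)
  qed
  \<comment> \<open>The decisive exponent inequality. Its worst case is \<gamma> = 1, where
    \<open>e = w + 1 - d\<close> and it is exactly the hypothesis \<open>main\<close>.\<close>
  have e2: "1 + 2 * \<rho> / e * (d + \<gamma> - 1) \<le> w"
  proof -
    have "2 * \<rho> * (d + \<gamma> - 1) \<le> 2 * \<rho> * d" using \<rho> \<gamma> by (intro mult_left_mono) auto
    also note main'
    finally have "2 * \<rho> * (d + \<gamma> - 1) / e \<le> w - 1" using e by (simp add: divide_le_eq)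
    then show ?thesis by simp
  qed
  define c where "c = min (C powr (- real d / 2)) (C powr (- (d + \<gamma> - 1)) / K\<^sup>2)"
  have c0: "c > 0" using C K by (simp add: c_def)
  show ?thesis
  proof (intro exI[of _ c] conjI allI impI c0)
    fix P :: "'a poly poly"
    assume P: "P \<noteq> 0" "degree P \<le> d" and cop: "\<forall>j. ev P (rt j) \<noteq> 0 \<and> ev P (rt' j) \<noteq> 0"
    define h where "h = height P"
    have h: "h \<ge> 1" using height_ge_1[OF P(1)] by (simp add: h_def)
    define y where "y = v (ev P x)"
    have y0: "y \<ge> 0" by (simp add: y_def nonneg)
    define B where "B = K ^ 4 * h\<^sup>2"
    have B1: "B \<ge> 1" using K h by (simp add: B_def one_le_power mult_ge1_I)
    have "eventually (\<lambda>j. H j > B powr (1 / e)) sequentially"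
      using height_inf by (simp add: filterlim_at_top_dense)
    then obtain j0 where "H j0 > B powr (1 / e)" by (auto simp: eventually_sequentially)
    define j where "j = (LEAST j. H j > B powr (1 / e))"
    have j: "H j > B powr (1 / e)" unfolding j_def by (rule LeastI) fact
    have least: "H i \<le> B powr (1 / e)" if "i < j" for i
      using not_less_Least[of i "\<lambda>j. H j > B powr (1 / e)"] that by (simp add: j_def)
    have HB: "H j powr e > B"
    proof -
      have "(B powr (1 / e)) powr e < H j powr e"
        using j e by (intro powr_less_mono2) auto
      then show ?thesis using e B1 by (simp add: powr_powr)
    qed
    have HC: "H j \<le> C * h powr (2 * \<rho> / e)"
    proof (cases j)
      case 0
      have "1 \<le> h powr (2 * \<rho> / e)" using h \<rho> e by (intro ge_one_powr_ge_zero) auto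
      then have "C * 1 \<le> C * h powr (2 * \<rho> / e)" using C by (intro mult_left_mono) auto
      then show ?thesis using 0 by (simp add: C_def)
    next
      case (Suc i)
      have "H j \<le> K * H i powr \<rho>" using growth Suc by simp
      also have "\<dots> \<le> K * (B powr (1 / e)) powr \<rho>"
        using least[of i] Suc K \<rho> H_ge_1[of i] by (intro mult_left_mono powr_mono2) auto
      also have "\<dots> = K * (K ^ 4) powr (\<rho> / e) * h powr (2 * \<rho> / e)"
      proof -
        have "h\<^sup>2 = h powr 2" using h by simp
        then have "(h\<^sup>2) powr (\<rho> / e) = h powr (2 * \<rho> / e)" by (simp only: powr_powr) simp
        then show ?thesis using h K by (simp add: powr_powr B_def powr_mult)
      qed
      also have "\<dots> \<le> C * h powr (2 * \<rho> / e)"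
        by (intro mult_right_mono) (auto simp: C_def)
      finally show ?thesis .
    qed
    have Hpos: "H j > 0" using H_ge_1[of j] by simp
    have xz: "v (ev P z) \<le> max y (h * v (x - z))" if "ev (R j) z = 0" for z
    proof -
      have "ev P z = ev P x - (ev P x - ev P z)" by simp
      then have "v (ev P z) \<le> max y (v (ev P x - ev P z))" unfolding y_def by (metis ultra_diff)
      moreover have "v (ev P x - ev P z) \<le> h * v (x - z)"
        unfolding h_def using v_root_le_1[OF that] x_le_1 by (intro v_ev_diff_le)
      ultimately show ?thesis by auto
    qed
    have A: "v (ev P (rt j)) \<le> max y (h * v (x - rt j))"
      and A': "v (ev P (rt' j)) \<le> max y (h * v (x - rt' j))"
      using xz by (auto simp: ev_R_eq_0_iff)
    have res: "1 \<le> H j ^ d * v (ev P (rt j)) * v (ev P (rt' j))"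
      using cop P by (intro resultant_ge_1) auto
    \<comment> \<open>Otherwise both values of \<open>P\<close> at the roots obey the Lipschitz
      bounds, and the choice of \<open>j\<close> makes the norm smaller than 1.\<close>
    have yl: "y > h * v (x - rt j)"
    proof (rule ccontr)
      assume "\<not> ?thesis"
      then have y: "y \<le> h * v (x - rt j)" by simp
      moreover have "h * v (x - rt j) \<le> h * v (x - rt' j)"
        using rt_le[of j] h by (intro mult_left_mono) auto
      ultimately have "v (ev P (rt j)) \<le> h * v (x - rt j)" "v (ev P (rt' j)) \<le> h * v (x - rt' j)"
        using A A' by auto
      moreover have "h * v (x - rt j) \<le> h * (K\<^sup>2 * H j powr (- w - 1))"
        "h * v (x - rt' j) \<le> h * (K\<^sup>2 * H j powr (\<gamma> - 1))"
        using dist_rt_le[of j] dist_rt'_le[of j] h by auto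
      ultimately have "v (ev P (rt j)) \<le> h * (K\<^sup>2 * H j powr (- w - 1))"
        "v (ev P (rt' j)) \<le> h * (K\<^sup>2 * H j powr (\<gamma> - 1))" by linarith+
      then have "v (ev P (rt j)) * v (ev P (rt' j))
          \<le> (h * (K\<^sup>2 * H j powr (- w - 1))) * (h * (K\<^sup>2 * H j powr (\<gamma> - 1)))"
        using h nonneg by (intro mult_mono) auto
      also have "\<dots> = B * (H j powr (- w - 1) * H j powr (\<gamma> - 1))"
        by (simp add: B_def power2_eq_square power4_eq_xxxx)
      finally have "H j ^ d * (v (ev P (rt j)) * v (ev P (rt' j)))
          \<le> H j ^ d * (B * (H j powr (- w - 1) * H j powr (\<gamma> - 1)))"
        using Hpos by (intro mult_left_mono) auto
      also have "\<dots> = B * H j powr (- e)"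
        using Hpos by (simp add: powr_realpow[symmetric] powr_add[symmetric] e_def algebra_simps)
      also have "\<dots> < 1" using HB Hpos by (simp add: powr_minus field_simps)
      finally show False using res by (simp add: mult.assoc)
    qed
    then have A1: "v (ev P (rt j)) \<le> y" using A by simp
    have ypos: "y > 0" using yl h nonneg[of "x - rt j"] by (smt (verit) mult_nonneg_nonneg)
    have "1 \<le> H j ^ d * y * max y (h * v (x - rt' j))"
      by (rule order_trans[OF res]) (intro mult_mono A1 A', use y0 nonneg Hpos in auto)
    \<comment> \<open>At the farther root either the value at \<open>x\<close> or the Lipschitz term
      dominates; the first alternative bounds \<open>y\<^sup>2\<close> from below, the second bounds
      \<open>y\<close> and needs \<open>e2\<close>.\<close>
    then consider "1 \<le> H j ^ d * y * y" | "1 \<le> H j ^ d * y * (h * v (x - rt' j))"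
      by (auto simp: max_def split: if_splits)
    then have "c * h powr (- w) \<le> y"
    proof cases
      case 1
      have "(H j powr (- real d / 2))\<^sup>2 \<le> y\<^sup>2"
      proof -
        have "(H j powr (- real d / 2))\<^sup>2 = H j powr (- real d)"
          by (simp add: power2_eq_square powr_add[symmetric])
        also have "\<dots> = 1 / H j ^ d" using Hpos by (simp add: powr_minus_divide powr_realpow)
        finally have "(H j powr (- real d / 2))\<^sup>2 = 1 / H j ^ d" .
        moreover have "1 / H j ^ d \<le> y\<^sup>2"
          using 1 Hpos by (simp add: divide_le_eq power2_eq_square mult_ac)
        ultimately show ?thesis by simp
      qed
      then have "H j powr (- real d / 2) \<le> y" using y0 by (rule power2_le_imp_le)
      moreover have "(C * h powr (2 * \<rho> / e)) powr (- real d / 2) \<le> H j powr (- real d / 2)"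
        using HC Hpos by (intro powr_mono2') auto
      moreover have "(C * h powr (2 * \<rho> / e)) powr (- real d / 2)
          = C powr (- real d / 2) * h powr (- (\<rho> * d / e))"
        using C h by (simp add: powr_mult powr_powr)
      moreover have "c * h powr (- w) \<le> C powr (- real d / 2) * h powr (- (\<rho> * d / e))"
        using e1 h by (intro mult_mono powr_mono) (auto simp: c_def)
      ultimately show ?thesis by linarith
    next
      case 2
      let ?s = "real d + \<gamma> - 1"
      have s0: "?s \<ge> 0" using d \<gamma> by simp
      have "1 \<le> H j ^ d * y * (h * (K\<^sup>2 * H j powr (\<gamma> - 1)))"
        by (rule order_trans[OF 2]) (intro mult_left_mono dist_rt'_le, use y0 h Hpos in auto)
      also have "\<dots> = y * (h * K\<^sup>2 * H j powr ?s)"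
        using Hpos by (simp add: powr_realpow[symmetric] powr_add[symmetric] algebra_simps)
      also have "\<dots> \<le> y * (h * K\<^sup>2 * (C * h powr (2 * \<rho> / e)) powr ?s)"
        using HC Hpos s0 y0 h K by (intro mult_left_mono powr_mono2) auto
      also have "(C * h powr (2 * \<rho> / e)) powr ?s = C powr ?s * h powr (2 * \<rho> / e * ?s)"
        using C h by (simp add: powr_mult powr_powr)
      also have "h * K\<^sup>2 * (C powr ?s * h powr (2 * \<rho> / e * ?s))
          = K\<^sup>2 * C powr ?s * h powr (1 + 2 * \<rho> / e * ?s)"
        using h by (simp add: powr_add)
      also have "y * \<dots> \<le> y * (K\<^sup>2 * C powr ?s * h powr w)"
        using e2 h y0 K by (intro mult_left_mono powr_mono) auto
      finally have "1 / (K\<^sup>2 * C powr ?s * h powr w) \<le> y"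
        using h K C by (simp add: divide_le_eq mult.commute)
      moreover have "1 / (K\<^sup>2 * C powr ?s * h powr w) = (C powr (- ?s) / K\<^sup>2) * h powr (- w)"
        by (simp only: powr_minus) (simp add: field_simps)
      moreover have "c * h powr (- w) \<le> (C powr (- ?s) / K\<^sup>2) * h powr (- w)"
        by (intro mult_right_mono) (auto simp: c_def)
      ultimately show ?thesis by linarith
    qed
    then show "c * height P powr (- w) \<le> v (ev P x)" by (simp add: h_def y_def)
  qed
qed

end

section \<open>From bounds to infinite and finite sets of approximations\<close>

lemma le_of_powr_minus_le:
  fixes a b c h :: real
  assumes "c > 0" "a < b" "h \<ge> 1" "c * h powr (- a) \<le> h powr (- b)"
  shows "h \<le> (1 / c) powr (1 / (b - a))"
proof -
  have "c * h powr (- a) * h powr b \<le> h powr (- b) * h powr b"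
    by (rule mult_right_mono[OF assms(4)]) simp
  then have "c * (h powr (- a) * h powr b) \<le> h powr (- b) * h powr b" by (simp add: mult.assoc)
  then have "c * h powr (b - a) \<le> 1" using assms(3) by (simp add: powr_add[symmetric])
  then have "h powr (b - a) \<le> 1 / c" using assms(1) by (simp add: field_simps)
  then have "(h powr (b - a)) powr (1 / (b - a)) \<le> (1 / c) powr (1 / (b - a))"
    using assms by (intro powr_mono2) auto
  then show ?thesis using assms by (simp add: powr_powr)
qed

context quad_approx
begin

definition minimal :: "'k \<Rightarrow> 'a poly poly \<Rightarrow> bool" where
  "minimal \<alpha> P \<longleftrightarrow> degree P \<ge> 1 \<and> irreducible P \<and> primitive P \<and>
     lead_coeff (lead_coeff P) = 1 \<and> ev P \<alpha> = 0"

lemma eventually_const_mult_le: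
  assumes "a < b" "c > 0"
  shows "eventually (\<lambda>j. c * H j powr (- b) \<le> H j powr (- a)) sequentially"
proof -
  have "eventually (\<lambda>j. H j > c powr (1 / (b - a))) sequentially"
    using height_inf by (simp add: filterlim_at_top_dense)
  then show ?thesis
  proof eventually_elim
    case (elim j)
    have "(c powr (1 / (b - a))) powr (b - a) \<le> H j powr (b - a)"
      using elim assms by (intro powr_mono2) auto
    then have "c \<le> H j powr (b - a)" using assms by (simp add: powr_powr)
    then have "c * H j powr (- b) \<le> H j powr (b - a) * H j powr (- b)"
      by (intro mult_right_mono) auto
    then show ?case by (simp add: powr_add[symmetric])
  qed
qed

lemma value_pos: "0 < v (ev (R j) x)"
  using value_ge[of j] H_ge_1[of j] K by (smt (verit) divide_pos_pos powr_gt_zero)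

lemma dist_rt_pos: "0 < v (x - rt j)"
  using dist_rt_ge[of j] H_ge_1[of j] K by (smt (verit) divide_pos_pos powr_gt_zero zero_less_power)

lemma infinite_approx_values:
  assumes "\<omega> < w + 1 - \<gamma>"
  shows "infinite {P. degree P \<le> 2 \<and> 0 < v (ev P x) \<and> v (ev P x) \<le> height P powr (- \<omega>)}"
    (is "infinite ?S")
proof
  assume fin: "finite ?S"
  have "eventually (\<lambda>j. K * H j powr (- (w + 1 - \<gamma>)) \<le> H j powr (- \<omega>)) sequentially"
    using assms K by (intro eventually_const_mult_le) auto
  then have "eventually (\<lambda>j. R j \<in> ?S) sequentially"
  proof eventually_elim
    case (elim j)
    then show ?case using value_pos[of j] value_le[of j] degree_R[of j] by auto
  qed
  moreover have "eventually (\<lambda>j. H j > Max (height ` ?S)) sequentially"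
    using height_inf by (simp add: filterlim_at_top_dense)
  ultimately have "eventually (\<lambda>j. False) sequentially"
  proof eventually_elim
    case (elim j)
    have "H j \<le> Max (height ` ?S)" using fin elim by (intro Max_ge) auto
    then show False using elim by simp
  qed
  then show False by simp
qed

lemma infinite_approx_roots:
  assumes "\<omega> < w"
  shows "infinite {\<alpha>. \<exists>P. minimal \<alpha> P \<and> degree P \<le> 2 \<and> 0 < v (x - \<alpha>) \<and>
           v (x - \<alpha>) \<le> height P powr (- \<omega> - 1)}" (is "infinite ?S")
proof
  assume fin: "finite ?S"
  define S where "S = ?S"
  have finS: "finite S" using fin by (simp add: S_def)
  have K2: "K\<^sup>2 > 0" using K by simp
  have "eventually (\<lambda>j. K\<^sup>2 * H j powr (- (w + 1)) \<le> H j powr (- (\<omega> + 1))) sequentially"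
    using assms K by (intro eventually_const_mult_le) auto
  then have in_S: "eventually (\<lambda>j. rt j \<in> S) sequentially"
  proof eventually_elim
    case (elim j)
    have "minimal (rt j) (R j)"
      using degree_R[of j] irred_R primitive_R monic_R[of j] by (simp add: minimal_def ev_R_eq_0_iff)
    moreover have "v (x - rt j) \<le> height (R j) powr (- \<omega> - 1)"
      using order_trans[OF dist_rt_le[of j]] elim by (simp only: minus_add_distrib diff_conv_add_uminus)
    ultimately show ?case using dist_rt_pos[of j] degree_R[of j] unfolding S_def by auto
  qed
  \<comment> \<open>The inserted 1 keeps the minimum defined and positive even if \<open>S\<close>
    is empty. The distances of the nearer roots tend to 0 and so fall below
    \<open>m\<close>.\<close>
  define m where "m = Min (insert 1 ((\<lambda>\<alpha>. v (x - \<alpha>)) ` S))"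
  have m0: "m > 0" using finS by (auto simp: m_def S_def)
  have m_le: "m \<le> v (x - \<alpha>)" if "\<alpha> \<in> S" for \<alpha>
    unfolding m_def using finS that by (intro Min_le) auto
  have "eventually (\<lambda>j. 2 / m * K\<^sup>2 * H j powr (- (w + 1)) \<le> H j powr (- 0)) sequentially"
    using w m0 K by (intro eventually_const_mult_le) auto
  with in_S have "eventually (\<lambda>j. False) sequentially"
  proof eventually_elim
    case (elim j)
    have "m \<le> v (x - rt j)" using elim by (intro m_le)
    also have "\<dots> \<le> K\<^sup>2 * H j powr (- (w + 1))" using dist_rt_le[of j] by (simp only: minus_add_distrib diff_conv_add_uminus)
    also have "\<dots> \<le> m / 2"
      using elim m0 H_ge_1[of j] by (simp add: field_simps split: if_splits)
    finally show False using m0 by simp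
  qed
  then show False by simp
qed

end

locale quad_approx_bounded = quad_approx v \<iota> x R w \<gamma> \<rho> K
  for v :: "'k::field \<Rightarrow> real" and \<iota> :: "'a::{finite,field} poly \<Rightarrow> 'k"
    and x R w \<gamma> \<rho> K +
  fixes d :: nat
  assumes d: "d \<ge> 1" and wd: "w + 1 - d > 0" and main: "2 * \<rho> * d \<le> (w - 1) * (w + 1 - d)"
begin

text \<open>Either \<open>coprime_bound\<close> applies, with the better exponent \<open>w\<close>
  because \<gamma> is at most 1, or some \<open>R j\<close> divides \<open>P\<close>. In the second
  case the value is multiplicative and the height supermultiplicative, so the bounds for
  \<open>R j\<close> and for the quotient of degree two less combine.\<close>

lemma value_lower_bound:
  "\<exists>c>0. \<forall>P. P \<noteq> 0 \<longrightarrow> degree P \<le> d \<longrightarrow> c * height P powr (- (w + 1 - \<gamma>)) \<le> v (ev P x)"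
proof -
  let ?u = "w + 1 - \<gamma>"
  obtain c where c: "c > 0" "\<And>P. P \<noteq> 0 \<Longrightarrow> degree P \<le> d \<Longrightarrow>
      (\<And>j. ev P (rt j) \<noteq> 0 \<and> ev P (rt' j) \<noteq> 0) \<Longrightarrow> c * height P powr (- w) \<le> v (ev P x)"
    using coprime_bound[OF d wd main] by blast
  have "\<exists>c>0. \<forall>P. P \<noteq> 0 \<longrightarrow> degree P \<le> n \<longrightarrow> c * height P powr (- ?u) \<le> v (ev P x)" if "n \<le> d" for n
    using that
  proof (induction n rule: less_induct)
    case (less n)
    \<comment> \<open>For \<open>n < 2\<close> no quotient by a quadratic polynomial arises, so any
      positive \<open>c1\<close> will do.\<close>
    have "\<exists>c1>0. 2 \<le> n \<longrightarrow> (\<forall>P. P \<noteq> 0 \<longrightarrow> degree P \<le> n - 2 \<longrightarrow> c1 * height P powr (- ?u) \<le> v (ev P x))"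
    proof (cases "2 \<le> n")
      case True
      then show ?thesis using less.IH[of "n - 2"] less.prems by auto
    qed (auto intro: exI[of _ 1])
    then obtain c1 where c1: "c1 > 0" "\<And>P. 2 \<le> n \<Longrightarrow> P \<noteq> 0 \<Longrightarrow> degree P \<le> n - 2 \<Longrightarrow>
        c1 * height P powr (- ?u) \<le> v (ev P x)" by blast
    show ?case
    proof (intro exI[of _ "min c (c1 / K)"] conjI allI impI)
      show "min c (c1 / K) > 0" using c(1) c1(1) K by simp
      fix P :: "'a poly poly" assume P: "P \<noteq> 0" "degree P \<le> n"
      have hP: "height P \<ge> 1" using height_ge_1[OF P(1)] .
      show "min c (c1 / K) * height P powr (- ?u) \<le> v (ev P x)"
      proof (cases "\<forall>j. ev P (rt j) \<noteq> 0 \<and> ev P (rt' j) \<noteq> 0")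
        case True
        have "min c (c1 / K) * height P powr (- ?u) \<le> c * height P powr (- w)"
          using hP \<gamma> c by (intro mult_mono powr_mono) auto
        then show ?thesis using c(2)[of P] True P less.prems by fastforce
      next
        case False
        then obtain j z where z: "ev P z = 0" "ev (R j) z = 0" by (auto simp: ev_R_eq_0_iff)
        then have "R j dvd P"
          using degree_R irred_R primitive_R by (intro dvd_of_common_root) auto
        then obtain Q where Q: "P = R j * Q" by (elim dvdE)
        have Q0: "Q \<noteq> 0" and dP: "degree P = 2 + degree Q"
          using P Q degree_R[of j] by (auto simp: degree_mult_eq)
        have hQ: "height Q \<ge> 1" using height_ge_1[OF Q0] .
        have hh: "height Q * H j \<le> height P"
          using height_mult_ge[OF degree_R height_R Q0, of j] Q by (simp add: mult.commute)
        have pos: "height Q * H j > 0" using hQ H_ge_1[of j] by simp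
        have "min c (c1 / K) * height P powr (- ?u) \<le> c1 / K * (height Q * H j) powr (- ?u)"
          using hh pos c1 K w \<gamma> by (intro mult_mono powr_mono2') auto
        also have "\<dots> = (c1 * height Q powr (- ?u)) * (H j powr (- ?u) / K)"
          using hQ H_ge_1[of j] by (simp add: powr_mult)
        also have "\<dots> \<le> v (ev Q x) * v (ev (R j) x)"
          using c1(1) c1(2)[of Q] Q0 dP P(2) value_ge[of j] K nonneg by (intro mult_mono) auto
        also have "\<dots> = v (ev P x)" by (simp add: Q ev_mult mult)
        finally show ?thesis .
      qed
    qed
  qed
  then show ?thesis by blast
qed

lemma finite_approx_values:
  assumes "\<omega> > w + 1 - \<gamma>"
  shows "finite {P. degree P \<le> d \<and> 0 < v (ev P x) \<and> v (ev P x) \<le> height P powr (- \<omega>)}"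
proof -
  obtain c where c: "c > 0" "\<And>P. P \<noteq> 0 \<Longrightarrow> degree P \<le> d \<Longrightarrow>
      c * height P powr (- (w + 1 - \<gamma>)) \<le> v (ev P x)"
    using value_lower_bound by blast
  show ?thesis
  proof (rule finite_subset[OF _ finite_height_le])
    show "{P. degree P \<le> d \<and> 0 < v (ev P x) \<and> v (ev P x) \<le> height P powr (- \<omega>)}
      \<subseteq> {P. degree P \<le> d \<and> height P \<le> (1 / c) powr (1 / (\<omega> - (w + 1 - \<gamma>)))}"
    proof safe
      fix P :: "'a poly poly"
      assume P: "degree P \<le> d" "0 < v (ev P x)" "v (ev P x) \<le> height P powr (- \<omega>)"
      then have "P \<noteq> 0" by auto
      then show "height P \<le> (1 / c) powr (1 / (\<omega> - (w + 1 - \<gamma>)))"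
        using c(2)[of P] c(1) P assms height_ge_1[of P] by (intro le_of_powr_minus_le) auto
    qed
  qed
qed

text \<open>An irreducible \<open>P\<close> sharing a root with \<open>R j\<close> is a constant
  multiple of it, so \<alpha> is one of its two roots and no closer than \<open>rt j\<close>.
  Otherwise the value of \<open>P\<close> at \<open>x\<close> is at most the height times the
  distance to \<alpha>.\<close>

lemma root_lower_bound:
  "\<exists>c>0. \<forall>\<alpha> P. minimal \<alpha> P \<longrightarrow> degree P \<le> d \<longrightarrow> c * height P powr (- w - 1) \<le> v (x - \<alpha>)"
proof -
  obtain c where c: "c > 0" "\<And>P. P \<noteq> 0 \<Longrightarrow> degree P \<le> d \<Longrightarrow>
      (\<And>j. ev P (rt j) \<noteq> 0 \<and> ev P (rt' j) \<noteq> 0) \<Longrightarrow> c * height P powr (- w) \<le> v (ev P x)"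
    using coprime_bound[OF d wd main] by blast
  \<comment> \<open>The three entries belong to \<alpha> outside the unit ball, to \<open>P\<close>
    without a common root, and to \<open>P\<close> associated with a member.\<close>
  define c' where "c' = min 1 (min c (1 / K ^ 3))"
  have c': "c' > 0" "c' \<le> 1" "c' \<le> c" "c' \<le> 1 / K ^ 3" using c K by (auto simp: c'_def)
  show ?thesis
  proof (intro exI[of _ c'] conjI allI impI c')
    fix \<alpha> and P :: "'a poly poly"
    assume min: "minimal \<alpha> P" and dP: "degree P \<le> d"
    have P0: "P \<noteq> 0" using min by (auto simp: minimal_def)
    have hP: "height P \<ge> 1" using height_ge_1[OF P0] .
    have ev0: "ev P \<alpha> = 0" using min by (simp add: minimal_def)
    show "c' * height P powr (- w - 1) \<le> v (x - \<alpha>)"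
    proof (cases "\<forall>j. ev P (rt j) \<noteq> 0 \<and> ev P (rt' j) \<noteq> 0")
      case True
      show ?thesis
      proof (cases "v \<alpha> \<le> 1")
        case v1: True
        have "c * height P powr (- w) \<le> v (ev P x)" using c(2) P0 dP True by blast
        also have "\<dots> \<le> height P * v (x - \<alpha>)"
          using v_ev_diff_le[OF x_le_1 v1, of P] ev0 by simp
        finally have "c * (height P powr (- w) / height P) \<le> v (x - \<alpha>)"
          using hP by (simp add: field_simps)
        moreover have "height P powr (- w) / height P = height P powr (- w - 1)"
          using hP by (simp add: powr_diff)
        moreover have "c' * height P powr (- w - 1) \<le> c * height P powr (- w - 1)"
          using c' by (intro mult_right_mono) auto
        ultimately show ?thesis by simp
      next
        case False
        then have "v (x - \<alpha>) = v \<alpha>" using x_le_1 by (intro diff_eq') auto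
        moreover have "height P powr (- w - 1) \<le> height P powr 0"
          using hP w by (intro powr_mono) auto
        then have "c' * height P powr (- w - 1) \<le> 1 * 1"
          using c' hP by (intro mult_mono) auto
        ultimately show ?thesis using False by simp
      qed
    next
      case False
      then obtain j z where z: "ev P z = 0" "ev (R j) z = 0" by (auto simp: ev_R_eq_0_iff)
      then have "R j dvd P"
        using degree_R irred_R primitive_R by (intro dvd_of_common_root) auto
      then obtain Q where Q: "P = R j * Q" by (elim dvdE)
      have Q0: "Q \<noteq> 0" using P0 Q by auto
      have "irreducible P" using min by (simp add: minimal_def)
      then have "R j dvd 1 \<or> Q dvd 1" using Q by (auto dest: irreducibleD)
      then have "Q dvd 1" using irred_R[of j] by (auto simp: irreducible_def)
      then obtain a where a: "Q = [:a:]" by (auto simp: is_unit_poly_iff)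
      then have "ev (R j) \<alpha> = 0" using ev0 Q Q0 by (auto simp: ev_smult)
      then have le: "v (x - rt j) \<le> v (x - \<alpha>)" using rt_le[of j] by (auto simp: ev_R_eq_0_iff)
      have "height Q * H j \<le> height P"
        using height_mult_ge[OF degree_R height_R Q0, of j] Q by (simp add: mult.commute)
      moreover have "1 * H j \<le> height Q * H j"
        using height_ge_1[OF Q0] by (intro mult_right_mono) auto
      ultimately have "H j \<le> height P" by simp
      then have "c' * height P powr (- w - 1) \<le> 1 / K ^ 3 * H j powr (- w - 1)"
        using c' H_ge_1[of j] w K by (intro mult_mono powr_mono2') auto
      also have "\<dots> \<le> v (x - rt j)" using dist_rt_ge[of j] by simp
      finally show ?thesis using le by simp
    qed
  qed
qed

lemma finite_approx_roots:
  assumes "\<omega> > w"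
  shows "finite {\<alpha>. \<exists>P. minimal \<alpha> P \<and> degree P \<le> d \<and> 0 < v (x - \<alpha>) \<and>
           v (x - \<alpha>) \<le> height P powr (- \<omega> - 1)}"
proof -
  obtain c where c: "c > 0" "\<And>\<alpha> P. minimal \<alpha> P \<Longrightarrow> degree P \<le> d \<Longrightarrow>
      c * height P powr (- w - 1) \<le> v (x - \<alpha>)"
    using root_lower_bound by blast
  let ?B = "(1 / c) powr (1 / ((\<omega> + 1) - (w + 1)))"
  let ?T = "{P :: 'a poly poly. degree P \<le> d \<and> height P \<le> ?B} - {0}"
  have "finite (\<Union>P\<in>?T. {\<alpha>. ev P \<alpha> = 0})"
  proof (rule finite_UN_I)
    show "finite ?T" using finite_height_le by blast
    fix P assume "P \<in> ?T"
    then have "map_poly \<iota> P \<noteq> 0" by (simp add: map_poly_eq_0_iff)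
    then show "finite {\<alpha>. ev P \<alpha> = 0}" unfolding ev_def by (rule poly_roots_finite)
  qed
  moreover have "{\<alpha>. \<exists>P. minimal \<alpha> P \<and> degree P \<le> d \<and> 0 < v (x - \<alpha>) \<and>
           v (x - \<alpha>) \<le> height P powr (- \<omega> - 1)} \<subseteq> (\<Union>P\<in>?T. {\<alpha>. ev P \<alpha> = 0})"
  proof safe
    fix \<alpha> P assume P: "minimal \<alpha> P" "degree P \<le> d" "0 < v (x - \<alpha>)"
      "v (x - \<alpha>) \<le> height P powr (- \<omega> - 1)"
    have P0: "P \<noteq> 0" using P by (auto simp: minimal_def)
    have "c * height P powr (- (w + 1)) \<le> height P powr (- (\<omega> + 1))"
      using order_trans[OF c(2)[OF P(1,2)] P(4)] by (simp only: minus_add_distrib diff_conv_add_uminus)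
    then have "height P \<le> ?B"
      using c(1) assms height_ge_1[OF P0] by (intro le_of_powr_minus_le) auto
    then show "\<alpha> \<in> (\<Union>P\<in>?T. {\<alpha>. ev P \<alpha> = 0})" using P P0 by (auto simp: minimal_def)
  qed
  ultimately show ?thesis by (rule finite_subset[rotated])
qed

end

section \<open>From quadratic polynomials to Diophantine exponents\<close>

interpretation fls: poly_valued "fls_abs :: 'a::{finite,field} fls \<Rightarrow> real" poly_to_fls
  by unfold_locales (simp_all add: poly_to_fls_add poly_to_fls_mult fls_abs_poly)

lemma eval_fls_eq_ev: "eval_fls P \<xi> = fls.ev P \<xi>"
  by (simp add: eval_fls_def fls.ev_def)

locale ext =
  fixes emb :: "'a::{finite,field} fls \<Rightarrow> 'k::field" and av :: "'k \<Rightarrow> real"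
  assumes ext: "ext_setting emb av"
begin

lemma emb_add: "emb (x + y) = emb x + emb y"
  and emb_mult: "emb (x * y) = emb x * emb y"
  and emb_1 [simp]: "emb 1 = 1"
  and av_emb: "av (emb x) = fls_abs x"
  and alg_closed: "degree (f :: 'k poly) \<ge> 1 \<Longrightarrow> \<exists>z. poly f z = 0"
  using ext by (auto simp: ext_setting_def)

lemma emb_0 [simp]: "emb 0 = 0"
  by (metis emb_add add_0 add_cancel_right_right)

lemma emb_of_nat: "emb (of_nat n) = of_nat n"
  by (induction n) (simp_all add: emb_add)

definition poly_emb :: "'a poly \<Rightarrow> 'k" where
  "poly_emb c = emb (poly_to_fls c)"

sublocale poly_valued av poly_emb
proof -
  \<comment> \<open>\<open>ext_setting\<close> grants \<open>av\<close> only the triangle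
    inequality. The strong one follows because integers are images of constant series, whose
    absolute value is at most 1.\<close>
  interpret ultrametric av
  proof (rule ultrametric_of_triangle)
    fix n
    have "av (of_nat n) = fls_abs (of_nat n :: 'a fls)" by (metis av_emb emb_of_nat)
    also have "\<dots> \<le> 1" by (simp add: fls_abs_def)
    finally show "av (of_nat n) \<le> 1" .
  qed (use ext in \<open>auto simp: ext_setting_def\<close>)
  show "poly_valued av poly_emb"
    by unfold_locales (simp_all add: poly_emb_def poly_to_fls_add poly_to_fls_mult emb_add emb_mult av_emb fls_abs_poly)
qed

lemma ev_emb: "ev P (emb \<xi>) = emb (eval_fls P \<xi>)"
  by (induction P) (simp_all add: eval_fls_eq_ev poly_emb_def[symmetric] emb_add emb_mult)

lemma av_ev_emb: "av (ev P (emb \<xi>)) = fls_abs (eval_fls P \<xi>)"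
  by (simp add: ev_emb av_emb)

lemma is_minpoly_iff:
  "is_minpoly emb \<alpha> P \<longleftrightarrow> degree P \<ge> 1 \<and> irreducible P \<and> primitive P \<and>
     lead_coeff (lead_coeff P) = 1 \<and> ev P \<alpha> = 0"
proof -
  have "emb \<circ> poly_to_fls = poly_emb" by (simp add: fun_eq_iff poly_emb_def)
  then show ?thesis by (simp add: is_minpoly_def primitive_def ev_def)
qed

lemma w_exp_ge:
  assumes "\<And>\<omega>. \<omega> < u \<Longrightarrow> infinite {P. degree P \<le> n \<and> 0 < av (ev P (emb \<xi>)) \<and>
    av (ev P (emb \<xi>)) \<le> height P powr (- \<omega>)}"
  shows "ereal u \<le> w_exp n \<xi>"
proof (rule dense_le)
  fix y assume "y < ereal u"
  then obtain \<omega> where \<omega>: "y < ereal \<omega>" "\<omega> < u" by (metis ereal_dense2 ereal_less_eq(3) less_ereal.simps(1))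
  have "ereal \<omega> \<le> w_exp n \<xi>"
    unfolding w_exp_def using assms[OF \<omega>(2)] by (intro Sup_upper) (auto simp: av_ev_emb)
  then show "y \<le> w_exp n \<xi>" using \<omega>(1) by simp
qed

lemma w_exp_le:
  assumes "\<And>\<omega>. u < \<omega> \<Longrightarrow> finite {P. degree P \<le> n \<and> 0 < av (ev P (emb \<xi>)) \<and>
    av (ev P (emb \<xi>)) \<le> height P powr (- \<omega>)}"
  shows "w_exp n \<xi> \<le> ereal u"
  unfolding w_exp_def
proof (rule Sup_least)
  fix y assume "y \<in> {ereal w | w. infinite {P :: 'a poly poly. degree P \<le> n \<and>
       0 < fls_abs (eval_fls P \<xi>) \<and> fls_abs (eval_fls P \<xi>) \<le> height P powr (- w)}}"
  then obtain \<omega> where "y = ereal \<omega>" "infinite {P :: 'a poly poly. degree P \<le> n \<and>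
       0 < fls_abs (eval_fls P \<xi>) \<and> fls_abs (eval_fls P \<xi>) \<le> height P powr (- \<omega>)}" by blast
  then show "y \<le> ereal u" using assms[of \<omega>] by (force simp: av_ev_emb not_less)
qed

lemma w_star_exp_ge:
  assumes "\<And>\<omega>. \<omega> < u \<Longrightarrow> infinite {\<alpha>. \<exists>P. is_minpoly emb \<alpha> P \<and> degree P \<le> n \<and>
    0 < av (emb \<xi> - \<alpha>) \<and> av (emb \<xi> - \<alpha>) \<le> height P powr (- \<omega> - 1)}"
  shows "ereal u \<le> w_star_exp emb av n \<xi>"
proof (rule dense_le)
  fix y assume "y < ereal u"
  then obtain \<omega> where \<omega>: "y < ereal \<omega>" "\<omega> < u" by (metis ereal_dense2 ereal_less_eq(3) less_ereal.simps(1))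
  have "ereal \<omega> \<le> w_star_exp emb av n \<xi>"
    unfolding w_star_exp_def using assms[OF \<omega>(2)] by (intro Sup_upper) auto
  then show "y \<le> w_star_exp emb av n \<xi>" using \<omega>(1) by simp
qed

lemma w_star_exp_le:
  assumes "\<And>\<omega>. u < \<omega> \<Longrightarrow> finite {\<alpha>. \<exists>P. is_minpoly emb \<alpha> P \<and> degree P \<le> n \<and>
    0 < av (emb \<xi> - \<alpha>) \<and> av (emb \<xi> - \<alpha>) \<le> height P powr (- \<omega> - 1)}"
  shows "w_star_exp emb av n \<xi> \<le> ereal u"
  unfolding w_star_exp_def
proof (rule Sup_least)
  fix y assume "y \<in> {ereal w | w. infinite {\<alpha> :: 'k. \<exists>P. is_minpoly emb \<alpha> P \<and> degree P \<le> n \<and>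
       0 < av (emb \<xi> - \<alpha>) \<and> av (emb \<xi> - \<alpha>) \<le> height P powr (- w - 1)}}"
  then obtain \<omega> where "y = ereal \<omega>" "infinite {\<alpha> :: 'k. \<exists>P. is_minpoly emb \<alpha> P \<and> degree P \<le> n \<and>
       0 < av (emb \<xi> - \<alpha>) \<and> av (emb \<xi> - \<alpha>) \<le> height P powr (- \<omega> - 1)}" by blast
  then show "y \<le> ereal u" using assms[of \<omega>] by (force simp: not_less)
qed

lemma w_exp_mono: "m \<le> n \<Longrightarrow> w_exp m \<xi> \<le> w_exp n \<xi>"
  unfolding w_exp_def by (intro Sup_subset_mono) (auto elim!: infinite_super[rotated])

lemma w_star_exp_mono: "m \<le> n \<Longrightarrow> w_star_exp emb av m \<xi> \<le> w_star_exp emb av n \<xi>"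
  unfolding w_star_exp_def
  by (intro Sup_subset_mono Collect_mono) (fastforce elim!: infinite_super[rotated])

end

text \<open>The content of the forms to come is only known to divide \<open>T\<close>, which is
  \<open>[:0, 1:]\<close>. Removing it and making the leading coefficient monic changes sizes by a
  factor of at most \<open>CARD('a)\<close>.\<close>

lemma normalize_quadratic:
  fixes P :: "'a::{finite,field} poly poly"
  assumes "P \<noteq> 0" and content: "\<And>c. (\<And>i. c dvd coeff P i) \<Longrightarrow> c dvd [:0, 1:]"
  obtains g R where "P = smult g R" "primitive R" "lead_coeff (lead_coeff R) = 1"
    "1 \<le> poly_abs g" "poly_abs g \<le> CARD('a)"
proof -
  obtain g0 R0 where R0: "g0 \<noteq> 0" "P = smult g0 R0" "primitive R0"
    using primitive_part_exists[OF assms(1)] by blast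
  have R00: "R0 \<noteq> 0" using assms R0 by auto
  define a where "a = lead_coeff (lead_coeff R0)"
  have a0: "a \<noteq> 0" using R00 by (simp add: a_def)
  define g R where "g = g0 * [:a:]" and "R = smult [:inverse a:] R0"
  have "P = smult g R" using a0 by (simp add: g_def R_def R0 pCons_one)
  moreover have "primitive R"
    unfolding primitive_def
  proof safe
    fix c assume "\<forall>i. c dvd coeff R i"
    then have "\<forall>i. c dvd [:a:] * coeff R i" by (simp add: dvd_smult)
    then have "\<forall>i. c dvd coeff R0 i" using a0 by (simp add: R_def)
    then show "c dvd 1" using R0(3) by (simp add: primitive_def)
  qed
  moreover have "lead_coeff (lead_coeff R) = 1" using a0 by (simp add: R_def a_def)
  moreover have g0: "g \<noteq> 0" using R0 a0 by (simp add: g_def)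
  then have "1 \<le> poly_abs g" by (rule poly_abs_ge_1)
  moreover have "poly_abs g \<le> CARD('a)"
  proof -
    have "g dvd [:0, 1:]" by (rule content) (simp add: \<open>P = smult g R\<close>)
    then have "degree g \<le> degree [:0, 1 :: 'a:]" by (rule dvd_imp_degree_le) simp
    then have "real CARD('a) ^ degree g \<le> real CARD('a) ^ 1"
      using card_ge2[where 'a='a] by (intro power_increasing) auto
    then show ?thesis using g0 by (simp add: poly_abs_def)
  qed
  ultimately show ?thesis using that by blast
qed

text \<open>Completing the square, (2 l \<xi> + b)^2 = disc + 4 l P(\<xi>), bounds the middle
  coefficient by the leading one; the identity is also valid in characteristic 2. The constant
  coefficient is then recovered from the value.\<close>

lemma height_eq_lead:
  fixes P :: "'a::{finite,field} poly poly"
  assumes "degree P = 2" "fls_abs \<xi> \<le> 1"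
    and "poly_abs (quad_disc P) \<le> (poly_abs (coeff P 2))\<^sup>2"
    and "fls_abs (eval_fls P \<xi>) \<le> poly_abs (coeff P 2)"
  shows "height P = poly_abs (coeff P 2)"
proof -
  define l b c where "l = coeff P 2" "b = coeff P 1" "c = coeff P 0"
  let ?l = "poly_to_fls l" and ?b = "poly_to_fls b" and ?c = "poly_to_fls c" 
  have P: "P = [:c, b, l:]"
    by (rule poly_eqI) (use assms(1) in \<open>auto simp: l_b_c_def coeff_pCons numeral_2_eq_2 coeff_eq_0 split: nat.splits\<close>)
  let ?e = "eval_fls P \<xi>"
  have e: "?e = ?c + \<xi> * (?b + \<xi> * ?l)" by (simp add: eval_fls_eq_ev P)
  define L where "L = poly_abs l"
  have l: "fls_abs ?l = L" by (simp add: fls_abs_poly L_def)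
  have L0: "L \<ge> 0" by (simp add: L_def)
  have ee: "fls_abs ?e \<le> L" using assms(4) by (simp add: L_def l_b_c_def)
  have two: "fls_abs (2 :: 'a fls) \<le> 1" by (simp add: fls_abs_def)
  have four: "fls_abs (4 :: 'a fls) \<le> 1" by (simp add: fls_abs_def)
  have "(2 * ?l * \<xi> + ?b)\<^sup>2 = poly_to_fls (quad_disc P) + 4 * (?l * ?e)"
    unfolding e quad_disc_def fls.\<iota>_diff fls.\<iota>_mult fls.\<iota>_power fls.\<iota>_numeral l_b_c_def[symmetric]
    by (simp add: power2_eq_square algebra_simps)
  moreover have "fls_abs (poly_to_fls (quad_disc P) + 4 * (?l * ?e)) \<le> L\<^sup>2"
  proof -
    have "fls_abs (4 * (?l * ?e)) \<le> 1 * (L * L)"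
      unfolding fls.mult l using four ee L0 by (intro mult_mono) (auto simp: fls.nonneg)
    then show ?thesis using fls.ultra[of "poly_to_fls (quad_disc P)" "4 * (?l * ?e)"] assms(3)
      by (simp add: fls_abs_poly L_def l_b_c_def power2_eq_square)
  qed
  ultimately have "fls_abs (2 * ?l * \<xi> + ?b) ^ 2 \<le> L\<^sup>2" by (simp add: fls.power[symmetric])
  then have 1: "fls_abs (2 * ?l * \<xi> + ?b) \<le> L" using L0 by (rule power2_le_imp_le)
  have 2: "fls_abs (2 * ?l * \<xi>) \<le> L"
  proof -
    have "fls_abs (2 * ?l * \<xi>) \<le> 1 * L * 1"
      unfolding fls.mult l using two L0 assms(2) by (intro mult_mono) (auto simp: fls.nonneg)
    then show ?thesis by simp
  qed
  have "?b = (2 * ?l * \<xi> + ?b) - 2 * ?l * \<xi>" by simp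
  then have "fls_abs ?b \<le> max (fls_abs (2 * ?l * \<xi> + ?b)) (fls_abs (2 * ?l * \<xi>))"
    by (metis fls.ultra_diff)
  then have b: "fls_abs ?b \<le> L" using 1 2 by simp
  have xl: "fls_abs (\<xi> * ?l) \<le> L"
    unfolding fls.mult l using assms(2) L0 by (simp add: mult_left_le_one_le fls.nonneg)
  have "fls_abs (\<xi> * (?b + \<xi> * ?l)) \<le> 1 * L"
    unfolding fls.mult[of \<xi> "?b + \<xi> * ?l"]
    using assms(2) L0 b xl fls.ultra[of ?b "\<xi> * ?l"] by (intro mult_mono) (auto simp: fls.nonneg)
  moreover have "?c = ?e - \<xi> * (?b + \<xi> * ?l)" by (simp add: e)
  then have "fls_abs ?c \<le> max (fls_abs ?e) (fls_abs (\<xi> * (?b + \<xi> * ?l)))" by (metis fls.ultra_diff)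
  ultimately have c: "fls_abs ?c \<le> L" using ee by simp
  have "height P \<le> L"
  proof (rule height_leI[OF L0])
    fix i show "poly_abs (coeff P i) \<le> L"
      using b c L0 by (auto simp: P coeff_pCons fls_abs_poly L_def split: nat.splits)
  qed
  then show ?thesis using coeff_le_height[of P 2] by (simp add: L_def l_b_c_def)
qed


text \<open>Primitivity leaves only a factorization into two linear polynomials. Bad approximability
  bounds the value of each from below, and the product of these bounds contradicts
  \<open>small\<close>.\<close>

lemma irreducible_of_small_value:
  fixes R :: "'a::{finite,field} poly poly"
  assumes "degree R = 2" "primitive R"
    and bad: "\<And>a b. a \<noteq> 0 \<Longrightarrow>
      1 / (CARD('a) * poly_abs a) \<le> fls_abs (poly_to_fls a * \<xi> + poly_to_fls b)"
    and small: "fls_abs (eval_fls R \<xi>) * (CARD('a) ^ 2 * poly_abs (coeff R 2)) < 1"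
  shows "irreducible R"
proof (rule irreducibleI)
  have q: "real CARD('a) > 0" using card_ge2[where 'a='a] by simp
  show R0: "R \<noteq> 0" using assms(1) by auto
  show "\<not> R dvd 1" using assms(1) by (auto simp: is_unit_poly_iff)
  fix A B assume AB: "R = A * B"
  have const: "C dvd 1" if C: "degree C = 0" "C dvd R" for C
  proof -
    obtain c where c: "C = [:c:]" using degree_eq_zeroE[OF C(1)] by blast
    then have "c dvd 1" using C(2) assms(2) by (simp add: const_poly_dvd_iff primitive_def)
    then show ?thesis using c by (simp add: is_unit_const_poly_iff)
  qed
  have nz: "A \<noteq> 0" "B \<noteq> 0" using AB R0 by auto
  have deg: "degree A + degree B = 2" using AB assms(1) nz by (simp add: degree_mult_eq)
  show "A dvd 1 \<or> B dvd 1"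
  proof (rule ccontr)
    assume "\<not> ?thesis"
    then have "degree A \<noteq> 0" "degree B \<noteq> 0" using const[of A] const[of B] AB by auto
    then have d1: "degree A = 1" "degree B = 1" using deg by auto
    have lin: "\<exists>a b. C = [:b, a:] \<and> a \<noteq> 0" if "degree C = 1" for C :: "'a poly poly"
    proof -
      obtain b D where C: "C = pCons b D" by (cases C)
      then have "degree D = 0" using that by (auto split: if_splits)
      then obtain a where "D = [:a:]" by (auto elim: degree_eq_zeroE)
      then show ?thesis using C that by (auto split: if_splits)
    qed
    obtain a b where A: "A = [:b, a:]" "a \<noteq> 0" using lin[OF d1(1)] by blast
    obtain a' b' where B: "B = [:b', a':]" "a' \<noteq> 0" using lin[OF d1(2)] by blast
    have "coeff R 2 = a * a'" by (simp add: AB A B numeral_2_eq_2)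
    then have l: "poly_abs (coeff R 2) = poly_abs a * poly_abs a'" by (simp add: poly_abs_mult)
    have pos: "poly_abs a > 0" "poly_abs a' > 0" using A B poly_abs_ge_1[of a] poly_abs_ge_1[of a'] by auto
    have "(1 / (CARD('a) * poly_abs a)) * (1 / (CARD('a) * poly_abs a'))
       \<le> fls_abs (poly_to_fls a * \<xi> + poly_to_fls b) * fls_abs (poly_to_fls a' * \<xi> + poly_to_fls b')"
      using bad[OF A(2)] bad[OF B(2)] by (intro mult_mono) (auto simp: fls.nonneg)
    also have "\<dots> = fls_abs (eval_fls R \<xi>)"
    proof -
      have "eval_fls R \<xi> = fls.ev A \<xi> * fls.ev B \<xi>" by (simp only: AB eval_fls_eq_ev fls.ev_mult)
      then show ?thesis by (simp add: A B fls.mult add.commute mult.commute)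
    qed
    finally have "1 \<le> fls_abs (eval_fls R \<xi>) * (CARD('a) ^ 2 * poly_abs (coeff R 2))"
      using q pos by (simp add: l field_simps power2_eq_square)
    then show False using small by simp
  qed
qed


text \<open>\<open>h\<close>, \<open>e\<close> and \<open>f\<close> are logarithms to base
  \<open>q\<close> of the leading coefficient, the inverse value and the square root of the
  discriminant; \<open>A\<close>, \<open>B\<close>, \<open>D\<close> are their rates along
  \<open>\<rho> ^ j\<close>, with error at most \<open>C\<close>. The comparisons \<open>fh\<close>
  and \<open>eh\<close> provide the hypotheses of \<open>height_eq_lead\<close>.\<close>

locale raw_quad_approx = ext emb av for emb :: "'a::{finite,field} fls \<Rightarrow> 'k::field" and av +
  fixes \<xi> :: "'a fls" and P :: "nat \<Rightarrow> 'a poly poly" and h e f :: "nat \<Rightarrow> real" and A B D C \<rho> :: real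
  assumes xi_le: "fls_abs \<xi> \<le> 1"
    and bad: "a \<noteq> 0 \<Longrightarrow> 1 / (CARD('a) * poly_abs a) \<le> fls_abs (poly_to_fls a * \<xi> + poly_to_fls b)"
    and deg_P: "degree (P j) = 2"
    and content: "(\<And>i. c dvd coeff (P j) i) \<Longrightarrow> c dvd [:0, 1:]"
    and lead_P: "poly_abs (coeff (P j) 2) = CARD('a) powr h j"
    and value_P: "fls_abs (eval_fls (P j) \<xi>) = CARD('a) powr (- e j)"
    and disc_P: "poly_abs (quad_disc (P j)) = CARD('a) powr (2 * f j)"
    and fh: "f j \<le> h j" and eh: "- e j \<le> h j"
    and h: "\<bar>h j - A * \<rho> ^ j\<bar> \<le> C" and e: "\<bar>e j - B * \<rho> ^ j\<bar> \<le> C"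
    and f: "\<bar>f j - D * \<rho> ^ j\<bar> \<le> C"
    and A: "A > 0" and D: "0 \<le> D" "D \<le> A" and BA: "B > A" and rho: "\<rho> > 1"
begin

lemma exists_normalized:
  "\<exists>g. \<exists>R. P j = smult g R \<and> primitive R \<and> lead_coeff (lead_coeff R) = 1 \<and>
     1 \<le> poly_abs g \<and> poly_abs g \<le> CARD('a)"
  using normalize_quadratic[of "P j"] content[of _ j] deg_P[of j]
  by (metis degree_0 zero_neq_numeral)

lemma normalized_sequence:
  obtains R g where "\<And>j. P j = smult (g j) (R j)" "\<And>j. primitive (R j)"
    "\<And>j. lead_coeff (lead_coeff (R j)) = 1" "\<And>j. 1 \<le> poly_abs (g j)" "\<And>j. poly_abs (g j) \<le> CARD('a)"
  using exists_normalized by metis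

text \<open>After taking logarithms every requirement of \<open>quad_approx\<close> compares linear
  functions of \<open>\<eta> j\<close> up to a bounded error, and \<open>K\<close> is the
  exponential of that error.\<close>

lemma quad_approx_exists:
  "\<exists>R K. quad_approx av poly_emb (emb \<xi>) R ((B + D) / A - 1) (D / A) \<rho> K"
proof -
  define q where "q = real CARD('a)"
  have q: "q > 1" using card_ge2[where 'a='a] by (simp add: q_def)
  obtain R g where R: "\<And>j. P j = smult (g j) (R j)" "\<And>j. primitive (R j)"
    "\<And>j. lead_coeff (lead_coeff (R j)) = 1" "\<And>j. 1 \<le> poly_abs (g j)" "\<And>j. poly_abs (g j) \<le> CARD('a)"
    by (rule normalized_sequence) (rule that)
  define \<delta> where "\<delta> j = log q (poly_abs (g j))" for j
  have gq: "poly_abs (g j) = q powr \<delta> j" for j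
    using q R(4)[of j] by (simp add: \<delta>_def)
  have \<delta>: "0 \<le> \<delta> j" "\<delta> j \<le> 1" for j
    using q R(4)[of j] R(5)[of j] by (simp_all add: \<delta>_def q_def)
  define \<eta> where "\<eta> j = h j - \<delta> j" for j
  define \<epsilon> where "\<epsilon> j = e j + \<delta> j" for j
  define \<phi> where "\<phi> j = f j - \<delta> j" for j
  have g0: "g j \<noteq> 0" for j using R(4)[of j] by auto
  have degR: "degree (R j) = 2" for j using deg_P[of j] g0[of j] by (simp add: R(1))
  have lead: "poly_abs (coeff (R j) 2) = q powr \<eta> j" for j
  proof -
    have "q powr \<delta> j * poly_abs (coeff (R j) 2) = q powr h j"
      using lead_P[of j] by (simp add: R(1) poly_abs_mult gq q_def)
    then show ?thesis using q by (simp add: \<eta>_def powr_diff field_simps)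
  qed
  have val: "fls_abs (eval_fls (R j) \<xi>) = q powr (- \<epsilon> j)" for j
  proof -
    have "q powr \<delta> j * fls_abs (eval_fls (R j) \<xi>) = q powr (- e j)"
      using value_P[of j] by (simp add: R(1) eval_fls_eq_ev fls.ev_smult fls.mult fls_abs_poly gq q_def)
    then have "fls_abs (eval_fls (R j) \<xi>) = q powr (- e j) / q powr \<delta> j" using q by (simp add: field_simps)
    also have "\<dots> = q powr (- \<epsilon> j)" by (simp only: \<epsilon>_def powr_diff[symmetric]) simp
    finally show ?thesis .
  qed
  have disc: "poly_abs (quad_disc (R j)) = (q powr \<phi> j)\<^sup>2" for j
  proof -
    have "quad_disc (P j) = g j * g j * quad_disc (R j)"
      by (simp add: R(1) quad_disc_def power2_eq_square algebra_simps)
    then have "q powr \<delta> j * q powr \<delta> j * poly_abs (quad_disc (R j)) = q powr (2 * f j)"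
      using disc_P[of j] by (simp add: poly_abs_mult gq q_def)
    moreover have "q powr (2 * f j) = q powr \<delta> j * q powr \<delta> j * (q powr \<phi> j)\<^sup>2"
      by (simp add: power2_eq_square powr_add[symmetric] \<phi>_def)
    ultimately show ?thesis using q by simp
  qed
  \<comment> \<open>Dividing out the content shifts each logarithm by \<open>\<delta> j\<close>,
    which lies between 0 and 1.\<close>
  define C' where "C' = C + 1"
  have C: "C \<ge> 0" using h[of 0] by linarith
  have \<eta>': "\<bar>\<eta> j - A * \<rho> ^ j\<bar> \<le> C'" and \<epsilon>': "\<bar>\<epsilon> j - B * \<rho> ^ j\<bar> \<le> C'"
    and \<phi>': "\<bar>\<phi> j - D * \<rho> ^ j\<bar> \<le> C'" for j
    using h[of j] e[of j] f[of j] \<delta>[of j] by (auto simp: \<eta>_def \<epsilon>_def \<phi>_def C'_def abs_le_iff)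
  have height: "height (R j) = q powr \<eta> j" for j
  proof -
    have "(q powr \<phi> j)\<^sup>2 \<le> (q powr \<eta> j)\<^sup>2"
      using fh[of j] q by (intro power_mono) (auto simp: \<phi>_def \<eta>_def)
    moreover have "q powr (- \<epsilon> j) \<le> q powr \<eta> j"
      using eh[of j] q by (auto simp: \<epsilon>_def \<eta>_def)
    ultimately show ?thesis
      using height_eq_lead[OF degR xi_le, of j] by (simp add: lead val disc)
  qed
  define u where "u = B / A"
  define \<gamma> where "\<gamma> = D / A"
  have u: "u > 1" using A BA by (simp add: u_def)
  have \<gamma>: "0 \<le> \<gamma>" "\<gamma> \<le> 1" using A D by (auto simp: \<gamma>_def)
  \<comment> \<open>The error of replacing \<open>s * \<rho> ^ j\<close> by
    \<open>s / A * \<eta> j\<close> is at most \<open>C' * (1 + s / A)\<close>, and the growth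
    estimate needs \<open>C' * (1 + \<rho>)\<close>; this exponent covers all of them.\<close>
  define K where "K = q powr (C' * (1 + u + \<gamma> + \<rho>))"
  have C'0: "C' \<ge> 0" using C by (simp add: C'_def)
  have K: "K \<ge> 1" using q C'0 u \<gamma> rho by (auto simp: K_def intro!: ge_one_powr_ge_zero)
  have lin: "\<bar>y - Y\<bar> \<le> C' * (1 + u + \<gamma> + \<rho>)"
    if "\<bar>y - s * \<rho> ^ j\<bar> \<le> C'" "Y = s / A * \<eta> j" "0 \<le> s / A" "s / A \<le> 1 + u + \<gamma> + \<rho> - 1" for y Y s j
  proof -
    have eq: "s * \<rho> ^ j = s / A * (A * \<rho> ^ j)" using A by simp
    have "\<bar>s * \<rho> ^ j - Y\<bar> = s / A * \<bar>A * \<rho> ^ j - \<eta> j\<bar>"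
      unfolding that(2) eq using that(3) by (simp only: right_diff_distrib[symmetric] abs_mult abs_of_nonneg)
    also have "\<dots> \<le> s / A * C'" using \<eta>'[of j] that(3) by (intro mult_left_mono) (auto simp: abs_minus_commute)
    finally have "\<bar>y - Y\<bar> \<le> C' + s / A * C'" using that(1) by linarith
    also have "\<dots> = C' * (1 + s / A)" by (simp add: algebra_simps)
    also have "\<dots> \<le> C' * (1 + u + \<gamma> + \<rho>)" using that(4) C'0 by (intro mult_left_mono) auto
    finally show ?thesis .
  qed
  have lin_\<epsilon>: "\<bar>\<epsilon> j - u * \<eta> j\<bar> \<le> C' * (1 + u + \<gamma> + \<rho>)" for j
    by (rule lin[OF \<epsilon>']) (use u \<gamma> rho in \<open>auto simp: u_def\<close>)
  have lin_\<phi>: "\<bar>\<phi> j - \<gamma> * \<eta> j\<bar> \<le> C' * (1 + u + \<gamma> + \<rho>)" for j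
    by (rule lin[OF \<phi>']) (use u \<gamma> rho in \<open>auto simp: \<gamma>_def\<close>)
  have growth: "height (R (Suc j)) \<le> K * height (R j) powr \<rho>" for j
  proof -
    have "\<eta> (Suc j) \<le> \<rho> * (A * \<rho> ^ j) + C'" using \<eta>'[of "Suc j"] by (simp add: abs_le_iff mult_ac)
    also have "\<dots> \<le> \<rho> * (\<eta> j + C') + C'"
      using \<eta>'[of j] rho by (intro add_right_mono mult_left_mono) (auto simp: abs_le_iff)
    also have "\<dots> = C' * (1 + \<rho>) + \<eta> j * \<rho>" by (simp add: algebra_simps)
    also have "\<dots> \<le> C' * (1 + u + \<gamma> + \<rho>) + \<eta> j * \<rho>"
      using C'0 u \<gamma> by (intro add_right_mono mult_left_mono) auto
    finally have "q powr \<eta> (Suc j) \<le> q powr (C' * (1 + u + \<gamma> + \<rho>) + \<eta> j * \<rho>)"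
      using q by simp
    then show ?thesis by (simp add: height K_def powr_add powr_powr)
  qed
  have \<eta>_inf: "filterlim \<eta> at_top sequentially"
  proof -
    have lim: "filterlim (\<lambda>j. - C' + A * \<rho> ^ j) at_top sequentially"
      using A rho by (intro filterlim_tendsto_add_at_top[OF tendsto_const]
        filterlim_tendsto_pos_mult_at_top[OF tendsto_const]
        filterlim_at_infinity_imp_filterlim_at_top[OF filterlim_realpow_sequentially_gt1]) auto
    have low: "- C' + A * \<rho> ^ j \<le> \<eta> j" for j using \<eta>'[of j] by (simp add: abs_le_iff)
    show ?thesis by (intro filterlim_at_top_mono[OF lim] always_eventually allI low)
  qed
  have height_inf: "filterlim (\<lambda>j. height (R j)) at_top sequentially"
  proof -
    have "filterlim (\<lambda>j. exp (ln q * \<eta> j)) at_top sequentially"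
      using q by (intro filterlim_compose[OF exp_at_top]
        filterlim_tendsto_pos_mult_at_top[OF tendsto_const _ \<eta>_inf]) auto
    then show ?thesis using q by (simp add: height powr_def mult.commute)
  qed
  \<comment> \<open>Beyond this threshold the value beats the leading coefficient by more than the
    factor \<open>CARD('a) ^ 2\<close> demanded by \<open>irreducible_of_small_value\<close>; this
    is why the sequence is shifted by \<open>J\<close> below.\<close>
  have "eventually (\<lambda>j. \<eta> j > (C' * (1 + u + \<gamma> + \<rho>) + 2) / (u - 1)) sequentially"
    using \<eta>_inf by (simp add: filterlim_at_top_dense)
  then obtain J where J: "\<And>j. j \<ge> J \<Longrightarrow> \<eta> j > (C' * (1 + u + \<gamma> + \<rho>) + 2) / (u - 1)"
    by (auto simp: eventually_sequentially)
  have irr: "irreducible (R j)" if "j \<ge> J" for j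
  proof (rule irreducible_of_small_value[OF degR R(2)])
    have "C' * (1 + u + \<gamma> + \<rho>) + 2 < (u - 1) * \<eta> j" using J[OF that] u by (simp add: field_simps)
    then have "- \<epsilon> j + 2 + \<eta> j < 0" using lin_\<epsilon>[of j] by (simp add: abs_le_iff algebra_simps)
    then have "q powr (- \<epsilon> j + 2 + \<eta> j) < q powr 0" using q by (intro powr_less_mono) auto
    then show "fls_abs (eval_fls (R j) \<xi>) * (CARD('a) ^ 2 * poly_abs (coeff (R j) 2)) < 1"
    proof -
      have "q powr (- \<epsilon> j + 2 + \<eta> j) = q powr (- \<epsilon> j) * (q ^ 2 * q powr \<eta> j)"
        using q by (simp only: powr_add) (simp add: mult.assoc)
      moreover assume "q powr (- \<epsilon> j + 2 + \<eta> j) < q powr 0"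
      ultimately show ?thesis using q by (simp add: val lead flip: q_def)
    qed
  qed (rule bad)
  have "quad_approx av poly_emb (emb \<xi>) (\<lambda>j. R (j + J)) (u + \<gamma> - 1) \<gamma> \<rho> K"
  proof unfold_locales
    fix F :: "'k poly" assume "1 \<le> degree F"
    then show "\<exists>z. poly F z = 0" by (rule alg_closed)
  next
    show "av (emb \<xi>) \<le> 1" using xi_le by (simp add: av_emb)
  next
    fix j
    show "height (R (j + J)) = poly_abs (lead_coeff (R (j + J)))" by (simp add: height lead degR)
    show "height (R (Suc j + J)) \<le> K * height (R (j + J)) powr \<rho>" using growth[of "j + J"] by simp
    show "av (ev (R (j + J)) (emb \<xi>)) \<le> K * height (R (j + J)) powr - (u + \<gamma> - 1 + 1 - \<gamma>)"
      using lin_\<epsilon>[of "j + J"] q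
      by (simp add: av_ev_emb val height K_def powr_powr powr_add[symmetric] abs_le_iff algebra_simps)
    show "height (R (j + J)) powr - (u + \<gamma> - 1 + 1 - \<gamma>) / K \<le> av (ev (R (j + J)) (emb \<xi>))"
      using lin_\<epsilon>[of "j + J"] q
      by (simp add: av_ev_emb val height K_def powr_powr powr_diff[symmetric] abs_le_iff algebra_simps)
    show "poly_abs (quad_disc (R (j + J))) \<le> (K * height (R (j + J)) powr \<gamma>)\<^sup>2"
      unfolding disc using lin_\<phi>[of "j + J"] q
      by (intro power_mono) (auto simp: height K_def powr_powr powr_add[symmetric] abs_le_iff algebra_simps)
    show "(height (R (j + J)) powr \<gamma> / K)\<^sup>2 \<le> poly_abs (quad_disc (R (j + J)))"
      unfolding disc using lin_\<phi>[of "j + J"] q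
      by (intro power_mono) (auto simp: height K_def powr_powr powr_diff[symmetric] abs_le_iff algebra_simps)
  next
    show "filterlim (\<lambda>j. height (R (j + J))) at_top sequentially"
      using filterlim_compose[OF height_inf filterlim_add_const_nat_at_top] .
  qed (use degR irr R K rho \<gamma> u in auto)
  then show ?thesis by (auto simp: u_def \<gamma>_def add_divide_distrib)
qed

theorem exponents:
  defines "w \<equiv> (B + D) / A - 1"
  shows "ereal w \<le> w_star_exp emb av 2 \<xi>" "ereal (B / A) \<le> w_exp 2 \<xi>"
    and "\<lbrakk>w + 1 - real d > 0; 2 * \<rho> * d \<le> (w - 1) * (w + 1 - real d); 2 \<le> n; n \<le> d\<rbrakk> \<Longrightarrow>
      w_star_exp emb av n \<xi> = ereal w \<and> w_exp n \<xi> = ereal (B / A)"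
proof -
  obtain R K where RK: "quad_approx av poly_emb (emb \<xi>) R w (D / A) \<rho> K"
    using quad_approx_exists unfolding w_def by blast
  interpret quad_approx av poly_emb "emb \<xi>" R w "D / A" \<rho> K by (fact RK)
  have u: "w + 1 - D / A = B / A" by (simp add: w_def add_divide_distrib)
  show 1: "ereal w \<le> w_star_exp emb av 2 \<xi>"
    using infinite_approx_roots by (intro w_star_exp_ge) (simp add: is_minpoly_iff minimal_def)
  show 2: "ereal (B / A) \<le> w_exp 2 \<xi>"
    using infinite_approx_values unfolding u by (intro w_exp_ge)
  show "w_star_exp emb av n \<xi> = ereal w \<and> w_exp n \<xi> = ereal (B / A)"
    if dn: "w + 1 - real d > 0" "2 * \<rho> * d \<le> (w - 1) * (w + 1 - real d)" "2 \<le> n" "n \<le> d"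
  proof -
    interpret quad_approx_bounded av poly_emb "emb \<xi>" R w "D / A" \<rho> K d
      by unfold_locales (use dn in auto)
    have "w_star_exp emb av d \<xi> \<le> ereal w"
      using finite_approx_roots by (intro w_star_exp_le) (simp add: is_minpoly_iff minimal_def)
    moreover have "w_exp d \<xi> \<le> ereal (B / A)"
      using finite_approx_values unfolding u by (intro w_exp_le)
    ultimately show ?thesis
      using 1 2 w_star_exp_mono[OF dn(3), of \<xi>] w_star_exp_mono[OF dn(4), of \<xi>]
        w_exp_mono[OF dn(3), of \<xi>] w_exp_mono[OF dn(4), of \<xi>]
      by (meson order_antisym order_trans)
  qed
qed

end

section \<open>Continued fractions with linear partial quotients\<close>

datatype 'a mat2 = Mat2 (m11: 'a) (m12: 'a) (m21: 'a) (m22: 'a)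

instantiation mat2 :: (comm_ring_1) monoid_mult
begin

definition "1 = Mat2 1 0 0 1"

definition "X * Y = Mat2 (m11 X * m11 Y + m12 X * m21 Y) (m11 X * m12 Y + m12 X * m22 Y)
  (m21 X * m11 Y + m22 X * m21 Y) (m21 X * m12 Y + m22 X * m22 Y)"

instance
  by standard (auto simp: one_mat2_def times_mat2_def algebra_simps intro: mat2.expand)

end

lemma mat2_one_sel [simp]: "m11 1 = 1" "m12 1 = 0" "m21 1 = 0" "m22 1 = 1"
  by (simp_all add: one_mat2_def)

lemma mat2_times_sel [simp]:
  "m11 (X * Y) = m11 X * m11 Y + m12 X * m21 Y" "m12 (X * Y) = m11 X * m12 Y + m12 X * m22 Y"
  "m21 (X * Y) = m21 X * m11 Y + m22 X * m21 Y" "m22 (X * Y) = m21 X * m12 Y + m22 X * m22 Y"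
  by (simp_all add: times_mat2_def)

lemma mat2_eqI: "m11 X = m11 Y \<Longrightarrow> m12 X = m12 Y \<Longrightarrow> m21 X = m21 Y \<Longrightarrow> m22 X = m22 Y \<Longrightarrow> X = Y"
  by (rule mat2.expand) simp

definition det2 :: "'a::comm_ring_1 mat2 \<Rightarrow> 'a" where
  "det2 X = m11 X * m22 X - m12 X * m21 X"

definition trace2 :: "'a::comm_ring_1 mat2 \<Rightarrow> 'a" where
  "trace2 X = m11 X + m22 X"

definition transpose2 :: "'a mat2 \<Rightarrow> 'a mat2" where
  "transpose2 X = Mat2 (m11 X) (m21 X) (m12 X) (m22 X)"

text \<open>The adjugate times the determinant, which is the inverse when the determinant is
  1 or -1.\<close>

definition minv :: "'a::comm_ring_1 mat2 \<Rightarrow> 'a mat2" where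
  "minv X = Mat2 (det2 X * m22 X) (- (det2 X * m12 X)) (- (det2 X * m21 X)) (det2 X * m11 X)"

definition step :: "'a::comm_ring_1 \<Rightarrow> 'a mat2" where
  "step a = Mat2 a 1 1 0"

definition word_mat :: "'a::comm_ring_1 list \<Rightarrow> 'a mat2" where
  "word_mat xs = prod_list (map step xs)"

lemma word_mat_Nil [simp]: "word_mat [] = 1"
  and word_mat_Cons: "word_mat (a # xs) = step a * word_mat xs"
  and word_mat_append: "word_mat (xs @ ys) = word_mat xs * word_mat ys"
  by (simp_all add: word_mat_def)

lemma step_sel [simp]: "m11 (step a) = a" "m12 (step a) = 1" "m21 (step a) = 1" "m22 (step a) = 0"
  by (simp_all add: step_def)

lemma det2_mult: "det2 (X * Y) = det2 X * det2 Y"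
  by (simp add: det2_def algebra_simps)

lemma det2_step: "det2 (step a) = - 1"
  by (simp add: det2_def)

lemma det2_1 [simp]: "det2 1 = 1"
  by (simp add: det2_def)

lemma det2_word_mat: "(det2 (word_mat xs))\<^sup>2 = 1"
  by (induction xs) (simp_all add: word_mat_Cons det2_mult det2_step power_mult_distrib)

lemma minv_right: "(det2 X)\<^sup>2 = 1 \<Longrightarrow> X * minv X = 1"
  and minv_left: "(det2 X)\<^sup>2 = 1 \<Longrightarrow> minv X * X = 1"
proof -
  assume "(det2 X)\<^sup>2 = 1"
  then have "det2 X * (m11 X * m22 X - m12 X * m21 X) = 1" by (simp add: det2_def power2_eq_square)
  then have *: "det2 X * m11 X * m22 X - det2 X * m12 X * m21 X = 1" by (simp add: algebra_simps)
  show "X * minv X = 1" "minv X * X = 1"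
    by (rule mat2_eqI; use * in \<open>simp add: minv_def algebra_simps\<close>)+
qed

lemma det2_minv: "(det2 X)\<^sup>2 = 1 \<Longrightarrow> det2 (minv X) = det2 X"
proof -
  assume 1: "(det2 X)\<^sup>2 = 1"
  have "det2 (minv X) = det2 X * det2 X * (m11 X * m22 X - m12 X * m21 X)"
    unfolding det2_def[of "minv X"] by (simp add: minv_def algebra_simps)
  also have "\<dots> = (det2 X)\<^sup>2 * det2 X" by (simp add: det2_def power2_eq_square)
  finally show "det2 (minv X) = det2 X" by (simp add: 1)
qed

lemma minv_minv: "(det2 X)\<^sup>2 = 1 \<Longrightarrow> minv (minv X) = X"
proof -
  assume 1: "(det2 X)\<^sup>2 = 1"
  have "det2 X * (det2 X * y) = y" for y using 1 by (simp add: power2_eq_square mult.assoc[symmetric])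
  then show ?thesis
    by (subst minv_def, subst det2_minv[OF 1], subst det2_minv[OF 1], subst det2_minv[OF 1], subst det2_minv[OF 1])
      (simp add: minv_def mat2.expand)
qed

lemma minv_mult: "minv (X * Y) = minv Y * minv X"
  by (rule mat2_eqI) (simp_all add: minv_def det2_mult algebra_simps)

lemma transpose2_word_mat: "transpose2 (word_mat xs) = word_mat (rev xs)"
proof (induction xs)
  case Nil
  show ?case by (rule mat2_eqI) (simp_all add: transpose2_def)
next
  case (Cons a xs)
  have "transpose2 (word_mat (a # xs)) = transpose2 (word_mat xs) * step a"
    by (rule mat2_eqI) (simp_all add: transpose2_def word_mat_Cons algebra_simps)
  then show ?case using Cons by (simp add: word_mat_append word_mat_Cons)
qed

lemma word_mat_palindrome: "rev xs = xs \<Longrightarrow> m12 (word_mat xs) = m21 (word_mat xs)"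
  using arg_cong[OF transpose2_word_mat[of xs], of m12] by (simp add: transpose2_def)

text \<open>The fixed points of the Moebius transformation of Y are the roots of its form; as a
  quadratic form in v, it is the determinant of the pair v, Yv.\<close>

definition qform :: "'a::comm_ring_1 mat2 \<Rightarrow> 'a poly" where
  "qform Y = [:- m12 Y, m22 Y - m11 Y, m21 Y:]"

lemma coeff_qform: "coeff (qform Y) 0 = - m12 Y" "coeff (qform Y) 1 = m22 Y - m11 Y"
  "coeff (qform Y) 2 = m21 Y"
  by (simp_all add: qform_def numeral_2_eq_2)

lemma quad_disc_qform: "quad_disc (qform Y) = (trace2 Y)\<^sup>2 - 4 * det2 Y"
  by (simp only: quad_disc_def coeff_qform trace2_def det2_def)
    (simp add: power2_eq_square algebra_simps)

lemma trace2_commute: "trace2 (X * Y) = trace2 (Y * X)"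
  by (simp add: trace2_def algebra_simps)

lemma quad_disc_conj:
  assumes "(det2 X)\<^sup>2 = 1"
  shows "quad_disc (qform (X * Y * minv X)) = quad_disc (qform Y)"
proof -
  have "trace2 (X * Y * minv X) = trace2 (minv X * X * Y)"
    by (subst trace2_commute) (simp add: mult.assoc)
  then have "trace2 (X * Y * minv X) = trace2 Y" using assms by (simp add: minv_left)
  moreover have "det2 (X * Y * minv X) = det2 Y"
  proof -
    have "det2 (X * Y * minv X) = (det2 X)\<^sup>2 * det2 Y"
      by (simp add: det2_mult det2_minv[OF assms] power2_eq_square mult_ac)
    then show ?thesis using assms by simp
  qed
  ultimately show ?thesis by (simp add: quad_disc_qform)
qed

text \<open>Up to the factor \<open>det2 X\<close>, the lower left entry is the homogeneous form of
  \<open>Y\<close> at \<open>(- m22 X, m21 X)\<close>, the point that \<open>X\<close> sends to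
  infinity. Hence the size of the leading coefficient depends on how close this point is to a root
  of the form.\<close>

lemma conj_entries:
  "m21 (X * Y * minv X) = det2 X * (m21 Y * (m22 X)\<^sup>2 + (m11 Y - m22 Y) * m21 X * m22 X - m12 Y * (m21 X)\<^sup>2)"
  "m12 (X * Y * minv X) = det2 X * (m12 Y * (m11 X)\<^sup>2 - (m11 Y - m22 Y) * m11 X * m12 X - m21 Y * (m12 X)\<^sup>2)"
  "m22 (X * Y * minv X) - m11 (X * Y * minv X) = det2 X *
     (2 * m12 Y * m11 X * m21 X - 2 * m21 Y * m12 X * m22 X - (m11 Y - m22 Y) * (m11 X * m22 X + m12 X * m21 X))"
proof -
  have *: "m11 (minv X) = det2 X * m22 X" "m12 (minv X) = - (det2 X * m12 X)"
    "m21 (minv X) = - (det2 X * m21 X)" "m22 (minv X) = det2 X * m11 X"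
    by (simp_all add: minv_def)
  show "m21 (X * Y * minv X) = det2 X * (m21 Y * (m22 X)\<^sup>2 + (m11 Y - m22 Y) * m21 X * m22 X - m12 Y * (m21 X)\<^sup>2)"
    unfolding mat2_times_sel * power2_eq_square by (simp add: algebra_simps)
  show "m12 (X * Y * minv X) = det2 X * (m12 Y * (m11 X)\<^sup>2 - (m11 Y - m22 Y) * m11 X * m12 X - m21 Y * (m12 X)\<^sup>2)"
    unfolding mat2_times_sel * power2_eq_square by (simp add: algebra_simps)
  show "m22 (X * Y * minv X) - m11 (X * Y * minv X) = det2 X *
     (2 * m12 Y * m11 X * m21 X - 2 * m21 Y * m12 X * m22 X - (m11 Y - m22 Y) * (m11 X * m22 X + m12 X * m21 X))"
    unfolding mat2_times_sel * by (simp add: algebra_simps mult_2)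
qed

lemma dvd_conj:
  assumes "g dvd m21 Y" "g dvd m12 Y" "g dvd m22 Y - m11 Y"
  shows "g dvd m21 (X * Y * minv X) \<and> g dvd m12 (X * Y * minv X) \<and>
    g dvd m22 (X * Y * minv X) - m11 (X * Y * minv X)"
proof -
  obtain b c e where "m21 Y = g * c" "m12 Y = g * b" "m22 Y - m11 Y = g * e"
    using assms by (auto elim!: dvdE)
  then have *: "m21 Y = g * c" "m12 Y = g * b" "m11 Y - m22 Y = g * (- e)"
    by (simp_all add: algebra_simps)
  show ?thesis unfolding conj_entries *
    by (intro conjI dvd_mult[where b = "det2 X"] dvd_diff dvd_add) (blast intro: dvd_mult dvd_mult2 dvd_refl)+
qed

text \<open>Conjugating back by \<open>minv X\<close> shows that common divisors of the coefficients
  survive; the content can thus be examined on the short matrix \<open>Y\<close>.\<close>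

lemma dvd_qform_conj:
  assumes "(det2 X)\<^sup>2 = 1" and g: "\<And>i. g dvd coeff (qform (X * Y * minv X)) i"
  shows "g dvd coeff (qform Y) i"
proof -
  let ?W = "X * Y * minv X"
  have "minv X * ?W * minv (minv X) = (minv X * X) * Y * (minv X * X)"
    using assms(1) by (simp only: minv_minv mult.assoc)
  then have Y: "minv X * ?W * minv (minv X) = Y" using assms(1) by (simp add: minv_left)
  have "g dvd m21 ?W" "g dvd m12 ?W" "g dvd m22 ?W - m11 ?W"
    using g[of 2] g[of 0] g[of 1] by (simp_all only: coeff_qform dvd_minus_iff)
  from dvd_conj[OF this, of "minv X"] have "g dvd m21 Y" "g dvd m12 Y" "g dvd m22 Y - m11 Y"
    unfolding Y by auto
  then show ?thesis by (auto simp: qform_def coeff_pCons split: nat.splits)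
qed

text \<open>With \<open>v = (\<xi>, 1)\<close>, the hypotheses say that the pair v, Wv is \<tau> X
  applied to the pair (\<eta>, 1), Y(\<eta>, 1), so its determinant is multiplied by \<tau>^2 and by
  the determinant of \<open>X\<close>.\<close>

lemma ev_qform_transform:
  fixes \<xi> \<eta> \<tau> :: "'a::{finite,field} fls"
  assumes WX: "W * X = X * Y"
    and 1: "\<xi> = \<tau> * (poly_to_fls (m11 X) * \<eta> + poly_to_fls (m12 X))"
    and 2: "1 = \<tau> * (poly_to_fls (m21 X) * \<eta> + poly_to_fls (m22 X))"
  shows "fls.ev (qform W) \<xi> = \<tau>\<^sup>2 * poly_to_fls (det2 X) * fls.ev (qform Y) \<eta>"
proof -
  let ?p = poly_to_fls
  have W1: "?p (m11 W) * \<xi> + ?p (m12 W) * 1 = \<tau> * (?p (m11 (X * Y)) * \<eta> + ?p (m12 (X * Y)))"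
    unfolding WX[symmetric]
    by (subst 1, subst 2) (simp add: fls.\<iota>_add fls.\<iota>_mult algebra_simps)
  have W2: "?p (m21 W) * \<xi> + ?p (m22 W) * 1 = \<tau> * (?p (m21 (X * Y)) * \<eta> + ?p (m22 (X * Y)))"
    unfolding WX[symmetric]
    by (subst 1, subst 2) (simp add: fls.\<iota>_add fls.\<iota>_mult algebra_simps)
  have "fls.ev (qform W) \<xi> = \<xi> * (?p (m21 W) * \<xi> + ?p (m22 W) * 1) - 1 * (?p (m11 W) * \<xi> + ?p (m12 W) * 1)"
    by (simp add: qform_def fls.\<iota>_diff fls.\<iota>_minus algebra_simps)
  also have "\<dots> = \<tau> * (?p (m11 X) * \<eta> + ?p (m12 X)) * (\<tau> * (?p (m21 (X * Y)) * \<eta> + ?p (m22 (X * Y))))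
    - \<tau> * (?p (m21 X) * \<eta> + ?p (m22 X)) * (\<tau> * (?p (m11 (X * Y)) * \<eta> + ?p (m12 (X * Y))))"
    unfolding W1 W2 using 1 2 by simp
  also have "\<dots> = \<tau>\<^sup>2 * ?p (det2 X) * fls.ev (qform Y) \<eta>"
    by (simp add: qform_def det2_def fls.\<iota>_diff fls.\<iota>_minus fls.\<iota>_add fls.\<iota>_mult power2_eq_square algebra_simps)
  finally show ?thesis .
qed

section \<open>Sizes of matrix entries and of forms\<close>

lemma poly_abs_ultra: "poly_abs (a + b) \<le> max (poly_abs a) (poly_abs b)"
  by (metis fls_abs_poly poly_to_fls_add fls.ultra)

lemma poly_abs_minus [simp]: "poly_abs (- a) = poly_abs a"
  by (simp add: poly_abs_def)

lemma poly_abs_add_eq: "poly_abs b < poly_abs a \<Longrightarrow> poly_abs (a + b) = poly_abs a"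
  by (metis fls_abs_poly poly_to_fls_add fls.add_eq)

lemma poly_abs_diff_eq: "poly_abs b < poly_abs a \<Longrightarrow> poly_abs (a - b) = poly_abs a"
  using poly_abs_add_eq[of "- b" a] by simp

text \<open>The exponents of q are shifted to avoid truncated subtraction.\<close>

lemma word_mat_degrees:
  fixes xs :: "'a::{finite,field} poly list"
  assumes "xs \<noteq> []" "\<And>a. a \<in> set xs \<Longrightarrow> poly_abs a = CARD('a)"
  shows "poly_abs (m11 (word_mat xs)) = real CARD('a) ^ length xs \<and>
    real CARD('a) * poly_abs (m12 (word_mat xs)) = real CARD('a) ^ length xs \<and>
    real CARD('a) * poly_abs (m21 (word_mat xs)) = real CARD('a) ^ length xs \<and>
    real CARD('a) ^ 2 * poly_abs (m22 (word_mat xs)) \<le> real CARD('a) ^ length xs"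
  using assms
proof (induction xs)
  case (Cons a xs)
  define q where "q = real CARD('a)"
  have q: "q > 1" using card_ge2[where 'a='a] by (simp add: q_def)
  have a: "poly_abs a = q" using Cons.prems by (simp add: q_def)
  show ?case
  proof (cases "xs = []")
    case True
    then show ?thesis using a q by (simp add: word_mat_Cons q_def[symmetric])
  next
    case False
    let ?n = "length xs" and ?M = "word_mat xs"
    have IH: "poly_abs (m11 ?M) = q ^ ?n" "q * poly_abs (m12 ?M) = q ^ ?n"
      "q * poly_abs (m21 ?M) = q ^ ?n" "q ^ 2 * poly_abs (m22 ?M) \<le> q ^ ?n"
      using Cons.IH[OF False] Cons.prems by (auto simp: q_def)
    have qn: "q ^ ?n > 0" using q by simp
    have "poly_abs (m21 ?M) < poly_abs (a * m11 ?M)"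
    proof -
      have "1 * poly_abs (m21 ?M) \<le> q * poly_abs (m21 ?M)"
        using q by (intro mult_right_mono) auto
      also have "\<dots> < q * q ^ ?n" using IH(3) q qn by simp
      finally show ?thesis by (simp add: poly_abs_mult a IH)
    qed
    then have 1: "poly_abs (a * m11 ?M + m21 ?M) = q ^ Suc ?n"
      by (simp add: poly_abs_add_eq poly_abs_mult a IH)
    have "poly_abs (m22 ?M) < poly_abs (a * m12 ?M)"
    proof -
      have "q * poly_abs (m22 ?M) < q * (q * poly_abs (m22 ?M)) \<or> poly_abs (m22 ?M) = 0"
        using q by (auto simp: less_le)
      then have "q * poly_abs (m22 ?M) < q ^ ?n * q"
        using IH(4) q qn by (auto simp: power2_eq_square mult.assoc) (smt (verit) mult_less_cancel_left_pos mult.commute less_1_mult)+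
      then show ?thesis using IH(2) q by (simp add: poly_abs_mult a mult.commute)
    qed
    then have 2: "q * poly_abs (a * m12 ?M + m22 ?M) = q ^ Suc ?n"
      by (simp add: poly_abs_add_eq poly_abs_mult a IH)
    show ?thesis
      using 1 2 IH q by (simp add: word_mat_Cons q_def[symmetric] power2_eq_square mult.assoc)
  qed
qed simp

text \<open>\<rho> plays the first letter of the periodic expansion fixed by \<open>Y\<close>, since
  \<open>m11 Y / m21 Y\<close> is within less than \<open>q\<close> of it. If the expansion of
  \<eta> starts with another letter, \<open>\<eta> - \<rho>\<close> has full size and nothing
  cancels.\<close>

lemma qform_value_abs:
  fixes \<eta> :: "'a::{finite,field} fls"
  defines "q \<equiv> real CARD('a)"
  assumes \<eta>: "fls_abs \<eta> = q" "fls_abs (\<eta> - poly_to_fls \<rho>) = q"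
    and c: "m21 Y \<noteq> 0" and a: "poly_abs (m11 Y - \<rho> * m21 Y) < q * poly_abs (m21 Y)"
    and d: "poly_abs (m22 Y) < q * poly_abs (m21 Y)" and b: "poly_abs (m12 Y) < q\<^sup>2 * poly_abs (m21 Y)"
  shows "fls_abs (fls.ev (qform Y) \<eta>) = q\<^sup>2 * poly_abs (m21 Y)"
proof -
  let ?p = poly_to_fls
  have q: "q > 1" using card_ge2[where 'a='a] by (simp add: q_def)
  have ev: "fls.ev (qform Y) \<eta> = \<eta> * ((\<eta> - ?p \<rho>) * ?p (m21 Y) - ?p (m11 Y - \<rho> * m21 Y))
      + (\<eta> * ?p (m22 Y) - ?p (m12 Y))"
    by (simp add: qform_def fls.\<iota>_diff fls.\<iota>_minus fls.\<iota>_mult algebra_simps)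
  have 1: "fls_abs (\<eta> * ((\<eta> - ?p \<rho>) * ?p (m21 Y) - ?p (m11 Y - \<rho> * m21 Y))) = q\<^sup>2 * poly_abs (m21 Y)"
    using a by (simp add: fls.mult \<eta> fls.diff_eq fls_abs_poly power2_eq_square)
  have "fls_abs (\<eta> * ?p (m22 Y)) < q\<^sup>2 * poly_abs (m21 Y)"
    using d q by (simp add: fls.mult \<eta> fls_abs_poly power2_eq_square mult.assoc)
  then have "fls_abs (\<eta> * ?p (m22 Y) - ?p (m12 Y)) < q\<^sup>2 * poly_abs (m21 Y)"
    using b fls.ultra_diff[of "\<eta> * ?p (m22 Y)" "?p (m12 Y)"] by (simp add: fls_abs_poly)
  then show ?thesis unfolding ev using 1 by (subst fls.add_eq) simp_all
qed

text \<open>The mirror image of \<open>qform_value_abs\<close>: quotients of entries in a row expand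
  backwards from the last letter. \<sigma> plays the last letter before the period and \<rho> the
  last letter of the period; as they differ, the term \<open>B\<close> dominates.\<close>

lemma qform_lead_abs:
  fixes X Y :: "'a::{finite,field} poly mat2"
  defines "q \<equiv> real CARD('a)"
  assumes det: "(det2 X)\<^sup>2 = 1"
    and \<rho>: "poly_abs \<sigma> = q" "poly_abs (\<rho> - \<sigma>) = q"
    and X: "m22 X \<noteq> 0" "poly_abs (m21 X - \<sigma> * m22 X) < q * poly_abs (m22 X)"
    and b: "m12 Y \<noteq> 0" and a: "poly_abs (m11 Y - \<rho> * m12 Y) < q * poly_abs (m12 Y)"
    and d: "poly_abs (m22 Y) < q * poly_abs (m12 Y)" and c: "poly_abs (m21 Y) < q\<^sup>2 * poly_abs (m12 Y)"
  shows "poly_abs (m21 (X * Y * minv X)) = q\<^sup>2 * poly_abs (m12 Y) * (poly_abs (m22 X))\<^sup>2"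
proof -
  have q: "q > 1" using card_ge2[where 'a='a] by (simp add: q_def)
  define s where "s = m21 X - \<sigma> * m22 X"
  define a2 where "a2 = m11 Y - \<rho> * m12 Y"
  let ?q' = "m22 X" and ?q1 = "m21 X"
  have X0: "poly_abs ?q' > 0" and b0: "poly_abs (m12 Y) > 0"
    using X(1) b poly_abs_ge_1[of ?q'] poly_abs_ge_1[of "m12 Y"] by auto
  have s: "poly_abs s < q * poly_abs ?q'" using X by (simp add: s_def)
  have a2: "poly_abs a2 < q * poly_abs (m12 Y)" using a by (simp add: a2_def)
  have q1: "poly_abs ?q1 = q * poly_abs ?q'"
  proof -
    have "?q1 = \<sigma> * ?q' + s" by (simp add: s_def)
    then show ?thesis using s poly_abs_add_eq[of s "\<sigma> * ?q'"] by (simp add: poly_abs_mult \<rho>)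
  qed
  have d1: "poly_abs (det2 X) = 1"
  proof -
    have "(poly_abs (det2 X))\<^sup>2 = 1" using arg_cong[OF det, of poly_abs] by (simp add: power2_eq_square poly_abs_mult)
    then show ?thesis by (simp add: power2_eq_1_iff) (use poly_abs_nonneg[of "det2 X"] in linarith)
  qed
  define B where "B = (\<rho> - \<sigma>) * (m12 Y * ?q')"
  have B: "poly_abs B = q * poly_abs (m12 Y) * poly_abs ?q'" by (simp add: B_def poly_abs_mult \<rho>)
  have "poly_abs (a2 * ?q') < poly_abs B" using a2 X0 by (simp add: B poly_abs_mult)
  moreover have "poly_abs (m12 Y * s) < poly_abs B" using s b0 by (simp add: B poly_abs_mult mult_ac)
  ultimately have 1: "poly_abs (B + a2 * ?q' - m12 Y * s) = poly_abs B"
    by (simp add: poly_abs_diff_eq poly_abs_add_eq)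
  have main: "poly_abs (?q1 * (B + a2 * ?q' - m12 Y * s)) = q\<^sup>2 * poly_abs (m12 Y) * (poly_abs ?q')\<^sup>2"
    by (simp add: poly_abs_mult 1 q1 B power2_eq_square)
  have 2: "poly_abs (m22 Y * (?q1 * ?q')) < q\<^sup>2 * poly_abs (m12 Y) * (poly_abs ?q')\<^sup>2"
    using d X0 q by (simp add: poly_abs_mult q1 power2_eq_square mult_ac)
  have 3: "poly_abs (m21 Y * ?q'\<^sup>2) < q\<^sup>2 * poly_abs (m12 Y) * (poly_abs ?q')\<^sup>2"
    using c X0 by (simp add: poly_abs_mult power2_eq_square)
  have "m21 (X * Y * minv X) = det2 X * (?q1 * (B + a2 * ?q' - m12 Y * s) - m22 Y * (?q1 * ?q') + m21 Y * ?q'\<^sup>2)"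
    unfolding conj_entries by (simp add: B_def a2_def s_def power2_eq_square algebra_simps)
  then show ?thesis using main 2 3 d1
    by (simp add: poly_abs_mult poly_abs_diff_eq poly_abs_add_eq)
qed

section \<open>Complete quotients and convergents\<close>

primrec complete_quotient :: "'a::field fls \<Rightarrow> (nat \<Rightarrow> 'a poly) \<Rightarrow> nat \<Rightarrow> 'a fls" where
  "complete_quotient \<xi> a 0 = \<xi>"
| "complete_quotient \<xi> a (Suc n) = inverse (complete_quotient \<xi> a n - poly_to_fls (a n))"

lemma fls_abs_cf_fin: "(\<And>i. poly_abs (a i) > 1) \<Longrightarrow> fls_abs (cf_fin n a) = poly_abs (a 0)"
proof (induction n arbitrary: a)
  case (Suc n)
  have "fls_abs (cf_fin n (\<lambda>i. a (Suc i))) = poly_abs (a 1)" using Suc by simp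
  then have "fls_abs (inverse (cf_fin n (\<lambda>i. a (Suc i)))) < 1"
    using Suc.prems[of 1] by (simp add: fls.divide field_simps)
  then have "fls_abs (inverse (cf_fin n (\<lambda>i. a (Suc i)))) < poly_abs (a 0)"
    using Suc.prems[of 0] by simp
  then show ?case by (simp add: fls.add_eq fls_abs_poly)
qed (simp add: fls_abs_poly)

text \<open>All truncations of the tail have the same absolute value \<open>c\<close>, so near the
  limit inversion multiplies distances by exactly \<open>c\<^sup>2\<close> and convergence passes to
  the tail.\<close>

lemma has_cf_step:
  fixes a :: "nat \<Rightarrow> 'a::{finite,field} poly"
  assumes cf: "has_cf \<xi> a" and a: "\<And>i. poly_abs (a (Suc i)) > 1"
  shows "has_cf (inverse (\<xi> - poly_to_fls (a 0))) (\<lambda>i. a (Suc i))"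
    and "fls_abs (\<xi> - poly_to_fls (a 0)) = 1 / poly_abs (a 1)"
proof -
  define y where "y n = cf_fin n (\<lambda>i. a (Suc i))" for n
  define z where "z = \<xi> - poly_to_fls (a 0)"
  define c where "c = poly_abs (a 1)"
  have c: "c > 1" using a[of 0] by (simp add: c_def)
  have y: "fls_abs (y n) = c" for n
    unfolding y_def c_def using fls_abs_cf_fin[of "\<lambda>i. a (Suc i)"] a by simp
  have y0: "y n \<noteq> 0" for n using y[of n] c by auto
  have lim: "(\<lambda>n. fls_abs (z - inverse (y n))) \<longlonglongrightarrow> 0"
    using LIMSEQ_Suc[OF cf[unfolded has_cf_def]] by (simp add: z_def y_def diff_diff_eq)
  have "eventually (\<lambda>n. fls_abs (z - inverse (y n)) < 1 / c) sequentially"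
    using lim c by (intro order_tendstoD(2)) auto
  then obtain n where n: "fls_abs (z - inverse (y n)) < 1 / c" by (auto simp: eventually_sequentially)
  have "fls_abs (inverse (y n)) = 1 / c" by (simp add: fls.divide y inverse_eq_divide)
  then have "fls_abs (inverse (y n) + (z - inverse (y n))) = 1 / c"
    using n by (subst fls.add_eq) auto
  then have zc: "fls_abs z = 1 / c" by simp
  then show "fls_abs (\<xi> - poly_to_fls (a 0)) = 1 / poly_abs (a 1)" by (simp add: z_def c_def)
  have z0: "z \<noteq> 0" using zc c by auto
  have "inverse z - y n = - ((z - inverse (y n)) * (inverse z * y n))" for n
    using z0 y0[of n] by (simp add: field_simps)
  then have "fls_abs (inverse z - y n) = fls_abs (z - inverse (y n)) * c\<^sup>2" for n
    by (simp add: fls.mult fls.inverse zc y power2_eq_square)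
  moreover have "(\<lambda>n. fls_abs (z - inverse (y n)) * c\<^sup>2) \<longlonglongrightarrow> 0 * c\<^sup>2"
    by (intro tendsto_mult lim tendsto_const)
  ultimately show "has_cf (inverse (\<xi> - poly_to_fls (a 0))) (\<lambda>i. a (Suc i))"
    by (simp add: has_cf_def z_def y_def)
qed

locale linear_cf =
  fixes \<xi> :: "'a::{finite,field} fls" and a :: "nat \<Rightarrow> 'a poly" and q :: real
  assumes cf: "has_cf \<xi> a" and a0: "a 0 = 0" and abs_a: "i > 0 \<Longrightarrow> poly_abs (a i) = q"
    and q_card: "q = CARD('a)"
begin

lemma q_gt_1: "q > 1"
  using card_ge2[where 'a='a] by (simp add: q_card)

abbreviation "cq \<equiv> complete_quotient \<xi> a"

lemma has_cf_cq: "has_cf (cq n) (\<lambda>i. a (i + n))"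
proof (induction n)
  case 0
  then show ?case using cf by simp
next
  case (Suc n)
  from has_cf_step(1)[OF Suc] show ?case using abs_a q_gt_1 by simp
qed

lemma cq_diff: "fls_abs (cq n - poly_to_fls (a n)) = 1 / q"
  using has_cf_step(2)[OF has_cf_cq[of n]] abs_a q_gt_1 by simp

lemma cq_Suc: "cq n = poly_to_fls (a n) + inverse (cq (Suc n))"
  by simp

lemma fls_abs_cq: "n > 0 \<Longrightarrow> fls_abs (cq n) = q"
  using cq_diff[of "n - 1"] by (cases n) (simp_all add: fls.inverse)

lemma fls_abs_xi: "fls_abs \<xi> \<le> 1"
  using cq_diff[of 0] q_gt_1 by (simp add: a0)

definition conv :: "nat \<Rightarrow> 'a poly mat2" where
  "conv n = word_mat (map a [0..<n])"

lemma conv_add: "conv (m + n) = conv m * word_mat (map a [m..<m + n])"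
proof -
  have "[0..<m + n] = [0..<m] @ [m..<m + n]" by (rule upt_add_eq_append) simp
  then show ?thesis by (simp only: conv_def map_append word_mat_append)
qed

lemma conv_Suc: "conv (Suc n) = conv n * step (a n)"
  by (simp add: conv_def word_mat_append word_mat_Cons)

lemma det2_conv: "(det2 (conv n))\<^sup>2 = 1"
  unfolding conv_def by (rule det2_word_mat)

text \<open>\<tau> is the inverse of the denominator of the Moebius transformation; every step
  contributes the inverse of a complete quotient of size \<open>q\<close>.\<close>

lemma conv_cq:
  "\<exists>\<tau>. fls_abs \<tau> = 1 / q ^ n \<and>
     \<xi> = \<tau> * (poly_to_fls (m11 (conv n)) * cq n + poly_to_fls (m12 (conv n))) \<and>
     1 = \<tau> * (poly_to_fls (m21 (conv n)) * cq n + poly_to_fls (m22 (conv n)))"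
proof (induction n)
  case 0
  show ?case by (rule exI[of _ 1]) (simp add: conv_def)
next
  case (Suc n)
  then obtain \<tau> where \<tau>: "fls_abs \<tau> = 1 / q ^ n"
    "\<xi> = \<tau> * (poly_to_fls (m11 (conv n)) * cq n + poly_to_fls (m12 (conv n)))"
    "1 = \<tau> * (poly_to_fls (m21 (conv n)) * cq n + poly_to_fls (m22 (conv n)))" by blast
  define \<eta> where "\<eta> = cq (Suc n)"
  have \<eta>: "fls_abs \<eta> = q" unfolding \<eta>_def by (rule fls_abs_cq) simp
  then have \<eta>0: "\<eta> \<noteq> 0" using q_gt_1 by auto
  have cq: "cq n = poly_to_fls (a n) + inverse \<eta>" unfolding \<eta>_def by (rule cq_Suc)
  have 1: "(u * cq n + v) = inverse \<eta> * ((u * poly_to_fls (a n) + v) * \<eta> + u)" for u v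
    unfolding cq using \<eta>0 by (simp add: field_simps)
  have "fls_abs (\<tau> * inverse \<eta>) = 1 / q ^ Suc n"
    by (simp add: fls.mult fls.inverse fls.divide \<tau>(1) \<eta> field_simps)
  moreover have "\<xi> = \<tau> * inverse \<eta> * (poly_to_fls (m11 (conv (Suc n))) * \<eta> + poly_to_fls (m12 (conv (Suc n))))"
    by (subst \<tau>(2), subst 1) (simp add: conv_Suc fls.\<iota>_add fls.\<iota>_mult mult.assoc)
  moreover have "1 = \<tau> * inverse \<eta> * (poly_to_fls (m21 (conv (Suc n))) * \<eta> + poly_to_fls (m22 (conv (Suc n))))"
    by (subst \<tau>(3), subst 1) (simp add: conv_Suc fls.\<iota>_add fls.\<iota>_mult mult.assoc)
  ultimately show ?case unfolding \<eta>_def by (intro exI conjI)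
qed

lemma qform_value:
  assumes "W * conv n = conv n * Y"
  shows "fls_abs (eval_fls (qform W) \<xi>) = fls_abs (fls.ev (qform Y) (cq n)) / q ^ (2 * n)"
proof -
  obtain \<tau> where \<tau>: "fls_abs \<tau> = 1 / q ^ n"
    "\<xi> = \<tau> * (poly_to_fls (m11 (conv n)) * cq n + poly_to_fls (m12 (conv n)))"
    "1 = \<tau> * (poly_to_fls (m21 (conv n)) * cq n + poly_to_fls (m22 (conv n)))"
    using conv_cq by blast
  have "(poly_abs (det2 (conv n)))\<^sup>2 = 1"
    using arg_cong[OF det2_conv, of poly_abs n] by (simp add: power2_eq_square poly_abs_mult)
  then have d: "poly_abs (det2 (conv n)) = 1"
    by (simp add: power2_eq_1_iff) (use poly_abs_nonneg[of "det2 (conv n)"] in linarith)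
  show ?thesis
    unfolding eval_fls_eq_ev ev_qform_transform[OF assms \<tau>(2,3)]
    by (simp add: fls.mult fls.power \<tau>(1) fls_abs_poly d power_divide power_mult mult.commute)
qed

lemma conv_bottom_ge_2:
  assumes "n \<ge> 2"
  shows "q * poly_abs (m21 (conv n)) = q ^ n" "q ^ 2 * poly_abs (m22 (conv n)) = q ^ n"
proof -
  let ?xs = "map a [1..<n]"
  \<comment> \<open>The letter \<open>a 0 = 0\<close> merely swaps the rows, so the bottom row of
    \<open>conv n\<close> is the top row of the remaining word.\<close>
  have "[0..<n] = 0 # [1..<n]" using assms by (simp add: upt_conv_Cons)
  then have eq: "conv n = step 0 * word_mat ?xs" by (simp add: conv_def a0 word_mat_Cons)
  have ne: "?xs \<noteq> []" using assms by simp
  have letters: "poly_abs x = CARD('a)" if "x \<in> set ?xs" for x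
    using that abs_a by (auto simp: q_card)
  have "poly_abs (m11 (word_mat ?xs)) = q ^ length ?xs \<and> q * poly_abs (m12 (word_mat ?xs)) = q ^ length ?xs"
    using word_mat_degrees[OF ne letters] by (simp add: q_card)
  moreover have "q * q ^ length ?xs = q ^ n"
    using assms by (cases n) simp_all
  ultimately show "q * poly_abs (m21 (conv n)) = q ^ n" "q ^ 2 * poly_abs (m22 (conv n)) = q ^ n"
    by (auto simp: eq power2_eq_square mult.assoc)
qed

lemma conv_bottom:
  assumes "n \<ge> 1"
  shows "q * poly_abs (m21 (conv n)) = q ^ n" "poly_abs (m22 (conv n)) < q * poly_abs (m21 (conv n))"
proof -
  have "q * poly_abs (m21 (conv n)) = q ^ n \<and> poly_abs (m22 (conv n)) < q * poly_abs (m21 (conv n))"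
  proof (cases "n \<ge> 2")
    case True
    have "q ^ 2 * poly_abs (m22 (conv n)) > 0" using conv_bottom_ge_2(2)[OF True] q_gt_1 by simp
    then have "poly_abs (m22 (conv n)) > 0" using q_gt_1 by (simp add: zero_less_mult_iff)
    then have "1 * poly_abs (m22 (conv n)) < q ^ 2 * poly_abs (m22 (conv n))"
      using q_gt_1 by (intro mult_strict_right_mono) (auto simp: one_less_power)
    then show ?thesis using conv_bottom_ge_2[OF True] by simp
  next
    case False
    then have "n = 1" using assms by simp
    then show ?thesis using q_gt_1 by (simp add: conv_def a0 word_mat_Cons)
  qed
  then show "q * poly_abs (m21 (conv n)) = q ^ n" "poly_abs (m22 (conv n)) < q * poly_abs (m21 (conv n))"
    by auto
qed

text \<open>With the convergent matrix of length n = degree u + 1, a value of the linear form smaller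
  than q^(-n) would force u to have absolute value at least q^n.\<close>

lemma badly_approximable:
  assumes "u \<noteq> 0"
  shows "1 / (q * poly_abs u) \<le> fls_abs (poly_to_fls u * \<xi> + poly_to_fls v)"
proof (rule ccontr)
  assume "\<not> ?thesis"
  then have less: "fls_abs (poly_to_fls u * \<xi> + poly_to_fls v) < 1 / (q * poly_abs u)" by simp
  define n where "n = Suc (degree u)"
  have qn: "q * poly_abs u = q ^ n" using assms by (simp add: n_def poly_abs_def q_card)
  obtain \<tau> where \<tau>: "fls_abs \<tau> = 1 / q ^ n"
    "\<xi> = \<tau> * (poly_to_fls (m11 (conv n)) * cq n + poly_to_fls (m12 (conv n)))"
    "1 = \<tau> * (poly_to_fls (m21 (conv n)) * cq n + poly_to_fls (m22 (conv n)))"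
    using conv_cq by blast
  define u' where "u' = u * m11 (conv n) + v * m21 (conv n)"
  define v' where "v' = u * m12 (conv n) + v * m22 (conv n)"
  have "poly_to_fls u * \<xi> + poly_to_fls v * 1 = \<tau> * (poly_to_fls u' * cq n + poly_to_fls v')"
    by (subst \<tau>(2), subst \<tau>(3)) (simp add: u'_def v'_def fls.\<iota>_add fls.\<iota>_mult algebra_simps)
  then have "fls_abs (poly_to_fls u' * cq n + poly_to_fls v') < 1"
    using less qn q_gt_1 by (simp add: fls.mult \<tau>(1) divide_less_cancel)
  moreover have "fls_abs (cq n) = q" by (rule fls_abs_cq) (simp add: n_def)
  ultimately have small: "fls_abs (poly_to_fls u' * cq n + poly_to_fls v') < 1"
    and cq: "fls_abs (cq n) = q" by auto
  \<comment> \<open>Cramer's rule recovers \<open>u\<close> from \<open>u'\<close> and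
    \<open>v'\<close>, up to the sign carried by the determinant.\<close>
  have u_eq: "u = det2 (conv n) * (u' * m22 (conv n) - v' * m21 (conv n))"
  proof -
    have "u' * m22 (conv n) - v' * m21 (conv n) = u * det2 (conv n)"
      by (simp add: u'_def v'_def det2_def algebra_simps)
    then have "det2 (conv n) * (u' * m22 (conv n) - v' * m21 (conv n)) = u * (det2 (conv n))\<^sup>2"
      by (simp add: power2_eq_square mult_ac)
    then show ?thesis by (simp add: det2_conv)
  qed
  have u'0: "u' \<noteq> 0"
  proof
    assume "u' = 0"
    then have "poly_abs v' < 1" using small by (simp add: fls_abs_poly)
    then have "v' = 0" using poly_abs_ge_1[of v'] by fastforce
    then show False using u_eq \<open>u' = 0\<close> assms by simp
  qed
  have v': "poly_abs v' = q * poly_abs u'"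
  proof -
    have "1 \<le> fls_abs (poly_to_fls u' * cq n)"
      using poly_abs_ge_1[OF u'0] q_gt_1 by (simp add: fls.mult fls_abs_poly cq mult_ge1_I)
    then have "fls_abs ((poly_to_fls u' * cq n + poly_to_fls v') - poly_to_fls u' * cq n)
        = fls_abs (poly_to_fls u' * cq n)"
      using small by (intro fls.diff_eq') simp
    then show ?thesis by (simp add: fls.mult fls_abs_poly cq)
  qed
  have u'1: "poly_abs u' \<ge> 1" using u'0 by (rule poly_abs_ge_1)
  have d1: "poly_abs (det2 (conv n)) = 1"
  proof -
    have "(poly_abs (det2 (conv n)))\<^sup>2 = 1"
      using arg_cong[OF det2_conv, of poly_abs n] by (simp add: power2_eq_square poly_abs_mult)
    then show ?thesis by (simp add: power2_eq_1_iff) (use poly_abs_nonneg[of "det2 (conv n)"] in linarith)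
  qed
  have m: "q * poly_abs (m21 (conv n)) = q ^ n" "poly_abs (m22 (conv n)) < q * poly_abs (m21 (conv n))"
    by (rule conv_bottom; simp add: n_def)+
  have "poly_abs (u' * m22 (conv n)) < poly_abs (v' * m21 (conv n))"
    using m(2) u'1 by (simp add: poly_abs_mult v' mult_ac)
  then have "poly_abs (u' * m22 (conv n) - v' * m21 (conv n)) = poly_abs (v' * m21 (conv n))"
    by (metis poly_abs_diff_eq poly_abs_minus minus_diff_eq)
  then have "poly_abs u = poly_abs u' * q ^ n"
    by (subst u_eq) (simp add: poly_abs_mult d1 v' mult_ac flip: m(1))
  moreover have "1 * q ^ n \<le> poly_abs u' * q ^ n" using u'1 q_gt_1 by (intro mult_right_mono) auto
  ultimately have "q * poly_abs u \<le> poly_abs u" using qn by linarith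
  moreover have "poly_abs u \<ge> 1" using assms by (rule poly_abs_ge_1)
  ultimately show False using q_gt_1 by (simp add: mult_le_cancel_right1)
qed

end

section \<open>Two families of quadratic approximations\<close>

text \<open>\<open>E j\<close> is the position where group \<open>j\<close> starts:
  \<open>k + 1\<close> units of length \<open>r ^ Suc j\<close>, whose letters are given by
  \<open>U\<close>; \<open>E 0\<close> skips the letter 0 and the initial \<open>k\<close> letters
  \<open>T\<close>. The clause \<open>parity\<close> unites both characteristics.\<close>

locale theta_cf = linear_cf \<xi> a q for \<xi> :: "'a::{finite,field} fls" and a q +
  fixes k r :: nat and lam mu :: 'a and E :: "nat \<Rightarrow> nat" and U :: "nat \<Rightarrow> 'a poly"
  assumes E_0: "E 0 = 1 + k" and E_Suc: "E (Suc j) = E j + (k + 1) * r ^ Suc j"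
    and U_def: "U i = (if i = 0 then [:0, 1:] else if odd i then [:0, lam:] else [:0, mu:])"
    and block: "m \<le> k \<Longrightarrow> i < r ^ Suc j \<Longrightarrow> a (E j + m * r ^ Suc j + i) = U i"
    and lam: "lam \<noteq> 0" "lam \<noteq> 1" and mu: "mu \<noteq> 0" "mu \<noteq> 1"
    and parity: "odd r \<or> lam = mu" and r: "r \<ge> 2"
begin

lemma poly_abs_monomial: "c \<noteq> 0 \<Longrightarrow> poly_abs [:0, c :: 'a:] = q"
  by (simp add: poly_abs_def q_card)

lemma poly_abs_const: "c \<noteq> 0 \<Longrightarrow> poly_abs [:c :: 'a:] = 1"
  by (simp add: poly_abs_def)

lemma poly_abs_U: "poly_abs (U i) = q"
  using lam mu by (simp add: U_def poly_abs_monomial)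

definition alt_word :: "nat \<Rightarrow> 'a poly list" where
  "alt_word n = map (\<lambda>i. U (Suc i)) [0..<n]"

lemma length_alt_word [simp]: "length (alt_word n) = n"
  by (simp add: alt_word_def)

lemma set_alt_word: "x \<in> set (alt_word n) \<Longrightarrow> poly_abs x = q"
  by (auto simp: alt_word_def poly_abs_U)

lemma alt_word_Suc: "alt_word (Suc n) = alt_word n @ [U (Suc n)]"
  by (simp add: alt_word_def)

abbreviation "S n \<equiv> word_mat (alt_word n)"
abbreviation "T \<equiv> [:0, 1 :: 'a:]"

lemma r_pow_pos: "r ^ n > 0"
  using r by simp

lemma odd_r_pow: "odd (r ^ n) \<or> lam = mu"
  using parity by auto

lemma E_pos: "E j \<ge> 1"
  by (induction j) (simp_all add: E_0 E_Suc)

lemma conv_block: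
  assumes "m \<le> k" "i + l \<le> r ^ Suc j" "i > 0"
  shows "conv (E j + m * r ^ Suc j + i + l) = conv (E j + m * r ^ Suc j + i) * word_mat (map (\<lambda>t. U (i + t)) [0..<l])"
proof -
  let ?s = "E j + m * r ^ Suc j + i"
  have "map a [?s..<?s + l] = map (\<lambda>t. U (i + t)) [0..<l]"
  proof (rule nth_equalityI)
    fix t assume "t < length (map a [?s..<?s + l])"
    then have t: "t < l" by simp
    have "a (E j + m * r ^ Suc j + (i + t)) = U (i + t)"
      using assms t by (intro block) auto
    then show "map a [?s..<?s + l] ! t = map (\<lambda>t. U (i + t)) [0..<l] ! t"
      using t by (simp add: add.assoc)
  qed simp
  then show ?thesis by (simp add: conv_add)
qed

lemma conv_start:
  assumes "m \<le> k"
  shows "conv (Suc (E j + m * r ^ Suc j)) = conv (E j + m * r ^ Suc j) * step T"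
  using block[OF assms, of 0 j] r_pow_pos[of "Suc j"] by (simp add: conv_Suc U_def)

lemma conv_copy:
  assumes "m \<le> k" "l < r ^ Suc j"
  shows "conv (E j + m * r ^ Suc j + Suc l) = conv (Suc (E j + m * r ^ Suc j)) * S l"
  using conv_block[OF assms(1), of 1 l j] assms(2) by (simp add: alt_word_def)

definition period :: "nat \<Rightarrow> 'a poly mat2" where
  "period n = word_mat (T # alt_word (n - 1))"

lemma conv_period:
  assumes "m \<le> k" "0 < n" "n \<le> r ^ Suc j"
  shows "conv (E j + m * r ^ Suc j + n) = conv (E j + m * r ^ Suc j) * period n"
  using conv_copy[OF assms(1), of "n - 1" j] conv_start[OF assms(1), of j] assms
  by (simp add: period_def word_mat_Cons mult.assoc)

lemma conv_periods:
  "m \<le> Suc k \<Longrightarrow> conv (E j + m * r ^ Suc j) = conv (E j) * period (r ^ Suc j) ^ m"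
proof (induction m)
  case (Suc m)
  have "conv (E j + Suc m * r ^ Suc j) = conv (E j + m * r ^ Suc j + r ^ Suc j)" by (simp add: algebra_simps)
  also have "\<dots> = conv (E j + m * r ^ Suc j) * period (r ^ Suc j)"
    using Suc.prems r by (intro conv_period) auto
  finally show ?case using Suc by (simp add: mult.assoc power_commutes)
qed simp

text \<open>After the first unit of a group comes the first letter of the next unit, which belongs
  to the next group if \<open>k = 0\<close>.\<close>

lemma next_letter: "a (E j + r ^ Suc j) = T"
proof (cases "k = 0")
  case True
  have "a (E (Suc j) + 0 * r ^ Suc (Suc j) + 0) = U 0" using r by (intro block) auto
  then show ?thesis using True by (simp add: E_Suc U_def)
next
  case False
  have "a (E j + 1 * r ^ Suc j + 0) = U 0" using False r by (intro block) auto
  then show ?thesis by (simp add: U_def)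
qed

text \<open>The matrix of the invariant quadratic form of the purely alternating expansion, whose
  discriminant has degree 2.\<close>

definition alt_mat :: "'a \<Rightarrow> 'a \<Rightarrow> 'a poly mat2" where
  "alt_mat x y = Mat2 [:0, x * y:] [:x:] [:y:] 0"

lemma alt_mat_sel [simp]: "m11 (alt_mat x y) = [:0, x * y:]" "m12 (alt_mat x y) = [:x:]"
  "m21 (alt_mat x y) = [:y:]" "m22 (alt_mat x y) = 0"
  by (simp_all add: alt_mat_def)

text \<open>\<open>alt_mat x y\<close> is \<open>step [:0, x:] * step [:0, y:] - 1\<close> divided
  by \<open>T\<close>, so moving it past one letter rotates the period and exchanges
  \<open>x\<close> and \<open>y\<close>.\<close>

lemma alt_mat_step: "alt_mat x y * step [:0, x:] = step [:0, x:] * alt_mat y x"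
  by (rule mat2_eqI) (simp_all add: algebra_simps)

lemma alt_mat_word: "alt_mat lam mu * S n = S n * (if even n then alt_mat lam mu else alt_mat mu lam)"
proof (induction n)
  case (Suc n)
  let ?x = "if even n then lam else mu" and ?y = "if even n then mu else lam"
  have U: "U (Suc n) = [:0, ?x:]" by (simp add: U_def)
  have "alt_mat lam mu * S (Suc n) = S n * (alt_mat ?x ?y * step [:0, ?x:])"
    using Suc by (simp add: alt_word_Suc word_mat_append word_mat_Cons U mult.assoc[symmetric] split: if_splits)
  then show ?case
    unfolding alt_mat_step by (simp add: alt_word_Suc word_mat_append word_mat_Cons U mult.assoc)
qed (simp add: alt_word_def)

section \<open>The family that switches to the alternating period\<close>

definition const_quad :: "nat \<Rightarrow> 'a poly mat2" where
  "const_quad j = conv (Suc (E j)) * alt_mat lam mu * minv (conv (Suc (E j)))"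

lemma conv_Suc_bottom:
  fixes m j :: nat
  assumes "m \<le> k"
  defines "s \<equiv> E j + m * r ^ Suc j"
  shows "m22 (conv (Suc s)) = m21 (conv s)" "m21 (conv (Suc s)) = T * m22 (conv (Suc s)) + m22 (conv s)"
    "q * poly_abs (m22 (conv (Suc s))) = q ^ s"
    "poly_abs (m21 (conv (Suc s)) - T * m22 (conv (Suc s))) < q * poly_abs (m22 (conv (Suc s)))"
    "m22 (conv (Suc s)) \<noteq> 0"
proof -
  have s: "s \<ge> 1" using E_pos[of j] by (simp add: s_def)
  note b = conv_bottom[OF s]
  have eq: "conv (Suc s) = conv s * step T" unfolding s_def by (rule conv_start[OF assms(1)])
  show 1: "m22 (conv (Suc s)) = m21 (conv s)" by (simp add: eq)
  show 2: "m21 (conv (Suc s)) = T * m22 (conv (Suc s)) + m22 (conv s)" by (simp add: eq)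
  show 3: "q * poly_abs (m22 (conv (Suc s))) = q ^ s" using b by (simp add: 1)
  show "poly_abs (m21 (conv (Suc s)) - T * m22 (conv (Suc s))) < q * poly_abs (m22 (conv (Suc s)))"
    unfolding 2 using b by (simp add: 1)
  show "m22 (conv (Suc s)) \<noteq> 0"
    using 3 q_gt_1 by (metis mult_zero_right poly_abs_0 power_eq_0_iff not_one_less_zero)
qed

lemma const_quad_lead: "poly_abs (m21 (const_quad j)) = q ^ (2 * E j)"
proof -
  note b = conv_Suc_bottom[of 0 j, simplified]
  have "poly_abs (m21 (const_quad j)) = q\<^sup>2 * poly_abs (m12 (alt_mat lam mu)) * (poly_abs (m22 (conv (Suc (E j)))))\<^sup>2"
    unfolding const_quad_def q_card
  \<comment> \<open>The convergent ends in \<open>T\<close>, the alternating period in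
    \<open>mu T\<close>, and \<open>mu\<close> differs from 1.\<close>
  proof (rule qform_lead_abs[where \<sigma> = T and \<rho> = "[:0, mu:]"])
    show "(det2 (conv (Suc (E j))))\<^sup>2 = 1" by (rule det2_conv)
    show "poly_abs T = real CARD('a)" using poly_abs_monomial[of 1] by (simp add: q_card)
    have "poly_abs [:0, mu - 1:] = q" using mu by (intro poly_abs_monomial) simp
    then show "poly_abs ([:0, mu:] - T) = real CARD('a)" by (simp add: q_card)
    show "m22 (conv (Suc (E j))) \<noteq> 0" by (rule b(5))
    show "poly_abs (m21 (conv (Suc (E j))) - T * m22 (conv (Suc (E j)))) < real CARD('a) * poly_abs (m22 (conv (Suc (E j))))"
      using b(4) by (simp add: q_card)
    have "real CARD('a) > 1" "(real CARD('a))\<^sup>2 > 1"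
      using q_gt_1 by (auto simp: q_card one_less_power)
    then show "m12 (alt_mat lam mu) \<noteq> 0"
      "poly_abs (m11 (alt_mat lam mu) - [:0, mu:] * m12 (alt_mat lam mu)) < real CARD('a) * poly_abs (m12 (alt_mat lam mu))"
      "poly_abs (m22 (alt_mat lam mu)) < real CARD('a) * poly_abs (m12 (alt_mat lam mu))"
      "poly_abs (m21 (alt_mat lam mu)) < (real CARD('a))\<^sup>2 * poly_abs (m12 (alt_mat lam mu))"
      using lam mu by (simp_all add: poly_abs_const mult.commute)
  qed
  also have "\<dots> = (q * poly_abs (m22 (conv (Suc (E j)))))\<^sup>2"
    using lam by (simp add: poly_abs_const power_mult_distrib)
  also have "\<dots> = q ^ (2 * E j)" by (simp add: b(3) power_mult mult.commute flip: power_mult)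
  finally show ?thesis .
qed

text \<open>The purely alternating continuation agrees with the true expansion up to the end of the
  first unit. There the true letter is \<open>T\<close>, whereas the alternation would continue with
  \<open>lam T\<close> or \<open>mu T\<close>.\<close>

lemma const_quad_value:
  defines "n j \<equiv> r ^ Suc j"
  shows "fls_abs (eval_fls (qform (const_quad j)) \<xi>) = q\<^sup>2 / q ^ (2 * (E j + n j))"
proof -
  let ?K = "if even (n j - 1) then alt_mat lam mu else alt_mat mu lam"
  have nj: "n j > 0" using r by (simp add: n_def)
  have c: "conv (E j + n j) = conv (Suc (E j)) * S (n j - 1)"
    using conv_copy[of 0 "n j - 1" j] nj by (simp add: n_def)
  have "const_quad j * conv (E j + n j)
      = conv (Suc (E j)) * alt_mat lam mu * (minv (conv (Suc (E j))) * conv (Suc (E j))) * S (n j - 1)"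
    by (simp add: const_quad_def c mult.assoc)
  also have "\<dots> = conv (Suc (E j)) * (alt_mat lam mu * S (n j - 1))"
    by (simp add: minv_left[OF det2_conv] mult.assoc)
  also have "\<dots> = conv (E j + n j) * ?K" unfolding alt_mat_word c by (simp add: mult.assoc)
  finally have comm: "const_quad j * conv (E j + n j) = conv (E j + n j) * ?K" .
  have cq_T: "fls_abs (cq (E j + n j) - poly_to_fls T) = 1 / q"
    using cq_diff[of "E j + n j"] next_letter[of j] by (simp add: n_def)
  have "fls_abs (fls.ev (qform (alt_mat x y)) (cq (E j + n j))) = q\<^sup>2" 
    if "x \<noteq> 0" "x \<noteq> 1" "y \<noteq> 0" for x y
  proof -
    have "fls_abs (fls.ev (qform (alt_mat x y)) (cq (E j + n j))) = (real CARD('a))\<^sup>2 * poly_abs (m21 (alt_mat x y))"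
    proof (rule qform_value_abs[where \<rho> = "[:0, x:]"])
      show "fls_abs (cq (E j + n j)) = real CARD('a)"
        using fls_abs_cq[of "E j + n j"] nj by (simp add: q_card)
      have "poly_abs [:0, 1 - x:] = q" using that by (intro poly_abs_monomial) simp
      then have "fls_abs (poly_to_fls T - poly_to_fls [:0, x:]) = q"
        by (simp add: fls_abs_poly flip: fls.\<iota>_diff)
      moreover have "1 / q < q" using q_gt_1 by (simp add: divide_less_eq less_1_mult)
      ultimately have "fls_abs ((cq (E j + n j) - poly_to_fls T) + (poly_to_fls T - poly_to_fls [:0, x:])) = q"
        by (subst fls.add_eq') (simp_all add: cq_T)
      then show "fls_abs (cq (E j + n j) - poly_to_fls [:0, x:]) = real CARD('a)" by (simp add: q_card)
      have "real CARD('a) > 1" "(real CARD('a))\<^sup>2 > 1"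
        using q_gt_1 by (auto simp: q_card one_less_power)
      then show "m21 (alt_mat x y) \<noteq> 0"
        "poly_abs (m11 (alt_mat x y) - [:0, x:] * m21 (alt_mat x y)) < real CARD('a) * poly_abs (m21 (alt_mat x y))"
        "poly_abs (m22 (alt_mat x y)) < real CARD('a) * poly_abs (m21 (alt_mat x y))"
        "poly_abs (m12 (alt_mat x y)) < (real CARD('a))\<^sup>2 * poly_abs (m21 (alt_mat x y))"
        using that by (simp_all add: poly_abs_const mult.commute)
    qed
    then show ?thesis using that by (simp add: poly_abs_const q_card)
  qed
  then have "fls_abs (fls.ev (qform ?K) (cq (E j + n j))) = q\<^sup>2" using lam mu by simp
  then show ?thesis using qform_value[OF comm] by simp
qed

lemma monomial_of_const: "c \<noteq> 0 \<Longrightarrow> [:c:] dvd [:0, 1 :: 'a:]"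
  by (rule dvdI[of _ _ "[:0, inverse c:]"]) simp

lemma const_quad_content:
  assumes "\<And>i. g dvd coeff (qform (const_quad j)) i"
  shows "g dvd T"
proof -
  have "g dvd coeff (qform (alt_mat lam mu)) 2"
    using assms unfolding const_quad_def by (rule dvd_qform_conj[OF det2_conv])
  then have "g dvd [:mu:]" by (simp add: coeff_qform)
  then show ?thesis using monomial_of_const[OF mu(1)] by (rule dvd_trans)
qed

lemma poly_abs_numeral_mult_le: "poly_abs (numeral n * c :: 'a poly) \<le> poly_abs c"
proof -
  have "fls_abs (numeral n :: 'a fls) \<le> 1" by (simp add: fls_abs_def)
  then have "fls_abs (numeral n * poly_to_fls c) \<le> 1 * fls_abs (poly_to_fls c)"
    unfolding fls.mult by (intro mult_right_mono) (auto simp: fls.nonneg)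
  then show ?thesis by (simp add: fls_abs_poly[symmetric] fls.\<iota>_mult fls.\<iota>_numeral)
qed

lemma const_quad_disc: "poly_abs (quad_disc (qform (const_quad j))) = q\<^sup>2"
proof -
  have "quad_disc (qform (const_quad j)) = quad_disc (qform (alt_mat lam mu))"
    unfolding const_quad_def by (rule quad_disc_conj[OF det2_conv])
  also have "\<dots> = [:0, lam * mu:]\<^sup>2 - 4 * - [:lam * mu:]"
    by (simp add: quad_disc_qform trace2_def det2_def mult.commute[of mu lam])
  also have "poly_abs \<dots> = poly_abs ([:0, lam * mu:]\<^sup>2)"
  proof (rule poly_abs_diff_eq)
    have "poly_abs (4 * - [:lam * mu:]) \<le> 1"
      using poly_abs_numeral_mult_le[of "num.Bit0 (num.Bit0 num.One)" "- [:lam * mu:]"] lam mu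
      by (simp add: poly_abs_const)
    also have "1 < q\<^sup>2" using q_gt_1 by (simp add: one_less_power)
    also have "q\<^sup>2 = poly_abs ([:0, lam * mu:]\<^sup>2)"
      using lam mu poly_abs_monomial[of "lam * mu"] by (simp only: power2_eq_square poly_abs_mult) simp
    finally show "poly_abs (4 * - [:lam * mu:]) < poly_abs ([:0, lam * mu:]\<^sup>2)" .
  qed
  also have "\<dots> = q\<^sup>2"
    using lam mu poly_abs_monomial[of "lam * mu"] by (simp only: power2_eq_square poly_abs_mult) simp
  finally show ?thesis .
qed

section \<open>The family that repeats a unit\<close>

lemma period_degrees:
  assumes "n \<ge> 2"
  shows "poly_abs (m11 (period n)) = q ^ n" "q * poly_abs (m12 (period n)) = q ^ n"
    "q * poly_abs (m21 (period n)) = q ^ n" "q\<^sup>2 * poly_abs (m22 (period n)) \<le> q ^ n"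
    "poly_abs (m11 (period n) - T * m21 (period n)) < q * poly_abs (m21 (period n))"
proof -
  have all: "poly_abs x = real CARD('a)" if "x \<in> set (T # alt_word l)" for x l
    using that set_alt_word[of x l] poly_abs_monomial[of 1] by (auto simp: q_card)
  have "length (T # alt_word (n - 1)) = n" using assms by simp
  then show "poly_abs (m11 (period n)) = q ^ n" "q * poly_abs (m12 (period n)) = q ^ n"
    and 3: "q * poly_abs (m21 (period n)) = q ^ n" and "q\<^sup>2 * poly_abs (m22 (period n)) \<le> q ^ n"
    using word_mat_degrees[of "T # alt_word (n - 1)"] all unfolding period_def q_card by (simp_all)
  have "alt_word (n - 1) \<noteq> []" using assms by (simp flip: length_greater_0_conv)
  then have "q * poly_abs (m21 (S (n - 1))) = q ^ (n - 1)" "poly_abs (m11 (S (n - 1))) = q ^ (n - 1)"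
    using word_mat_degrees[of "alt_word (n - 1)"] set_alt_word by (auto simp: q_card)
  then have eq: "poly_abs (m21 (S (n - 1))) * q = poly_abs (m11 (S (n - 1)))" and "poly_abs (m11 (S (n - 1))) > 0"
    using q_gt_1 by (auto simp: mult.commute)
  then have "1 * poly_abs (m11 (S (n - 1))) < q * poly_abs (m11 (S (n - 1)))"
    using q_gt_1 by (intro mult_strict_right_mono) auto
  moreover have "poly_abs (m21 (S (n - 1))) * 1 \<le> poly_abs (m21 (S (n - 1))) * q"
    using q_gt_1 by (intro mult_left_mono) auto
  ultimately have "poly_abs (m21 (S (n - 1))) < q * poly_abs (m11 (S (n - 1)))"
    using eq by linarith
  then show "poly_abs (m11 (period n) - T * m21 (period n)) < q * poly_abs (m21 (period n))"
    by (simp add: period_def word_mat_Cons)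
qed

text \<open>The index is shifted: group \<open>Suc j\<close> is repeated, so that group
  \<open>j\<close> precedes it and \<open>period_quad_lead\<close> can look back into its last
  unit.\<close>

definition period_quad :: "nat \<Rightarrow> 'a poly mat2" where
  "period_quad j = conv (E (Suc j)) * period (r ^ Suc (Suc j)) * minv (conv (E (Suc j)))"

lemma r_pow_ge_2: "r ^ Suc j \<ge> 2"
proof -
  have "r \<le> r * r ^ j" using r by simp
  from le_trans[OF r this] show ?thesis by (simp only: power_Suc)
qed

lemma period_quad_disc: "poly_abs (quad_disc (qform (period_quad j))) = q ^ (2 * r ^ Suc (Suc j))"
proof -
  define n where "n = r ^ Suc (Suc j)"
  have n2: "n \<ge> 2" unfolding n_def by (rule r_pow_ge_2)
  note d = period_degrees[OF n2]
  have qn: "q ^ n > 0" using q_gt_1 by simp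
  have q2: "q\<^sup>2 > 1" using q_gt_1 by (simp add: one_less_power)
  have "poly_abs (m22 (period n)) < q ^ n"
  proof (cases "m22 (period n) = 0")
    case False
    then have "poly_abs (m22 (period n)) > 0" using poly_abs_ge_1[of "m22 (period n)"] by simp
    then have "1 * poly_abs (m22 (period n)) < q\<^sup>2 * poly_abs (m22 (period n))"
      using q2 by (intro mult_strict_right_mono)
    then show ?thesis using d(4) by simp
  qed (use qn in simp)
  then have tr: "poly_abs (trace2 (period n)) = q ^ n"
    using d(1) by (simp add: trace2_def poly_abs_add_eq)
  have "(poly_abs (det2 (period n)))\<^sup>2 = 1"
    using arg_cong[OF det2_word_mat, of poly_abs "T # alt_word (n - 1)"]
    by (simp add: period_def power2_eq_square poly_abs_mult)
  then have dd: "poly_abs (det2 (period n)) = 1"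
    by (simp add: power2_eq_1_iff) (use poly_abs_nonneg[of "det2 (period n)"] in linarith)
  have "quad_disc (qform (period_quad j)) = quad_disc (qform (period n))"
    unfolding period_quad_def n_def by (rule quad_disc_conj[OF det2_conv])
  also have "\<dots> = (trace2 (period n))\<^sup>2 - 4 * det2 (period n)" by (rule quad_disc_qform)
  also have "poly_abs \<dots> = poly_abs ((trace2 (period n))\<^sup>2)"
  proof (rule poly_abs_diff_eq)
    have "poly_abs (4 * det2 (period n)) \<le> 1"
      using poly_abs_numeral_mult_le[of "num.Bit0 (num.Bit0 num.One)" "det2 (period n)"] dd by simp
    also have "1 < (q ^ n)\<^sup>2" using q_gt_1 n2 by (simp add: one_less_power)
    finally show "poly_abs (4 * det2 (period n)) < poly_abs ((trace2 (period n))\<^sup>2)"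
      by (simp add: power2_eq_square poly_abs_mult tr)
  qed
  also have "\<dots> = q ^ (2 * n)" by (simp add: power2_eq_square poly_abs_mult tr mult_2 power_add)
  finally show ?thesis by (simp add: n_def)
qed

text \<open>The agreement extends beyond the end of the group, since the longer unit of the next
  group begins with the same \<open>n j\<close> letters. It stops where the longer unit goes on with
  \<open>lam T\<close> while the repetition returns to \<open>T\<close>.\<close>

lemma period_quad_value:
  defines "n j \<equiv> r ^ Suc (Suc j)"
  shows "fls_abs (eval_fls (qform (period_quad j)) \<xi>) = q ^ Suc (n j) / q ^ (2 * (E (Suc (Suc j)) + n j))"
proof -
  let ?Y = "period (n j)" and ?N = "E (Suc (Suc j)) + n j"
  have n2: "n j \<ge> 2" unfolding n_def by (rule r_pow_ge_2)
  have lt: "n j < r ^ Suc (Suc (Suc j))"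
    unfolding n_def using r by (intro power_strict_increasing) auto
  note d = period_degrees[OF n2]
  have "conv (E (Suc (Suc j))) = conv (E (Suc j) + Suc k * r ^ Suc (Suc j))"
    by (simp add: E_Suc[of "Suc j"])
  also have "\<dots> = conv (E (Suc j)) * ?Y ^ Suc k" unfolding n_def by (rule conv_periods) simp
  finally have "conv ?N = conv (E (Suc j)) * ?Y ^ Suc k * ?Y"
    using conv_period[of 0 "n j" "Suc (Suc j)"] n2 lt by simp
  then have c: "conv ?N = conv (E (Suc j)) * ?Y ^ (k + 2)"
    by (simp add: mult.assoc power_commutes)
  have "period_quad j * conv ?N = conv (E (Suc j)) * ?Y * (minv (conv (E (Suc j))) * conv (E (Suc j))) * ?Y ^ (k + 2)"
    unfolding period_quad_def c by (simp only: n_def mult.assoc)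
  also have "\<dots> = conv (E (Suc j)) * (?Y * ?Y ^ (k + 2))"
    by (simp only: minv_left[OF det2_conv] mult.assoc mult_1_right mult_1_left)
  also have "\<dots> = conv ?N * ?Y" by (simp only: c mult.assoc power_commutes)
  finally have comm: "period_quad j * conv ?N = conv ?N * ?Y" .
  have "a (E (Suc (Suc j)) + 0 * r ^ Suc (Suc (Suc j)) + n j) = U (n j)"
    using lt by (intro block) auto
  \<comment> \<open>Here the parity of \<open>n j\<close> selects \<open>lam\<close>, unless both
    letters coincide anyway.\<close>
  also have "U (n j) = [:0, lam:]" using n2 odd_r_pow[of "Suc (Suc j)"] by (auto simp: U_def n_def)
  finally have cq_l: "fls_abs (cq ?N - poly_to_fls [:0, lam:]) = 1 / q"
    using cq_diff[of ?N] by simp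
  have m21_0: "m21 ?Y \<noteq> 0" using d(3) q_gt_1 by auto
  then have m21_pos: "poly_abs (m21 ?Y) > 0" using poly_abs_ge_1[of "m21 ?Y"] by simp
  have "fls_abs (fls.ev (qform ?Y) (cq ?N)) = (real CARD('a))\<^sup>2 * poly_abs (m21 ?Y)"
  proof (rule qform_value_abs[where \<rho> = T])
    show "fls_abs (cq ?N) = real CARD('a)"
      using fls_abs_cq[of ?N] n2 by (simp add: q_card)
    have "poly_abs [:0, lam - 1:] = q" using lam by (intro poly_abs_monomial) simp
    then have "fls_abs (poly_to_fls [:0, lam:] - poly_to_fls T) = q"
      by (simp add: fls_abs_poly flip: fls.\<iota>_diff)
    moreover have "1 / q < q" using q_gt_1 by (simp add: divide_less_eq less_1_mult)
    ultimately have "fls_abs ((cq ?N - poly_to_fls [:0, lam:]) + (poly_to_fls [:0, lam:] - poly_to_fls T)) = q"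
      by (subst fls.add_eq') (simp_all add: cq_l)
    then show "fls_abs (cq ?N - poly_to_fls T) = real CARD('a)" by (simp add: q_card)
    show "m21 ?Y \<noteq> 0" by (rule m21_0)
    show "poly_abs (m11 ?Y - T * m21 ?Y) < real CARD('a) * poly_abs (m21 ?Y)"
      using d(5) by (simp add: q_card)
    have "q * (q * poly_abs (m22 ?Y)) \<le> q * poly_abs (m21 ?Y)"
      using d(3,4) by (simp add: power2_eq_square mult.assoc)
    then have "q * poly_abs (m22 ?Y) \<le> poly_abs (m21 ?Y)" using q_gt_1 by simp
    also have "\<dots> < (q * q) * poly_abs (m21 ?Y)" using m21_pos q_gt_1 by (simp add: less_1_mult)
    finally have "poly_abs (m22 ?Y) < q * poly_abs (m21 ?Y)" using q_gt_1 by (simp add: mult.assoc)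
    then show "poly_abs (m22 ?Y) < real CARD('a) * poly_abs (m21 ?Y)" by (simp add: q_card)
    have "q * poly_abs (m12 ?Y) = q * poly_abs (m21 ?Y)" using d by simp
    then have "poly_abs (m12 ?Y) = poly_abs (m21 ?Y)" using q_gt_1 by simp
    moreover have "1 * poly_abs (m21 ?Y) < q\<^sup>2 * poly_abs (m21 ?Y)"
      using m21_pos q_gt_1 by (intro mult_strict_right_mono) (auto simp: one_less_power)
    ultimately show "poly_abs (m12 ?Y) < (real CARD('a))\<^sup>2 * poly_abs (m21 ?Y)" by (simp add: q_card)
  qed
  also have "\<dots> = q * (q * poly_abs (m21 ?Y))" by (simp add: q_card power2_eq_square mult.assoc)
  also have "\<dots> = q ^ Suc (n j)" by (simp add: d(3))
  finally show ?thesis using qform_value[OF comm] by simp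
qed

text \<open>Replacing the initial \<open>T\<close> by \<open>mu T\<close> turns the unit into a
  palindrome with a symmetric matrix, and changes only the top row by the multiple \<open>e\<close>
  of \<open>T\<close>. A common divisor then divides \<open>m21 X = m12 X\<close> and
  \<open>e * m22 X\<close>, hence \<open>e\<close> times a determinant of square 1.\<close>

lemma period_content:
  assumes n: "odd n \<or> lam = mu" "n \<ge> 2" and g: "\<And>i. g dvd coeff (qform (period n)) i"
  shows "g dvd T"
proof -
  define xs where "xs = [:0, mu:] # alt_word (n - 1)"
  have nth: "xs ! i = (if even i then [:0, mu:] else [:0, lam:])" if "i < n" for i
    using that by (cases i) (auto simp: xs_def alt_word_def U_def)
  have len: "length xs = n" using n by (simp add: xs_def)
  have "rev xs = xs"
  proof (rule nth_equalityI)
    fix i assume "i < length (rev xs)"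
    then have i: "i < n" by (simp add: len)
    have "even (n - Suc i) = even i \<or> lam = mu" using n i by auto
    then show "rev xs ! i = xs ! i" using i by (auto simp: rev_nth len nth)
  qed simp
  then have sym: "m12 (word_mat xs) = m21 (word_mat xs)" by (rule word_mat_palindrome)
  have det: "(det2 (word_mat xs))\<^sup>2 = 1" by (rule det2_word_mat)
  define X where "X = word_mat xs"
  define e where "e = [:0, 1 - mu:]"
  have "step (x + y) = Mat2 1 x 0 1 * step y" for x y :: "'a poly"
    by (rule mat2_eqI) simp_all
  from this[of e "[:0, mu:]"] have "step T = Mat2 1 e 0 1 * step [:0, mu:]" by (simp add: e_def)
  then have "period n = Mat2 1 e 0 1 * X"
    by (simp add: period_def X_def xs_def word_mat_Cons mult.assoc)
  then have Y: "m12 (period n) = m12 X + e * m22 X" "m21 (period n) = m21 X"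
    by simp_all
  have "g dvd m21 X" using g[of 2] by (simp add: coeff_qform Y)
  moreover have "g dvd - (m12 X + e * m22 X)" using g[of 0] unfolding coeff_qform Y .
  then have "g dvd m12 X + e * m22 X" by (simp only: dvd_minus_iff)
  moreover have sX: "m12 X = m21 X" using sym by (simp add: X_def)
  ultimately have 1: "g dvd m21 X" and 2: "g dvd e * m22 X" by (auto simp: dvd_add_right_iff)
  have "e * det2 X = m11 X * (e * m22 X) - e * m21 X * m21 X" by (simp add: det2_def sX algebra_simps)
  moreover have "g dvd m11 X * (e * m22 X) - e * m21 X * m21 X" by (intro dvd_diff dvd_mult[OF 2] dvd_mult[OF 1])
  ultimately have "g dvd e * det2 X * det2 X" by simp
  then have "g dvd e" using det by (simp add: X_def power2_eq_square mult.assoc)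
  moreover have "e dvd T" unfolding e_def
    using mu by (intro dvdI[of _ _ "[:inverse (1 - mu):]"]) simp
  ultimately show ?thesis by (rule dvd_trans)
qed

lemma period_quad_content:
  assumes "\<And>i. g dvd coeff (qform (period_quad j)) i"
  shows "g dvd T"
proof (rule period_content)
  show "odd (r ^ Suc (Suc j)) \<or> lam = mu" by (rule odd_r_pow)
  show "2 \<le> r ^ Suc (Suc j)" by (rule r_pow_ge_2)
  show "g dvd coeff (qform (period (r ^ Suc (Suc j)))) i" for i
    using assms unfolding period_quad_def by (rule dvd_qform_conj[OF det2_conv])
qed

text \<open>Rotating the period past its last alternating stretch moves the base point back to just
  after the letter T that starts the last copy of the previous block. There no cancellation
  occurs, which shows that the leading coefficient is smaller than the generic size.\<close>

lemma period_quad_lead: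
  "poly_abs (m21 (period_quad j)) = q ^ (2 * (E j + k * r ^ Suc j) + r ^ Suc (Suc j) - 1)"
proof -
  define n0 where "n0 = r ^ Suc j"
  define n where "n = r ^ Suc (Suc j)"
  define s where "s = E j + k * n0"
  have n0: "n0 \<ge> 2" unfolding n0_def by (rule r_pow_ge_2)
  have nn0: "n0 < n" unfolding n_def n0_def using r by (intro power_strict_increasing) auto
  have even_diff: "even (n - n0) \<or> lam = mu"
    using odd_r_pow[of "Suc j"] odd_r_pow[of "Suc (Suc j)"] nn0 by (auto simp: n_def n0_def)
  let ?V = "S (n0 - 1)" and ?X = "conv (Suc s)"
  define ys where "ys = alt_word (n0 - 1) @ T # alt_word (n - n0 - 1)"
  define Z where "Z = word_mat ys"
  define Y where "Y = Z * step [:0, mu:]"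
  have E: "E (Suc j) = s + Suc (n0 - 1)" using n0 by (simp add: s_def E_Suc n0_def)
  have cE: "conv (E (Suc j)) = ?X * ?V"
    unfolding E using conv_copy[of k "n0 - 1" j] n0 by (simp add: s_def n0_def)
  \<comment> \<open>As \<open>n - n0\<close> is even or both letters agree, the longer alternating
    word ends with the shorter one in the same phase; this common ending is the source of the
    cancellation.\<close>
  have split: "alt_word (n - 1) = alt_word (n - n0) @ alt_word (n0 - 1)"
  proof (rule nth_equalityI)
    fix i assume "i < length (alt_word (n - 1))"
    then have i: "i < n - 1" by simp
    show "alt_word (n - 1) ! i = (alt_word (n - n0) @ alt_word (n0 - 1)) ! i"
      using i nn0 n0 even_diff by (auto simp: nth_append alt_word_def U_def)
  qed (use nn0 n0 in simp)
  have last: "alt_word (n - n0) = alt_word (n - n0 - 1) @ [[:0, mu:]]"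
  proof -
    have "U (n - n0) = [:0, mu:]" using even_diff nn0 by (auto simp: U_def)
    moreover have "Suc (n - n0 - 1) = n - n0" using nn0 by simp
    ultimately show ?thesis using alt_word_Suc[of "n - n0 - 1"] by (simp only:)
  qed
  \<comment> \<open>The common ending \<open>?V\<close> moves from the end of the period to its
    front; the rotated period ends in \<open>mu T\<close>, while \<open>?X\<close> ends in
    \<open>T\<close>.\<close>
  have rot: "?V * period n = Y * ?V"
    unfolding period_def split Y_def Z_def ys_def
    by (simp add: last word_mat_append word_mat_Cons mult.assoc)
  have "period_quad j = ?X * (?V * period n) * (minv ?V * minv ?X)"
    by (simp add: period_quad_def cE minv_mult mult.assoc n_def)
  also have "\<dots> = ?X * Y * (?V * minv ?V) * minv ?X" unfolding rot by (simp only: mult.assoc)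
  also have "\<dots> = ?X * Y * minv ?X" by (simp add: minv_right[OF det2_word_mat])
  finally have pq: "period_quad j = ?X * Y * minv ?X" .
  have ne: "ys \<noteq> []" by (simp add: ys_def)
  have letters: "poly_abs x = real CARD('a)" if "x \<in> set ys" for x
    using that set_alt_word[of x] poly_abs_monomial[of 1] by (auto simp: ys_def q_card)
  have lys: "length ys = n - 1" using nn0 n0 by (simp add: ys_def)
  have Z: "poly_abs (m11 Z) = q ^ (n - 1)" "q * poly_abs (m12 Z) = q ^ (n - 1)"
    "q * poly_abs (m21 Z) = q ^ (n - 1)" "q\<^sup>2 * poly_abs (m22 Z) \<le> q ^ (n - 1)"
    using word_mat_degrees[OF ne letters] unfolding lys Z_def[symmetric] q_card[symmetric] by blast+
  have m11pos: "poly_abs (m11 Z) > 0" using Z(1) q_gt_1 by simp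
  have small: "y < q * poly_abs (m11 Z)" if "q * y = q ^ (n - 1)" for y
  proof -
    have "q * y < q * (q * poly_abs (m11 Z))"
      using that m11pos q_gt_1 Z(1) by (simp add: less_1_mult flip: mult.assoc)
    then show ?thesis using q_gt_1 by simp
  qed
  have Ysel: "m12 Y = m11 Z" "m22 Y = m21 Z" "m11 Y = [:0, mu:] * m11 Z + m12 Z"
    "m21 Y = [:0, mu:] * m21 Z + m22 Z" by (simp_all add: Y_def mult.commute)
  note b = conv_Suc_bottom[OF order_refl, of j, folded n0_def, folded s_def]
  have "poly_abs (m21 (period_quad j)) = (real CARD('a))\<^sup>2 * poly_abs (m12 Y) * (poly_abs (m22 ?X))\<^sup>2"
    unfolding pq
  proof (rule qform_lead_abs[where \<sigma> = T and \<rho> = "[:0, mu:]"])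
    show "(det2 ?X)\<^sup>2 = 1" by (rule det2_conv)
    show "poly_abs T = real CARD('a)" using poly_abs_monomial[of 1] by (simp add: q_card)
    have "poly_abs [:0, mu - 1:] = q" using mu by (intro poly_abs_monomial) simp
    then show "poly_abs ([:0, mu:] - T) = real CARD('a)" by (simp add: q_card)
    show "m22 ?X \<noteq> 0" by (rule b(5))
    show "poly_abs (m21 ?X - T * m22 ?X) < real CARD('a) * poly_abs (m22 ?X)"
      using b(4) by (simp add: q_card)
    show "m12 Y \<noteq> 0" using m11pos by (auto simp: Ysel)
    show "poly_abs (m11 Y - [:0, mu:] * m12 Y) < real CARD('a) * poly_abs (m12 Y)"
      using small[OF Z(2)] by (simp add: Ysel q_card)
    show "poly_abs (m22 Y) < real CARD('a) * poly_abs (m12 Y)"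
      using small[OF Z(3)] by (simp add: Ysel q_card)
    have "poly_abs ([:0, mu:] * m21 Z) = q ^ (n - 1)"
      using Z(3) poly_abs_monomial[OF mu(1)] by (simp only: poly_abs_mult)
    moreover have "poly_abs (m22 Z) \<le> q ^ (n - 1)"
    proof -
      have "1 * poly_abs (m22 Z) \<le> q\<^sup>2 * poly_abs (m22 Z)"
        using q_gt_1 by (intro mult_right_mono) (auto simp: one_le_power)
      then show ?thesis using Z(4) by simp
    qed
    ultimately have "poly_abs (m21 Y) \<le> 1 * poly_abs (m11 Z)"
      using poly_abs_ultra[of "[:0, mu:] * m21 Z" "m22 Z"] by (simp only: Ysel Z(1))
    also have "\<dots> < q\<^sup>2 * poly_abs (m11 Z)"
      using m11pos q_gt_1 by (intro mult_strict_right_mono) (auto simp: one_less_power)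
    finally show "poly_abs (m21 Y) < (real CARD('a))\<^sup>2 * poly_abs (m12 Y)" by (simp add: Ysel q_card)
  qed
  also have "\<dots> = q ^ (n - 1) * (q * poly_abs (m22 ?X))\<^sup>2"
    by (simp add: Ysel Z(1) q_card power_mult_distrib)
  also have "\<dots> = q ^ (n - 1) * q ^ (2 * s)" by (simp only: b(3) power_mult mult.commute[of 2] power_mult)
  also have "\<dots> = q ^ (2 * s + n - 1)" using n0 nn0 by (simp add: add.commute flip: power_add)
  finally show ?thesis by (simp add: s_def n_def n0_def)
qed

end

context theta_cf
begin

section \<open>Growth rates of the two families\<close>

definition per :: real where "per = (real k + 1) / (real r - 1)"

text \<open>The geometric sum for \<open>E_Suc\<close>; \<open>per\<close> is the coefficient of its
  growing part.\<close>

lemma E_closed: "real (E j) = per * real r ^ Suc j + (1 + k - per * real r)"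
proof (induction j)
  case (Suc j)
  have k: "real (k + 1) = per * (real r - 1)" using r by (simp add: per_def)
  have "real (k + 1) * real r ^ Suc j = per * real r ^ Suc (Suc j) - per * real r ^ Suc j"
    unfolding k by (simp add: algebra_simps)
  moreover have "real (E (Suc j)) = real (E j) + real (k + 1) * real r ^ Suc j"
    by (simp add: E_Suc algebra_simps)
  ultimately show ?case using Suc by linarith
qed (simp add: E_0)

lemma degree_qform: "m21 Y \<noteq> 0 \<Longrightarrow> degree (qform Y) = 2"
  by (simp add: qform_def)

lemma poly_abs_nonzeroI: "poly_abs c = q ^ n \<Longrightarrow> c \<noteq> 0"
  using q_gt_1 by auto

lemma q_powr: "q powr real n = q ^ n"
  using q_gt_1 by (simp add: powr_realpow)

lemma q_powr_minus: "q powr (- real n) = 1 / q ^ n"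
  by (simp add: powr_minus q_powr inverse_eq_divide)

context
  fixes emb :: "'a fls \<Rightarrow> 'k::field" and av
  assumes ext: "ext_setting emb av"
begin

text \<open>Since \<open>E j\<close> grows like \<open>per * r * r ^ j\<close>, the rates follow
  from \<open>const_quad_lead\<close> and \<open>const_quad_value\<close>; the discriminant has
  constant size, so its rate is 0.\<close>

lemma const_quad_approx:
  "raw_quad_approx emb av \<xi> (\<lambda>j. qform (const_quad j))
     (\<lambda>j. real (2 * E j)) (\<lambda>j. real (2 * (E j + r ^ Suc j)) - 2) (\<lambda>_. 1)
     (2 * per * real r) (2 * per * r + 2 * real r) 0 (\<bar>2 * (1 + k - per * real r)\<bar> + 2) r"
proof
  show "ext_setting emb av" by (rule ext)
  show "fls_abs \<xi> \<le> 1" by (rule fls_abs_xi)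
  show "1 / (CARD('a) * poly_abs u) \<le> fls_abs (poly_to_fls u * \<xi> + poly_to_fls v)" if "u \<noteq> 0" for u v
    using badly_approximable[OF that] by (simp add: q_card)
  fix j
  show "degree (qform (const_quad j)) = 2"
    by (intro degree_qform poly_abs_nonzeroI[OF const_quad_lead])
  show "c dvd [:0, 1:]" if "\<And>i. c dvd coeff (qform (const_quad j)) i" for c
    using that by (rule const_quad_content)
  show "poly_abs (coeff (qform (const_quad j)) 2) = CARD('a) powr real (2 * E j)"
    unfolding coeff_qform const_quad_lead q_card[symmetric] q_powr ..
  have "q powr (- (real (2 * (E j + r ^ Suc j)) - 2)) = q powr 2 * q powr (- real (2 * (E j + r ^ Suc j)))"
    by (simp only: powr_add[symmetric]) (simp add: algebra_simps)
  also have "\<dots> = q\<^sup>2 / q ^ (2 * (E j + r ^ Suc j))"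
    unfolding q_powr_minus using q_gt_1 by simp
  finally show "fls_abs (eval_fls (qform (const_quad j)) \<xi>) = CARD('a) powr (- (real (2 * (E j + r ^ Suc j)) - 2))"
    unfolding const_quad_value by (simp flip: q_card)
  show "poly_abs (quad_disc (qform (const_quad j))) = CARD('a) powr (2 * 1)"
    using q_gt_1 by (simp add: const_quad_disc flip: q_card)
  show "1 \<le> real (2 * E j)" using E_pos[of j] by simp
  have "- (real (2 * (x + y)) - 2) \<le> real (2 * x)" if "1 \<le> x" for x y :: nat
    using that by simp
  then show "- (real (2 * (E j + r ^ Suc j)) - 2) \<le> real (2 * E j)" using E_pos by blast
  show "\<bar>real (2 * E j) - 2 * per * r * real r ^ j\<bar> \<le> (\<bar>2 * (1 + k - per * real r)\<bar> + 2)"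
    unfolding of_nat_mult E_closed by (simp add: algebra_simps)
  show "\<bar>real (2 * (E j + r ^ Suc j)) - 2 - (2 * per * r + 2 * real r) * real r ^ j\<bar> \<le> (\<bar>2 * (1 + k - per * real r)\<bar> + 2)"
  proof -
    have "real (2 * (E j + r ^ Suc j)) - 2 - (2 * per * r + 2 * real r) * real r ^ j = 2 * (1 + k - per * real r) - 2"
      unfolding of_nat_mult of_nat_add E_closed by (simp add: algebra_simps)
    then show ?thesis by linarith
  qed
  show "\<bar>1 - 0 * real r ^ j\<bar> \<le> (\<bar>2 * (1 + k - per * real r)\<bar> + 2)" by simp
qed (use r in \<open>auto simp: per_def\<close>)


text \<open>In the rate of the leading coefficient, \<open>k = per * (r - 1) - 1\<close> is inserted
  into \<open>2 * (per * r + k * r) + r\<^sup>2\<close>; the \<open>- 1\<close> is what leaves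
  \<open>- 2 * r\<close>.\<close>

lemma period_quad_approx:
  "raw_quad_approx emb av \<xi> (\<lambda>j. qform (period_quad j))
     (\<lambda>j. real (2 * (E j + k * r ^ Suc j) + r ^ Suc (Suc j)) - 1)
     (\<lambda>j. real (2 * E (Suc (Suc j)) + r ^ Suc (Suc j)) - 1) (\<lambda>j. real (r ^ Suc (Suc j)))
     (2 * per * (real r)\<^sup>2 + (real r)\<^sup>2 - 2 * real r) (2 * per * real r ^ 3 + (real r)\<^sup>2) ((real r)\<^sup>2) (\<bar>2 * (1 + k - per * real r)\<bar> + 1) r"
proof
  show "ext_setting emb av" by (rule ext)
  show "fls_abs \<xi> \<le> 1" by (rule fls_abs_xi)
  show "1 / (CARD('a) * poly_abs u) \<le> fls_abs (poly_to_fls u * \<xi> + poly_to_fls v)" if "u \<noteq> 0" for u v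
    using badly_approximable[OF that] by (simp add: q_card)
  have per: "per * (real r - 1) = real k + 1" using r by (simp add: per_def)
  have r2: "real r \<ge> 2" using r by simp
  fix j
  let ?n = "r ^ Suc (Suc j)" and ?s = "E j + k * r ^ Suc j"
  have n: "?n \<ge> 2" by (rule r_pow_ge_2)
  show "degree (qform (period_quad j)) = 2"
    by (intro degree_qform poly_abs_nonzeroI[OF period_quad_lead])
  show "c dvd [:0, 1:]" if "\<And>i. c dvd coeff (qform (period_quad j)) i" for c
    using that by (rule period_quad_content)
  have "real (2 * ?s + ?n) - 1 = real (2 * ?s + ?n - 1)" using n by simp
  then show "poly_abs (coeff (qform (period_quad j)) 2) = CARD('a) powr (real (2 * ?s + ?n) - 1)"
    unfolding coeff_qform period_quad_lead q_card[symmetric] by (simp only: q_powr)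
  have "q powr (- (real (2 * E (Suc (Suc j)) + ?n) - 1)) =
      q powr real (Suc ?n) * q powr (- real (2 * (E (Suc (Suc j)) + ?n)))"
    by (simp only: powr_add[symmetric]) (simp add: algebra_simps)
  also have "\<dots> = q ^ Suc ?n / q ^ (2 * (E (Suc (Suc j)) + ?n))"
    unfolding q_powr_minus q_powr by simp
  finally show "fls_abs (eval_fls (qform (period_quad j)) \<xi>) = CARD('a) powr (- (real (2 * E (Suc (Suc j)) + ?n) - 1))"
    unfolding period_quad_value by (simp only: q_card[symmetric])
  have "q powr (2 * real ?n) = q ^ (2 * ?n)" using q_powr[of "2 * ?n"] by (simp only: of_nat_mult of_nat_numeral)
  then show "poly_abs (quad_disc (qform (period_quad j))) = CARD('a) powr (2 * real ?n)"
    unfolding period_quad_disc by (simp only: q_card[symmetric])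
  have s: "1 \<le> ?s" using E_pos[of j] by simp
  have "real y \<le> real (2 * x + y) - 1 \<and> - (real (2 * z + y) - 1) \<le> real (2 * x + y) - 1"
    if "1 \<le> x" for x y z :: nat
    using that by simp
  from this[OF s] show "real ?n \<le> real (2 * ?s + ?n) - 1"
    "- (real (2 * E (Suc (Suc j)) + ?n) - 1) \<le> real (2 * ?s + ?n) - 1" by blast+
  have k: "real k = per * (real r - 1) - 1" using per by simp
  have "real (2 * ?s + ?n) - 1 - (2 * per * (real r)\<^sup>2 + (real r)\<^sup>2 - 2 * real r) * real r ^ j = 2 * (1 + k - per * real r) - 1"
    unfolding of_nat_add of_nat_mult E_closed by (simp add: k power2_eq_square algebra_simps)
  then show "\<bar>real (2 * ?s + ?n) - 1 - (2 * per * (real r)\<^sup>2 + (real r)\<^sup>2 - 2 * real r) * real r ^ j\<bar> \<le> \<bar>2 * (1 + k - per * real r)\<bar> + 1"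
    by linarith
  have "real (2 * E (Suc (Suc j)) + ?n) - 1 - (2 * per * real r ^ 3 + (real r)\<^sup>2) * real r ^ j = 2 * (1 + k - per * real r) - 1"
    unfolding of_nat_add of_nat_mult E_closed by (simp add: power2_eq_square power3_eq_cube algebra_simps)
  then show "\<bar>real (2 * E (Suc (Suc j)) + ?n) - 1 - (2 * per * real r ^ 3 + (real r)\<^sup>2) * real r ^ j\<bar> \<le> \<bar>2 * (1 + k - per * real r)\<bar> + 1"
    by linarith
  show "\<bar>real ?n - (real r)\<^sup>2 * real r ^ j\<bar> \<le> \<bar>2 * (1 + k - per * real r)\<bar> + 1" by (simp add: power2_eq_square)
next
  have per: "per * (real r - 1) = real k + 1" using r by (simp add: per_def)
  have per0: "per > 0" using r by (simp add: per_def)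
  have r2: "real r \<ge> 2" using r by simp
  have "per * r \<ge> 1"
    using per per0 by (simp add: algebra_simps)
  then have "real r * (per * real r) \<ge> real r * 1" using r2 by (intro mult_left_mono) auto
  then have 1: "2 * per * (real r)\<^sup>2 \<ge> 2 * real r" by (simp add: power2_eq_square algebra_simps)
  show "0 < 2 * per * (real r)\<^sup>2 + (real r)\<^sup>2 - 2 * real r" using 1 r2 by (smt (verit) zero_less_power)
  show "(real r)\<^sup>2 \<le> 2 * per * (real r)\<^sup>2 + (real r)\<^sup>2 - 2 * real r" using 1 by simp
  have "per * (real r)\<^sup>2 \<le> per * real r ^ 3"
    using per0 r2 by (intro mult_left_mono power_increasing) auto
  then show "2 * per * (real r)\<^sup>2 + (real r)\<^sup>2 - 2 * real r < 2 * per * real r ^ 3 + (real r)\<^sup>2"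
    using r2 by linarith
qed (use r in auto)

end

end

section \<open>The continued fraction of the theorem\<close>

lemma length_concat_replicate: "length (concat (replicate n xs)) = n * length xs"
  by (induction n) simp_all

lemma nth_concat_replicate:
  "i < n * length xs \<Longrightarrow> concat (replicate n xs) ! i = xs ! (i mod length xs)"
proof (induction n arbitrary: i)
  case (Suc n)
  show ?case
  proof (cases "i < length xs")
    case False
    then have "concat (replicate n xs) ! (i - length xs) = xs ! ((i - length xs) mod length xs)"
      using Suc.prems by (intro Suc.IH) auto
    then show ?thesis using False by (simp add: nth_append le_mod_geq)
  qed (simp add: nth_append)
qed simp

lemma word_ends_Suc: "word_ends W (Suc j) = word_ends W j + length (W j)"
  by (simp add: word_ends_def)

lemma word_ends_mono: "i \<le> j \<Longrightarrow> word_ends W i \<le> word_ends W j"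
  unfolding word_ends_def by (intro sum_mono2) auto

lemma inf_concat_nth:
  assumes "i < length (W j)"
  shows "inf_concat W (word_ends W j + i) = W j ! i"
proof -
  have "(LEAST l. word_ends W j + i < word_ends W (Suc l)) = j"
  proof (rule Least_equality)
    show "word_ends W j + i < word_ends W (Suc j)" using assms by (simp add: word_ends_Suc)
    fix l assume l: "word_ends W j + i < word_ends W (Suc l)"
    show "j \<le> l"
    proof (rule ccontr)
      assume "\<not> j \<le> l"
      then have "word_ends W (Suc l) \<le> word_ends W j" by (intro word_ends_mono) simp
      then show False using l by simp
    qed
  qed
  then show ?thesis by (simp add: inf_concat_def)
qed

lemma inf_concat_decompose:
  assumes "\<And>j. W j \<noteq> []"
  obtains j i where "i < length (W j)" "m = word_ends W j + i"
proof -
  have "n \<le> word_ends W n" for n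
  proof (induction n)
    case (Suc n)
    then show ?case using assms[of n] by (cases "W n") (auto simp: word_ends_Suc)
  qed simp
  then have ex: "\<exists>j. m < word_ends W (Suc j)" by (meson Suc_le_eq)
  define j where "j = (LEAST j. m < word_ends W (Suc j))"
  have less: "m < word_ends W (Suc j)" unfolding j_def using ex by (rule LeastI_ex)
  have "word_ends W j \<le> m"
  proof (cases j)
    case (Suc l)
    then have "\<not> m < word_ends W (Suc l)" unfolding j_def by (metis lessI not_less_Least)
    then show ?thesis using Suc by simp
  qed (simp add: word_ends_def)
  then show ?thesis using that[of "m - word_ends W j" j] less by (simp add: word_ends_Suc)
qed

text \<open>One formula for both cases of \<open>theta_unit\<close>: if
  \<open>2 - lam = lam\<close>, letters at odd positions and at positive even ones agree.\<close>

definition theta_letter :: "'a::field \<Rightarrow> nat \<Rightarrow> 'a poly" where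
  "theta_letter lam i = (if i = 0 then [:0, 1:] else if odd i then [:0, lam:] else [:0, 2 - lam:])"

lemma theta_unit_letters:
  assumes "p \<noteq> 2 \<Longrightarrow> odd r" "p = 2 \<Longrightarrow> 2 - lam = lam" "r > 0"
  shows "length (theta_unit p r lam i) = r ^ i"
    and "l < r ^ i \<Longrightarrow> theta_unit p r lam i ! l = theta_letter lam l"
proof -
  have r: "r ^ i > 0" using assms(3) by simp
  have odd: "odd (r ^ i)" if "p \<noteq> 2" using assms(1) that by simp
  have half: "(r ^ i - 1) div 2 * 2 = r ^ i - 1" if "p \<noteq> 2" using odd[OF that] r by auto
  show "length (theta_unit p r lam i) = r ^ i"
  proof (cases "p = 2")
    case False
    then have "length (theta_unit p r lam i) = Suc ((r ^ i - 1) div 2 * 2)"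
      by (simp add: theta_unit_def length_concat_replicate)
    then show ?thesis using half[OF False] r by linarith
  qed (use r in \<open>simp add: theta_unit_def\<close>)
  show "theta_unit p r lam i ! l = theta_letter lam l" if l: "l < r ^ i"
  proof (cases l)
    case 0
    then show ?thesis by (simp add: theta_unit_def theta_letter_def)
  next
    case (Suc l')
    show ?thesis
    proof (cases "p = 2")
      case True
      then show ?thesis using Suc l assms(2) by (auto simp: theta_unit_def theta_letter_def)
    next
      case False
      have "l' < (r ^ i - 1) div 2 * length [[:0, lam:], [:0, 2 - lam:]]"
        using half[OF False] l Suc by simp
      then have "theta_unit p r lam i ! l = [[:0, lam:], [:0, 2 - lam:]] ! (l' mod 2)"
        using False Suc by (simp add: theta_unit_def nth_concat_replicate numeral_2_eq_2)
      then show ?thesis using Suc by (auto simp: theta_letter_def mod2_eq_if)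
    qed
  qed
qed

lemma theta_cf_theta_pq:
  fixes lam :: "'a::{finite,field}"
  assumes odd: "p \<noteq> 2 \<Longrightarrow> odd r" and two: "p = 2 \<Longrightarrow> 2 - lam = lam" and r: "r \<ge> 2"
    and lam: "lam \<noteq> 0" "lam \<noteq> 1" "2 - lam \<noteq> 0" and cf: "has_cf \<xi> (theta_pq p r k lam)"
  shows "theta_cf \<xi> (theta_pq p r k lam) (real CARD('a)) k r lam (2 - lam)
    (\<lambda>j. 1 + k + word_ends (\<lambda>j. concat (replicate (k + 1) (theta_unit p r lam (Suc j)))) j)
    (theta_letter lam)"
proof -
  define W where "W j = concat (replicate (k + 1) (theta_unit p r lam (Suc j)))" for j
  have W_eq: "W = (\<lambda>j. concat (replicate (k + 1) (theta_unit p r lam (Suc j))))"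
    by (rule ext) (simp only: W_def)
  define E where "E j = 1 + k + word_ends W j" for j
  have unit: "length (theta_unit p r lam i) = r ^ i"
    "l < r ^ i \<Longrightarrow> theta_unit p r lam i ! l = theta_letter lam l" for i l
    using theta_unit_letters[OF odd two, where ?i = i] r by auto
  have len: "length (W j) = (k + 1) * r ^ Suc j" for j
    by (simp only: W_def length_concat_replicate unit)
  have W_nth: "W j ! i = theta_letter lam (i mod r ^ Suc j)" if "i < (k + 1) * r ^ Suc j" for i j
  proof -
    have "W j ! i = theta_unit p r lam (Suc j) ! (i mod r ^ Suc j)"
      unfolding W_def using that by (subst nth_concat_replicate) (simp_all only: unit)
    also have "\<dots> = theta_letter lam (i mod r ^ Suc j)"
      using r by (intro unit mod_less_divisor) simp
    finally show ?thesis .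
  qed
  have tail: "theta_pq p r k lam (E j + i) = theta_letter lam (i mod r ^ Suc j)"
    if "i < (k + 1) * r ^ Suc j" for i j
  proof -
    have "theta_pq p r k lam (E j + i) = inf_concat W (word_ends W j + i)"
      unfolding theta_pq_def W_eq[symmetric] by (simp add: prepend_def E_def)
    also have "\<dots> = W j ! i" using that by (intro inf_concat_nth) (simp only: len)
    finally show ?thesis using W_nth[OF that] by simp
  qed
  have E_Suc: "E (Suc j) = E j + (k + 1) * r ^ Suc j" for j
    by (simp only: E_def word_ends_Suc len add.assoc)
  have letter: "poly_abs (theta_letter lam i) = CARD('a)" for i
    using lam by (simp add: theta_letter_def poly_abs_def)
  have abs: "poly_abs (theta_pq p r k lam i) = CARD('a)" if i: "i > 0" for i
  proof (cases "i < 1 + k")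
    case True
    then have "theta_pq p r k lam i = [:0, 1:]"
      using i by (simp add: theta_pq_def prepend_def nth_Cons split: nat.splits)
    then show ?thesis by (simp add: poly_abs_def)
  next
    case False
    have "W j \<noteq> []" for j using len[of j] r by auto
    then obtain j l where "l < length (W j)" "i - (1 + k) = word_ends W j + l"
      by (rule inf_concat_decompose)
    then have "theta_pq p r k lam (E j + l) = theta_letter lam (l mod r ^ Suc j)" "E j + l = i"
      using tail[of l j] False by (auto simp only: len E_def)
    then show ?thesis using letter by simp
  qed
  have "theta_cf \<xi> (theta_pq p r k lam) (real CARD('a)) k r lam (2 - lam) E (theta_letter lam)"
  proof
    show "theta_pq p r k lam 0 = 0" by (simp add: theta_pq_def prepend_def)
    show "E 0 = 1 + k" by (simp add: E_def word_ends_def)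
    show "theta_pq p r k lam (E j + m * r ^ Suc j + i) = theta_letter lam i"
      if "m \<le> k" "i < r ^ Suc j" for m i j
    proof -
      have "m * r ^ Suc j + i < (m + 1) * r ^ Suc j" using that(2) by simp
      also have "\<dots> \<le> (k + 1) * r ^ Suc j" using that(1) by (intro mult_right_mono) auto
      finally show ?thesis using tail[of "m * r ^ Suc j + i" j] that(2) by (simp add: add.assoc)
    qed
    show "2 - lam \<noteq> 1"
    proof
      assume "2 - lam = 1"
      then have "1 + 1 = 1 + lam" by (simp add: algebra_simps)
      then show False using lam by simp
    qed
  qed (use cf abs E_Suc lam odd two r in \<open>auto simp: theta_letter_def\<close>)
  then show ?thesis by (simp add: E_def[abs_def] W_def[abs_def])
qed

text \<open>Translation by 1 permutes the field, so comparing the sums of all elements gives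
  \<open>of_nat CARD('a) = 0\<close>, a power of 2 equal to 0.\<close>

lemma two_eq_0_if_card_even:
  assumes "CARD('a::{finite,field}) = 2 ^ s"
  shows "(2 :: 'a) = 0"
proof -
  have "(\<Sum>x\<in>UNIV. x + 1) = (\<Sum>x\<in>UNIV. x :: 'a)"
    by (rule sum.reindex_bij_witness[of _ "\<lambda>x. x - 1" "\<lambda>x. x + 1"]) auto
  then have "(of_nat CARD('a) :: 'a) = 0" by (simp add: sum.distrib)
  then show ?thesis using assms by simp
qed

theorem theorem3p1:
  fixes p s t k d :: nat and lam :: "'a::{finite,field}" and \<xi> :: "'a fls"
    and emb :: "'a fls \<Rightarrow> 'k::field" and av :: "'k \<Rightarrow> real"
  assumes "prime p" and "s \<ge> 1" and "t \<ge> 1" and "CARD('a) = p ^ s"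
    and "d \<ge> 2"
    and "lam \<noteq> 0" and "lam \<noteq> 1" and "p \<noteq> 2 \<Longrightarrow> lam \<noteq> 2"
    and "has_cf \<xi> (theta_pq p (CARD('a) ^ t) k lam)"
    and "ext_setting emb av"
  defines "r \<equiv> real (CARD('a) ^ t)"
  defines "A \<equiv> r * (r - 1) * (r - 4) / (2 * r * (real k + 1) + (r - 1) * (r - 2))"
  defines "B \<equiv> r * (r - 1) * (r - 3) / (2 * r * (real k + 1) + (r - 1) * (r - 2))"
  shows "w_star_exp emb av 2 \<xi> \<ge> ereal (max ((r - 1) / (real k + 1)) (r - 1 - A)) \<and>
         w_exp 2 \<xi> \<ge> ereal (max ((r - 1) / (real k + 1) + 1) (r - B)) \<and>
         (real k \<le> 2 * (r - 1) / (real d + sqrt ((real d)\<^sup>2 + 4 * (2 * r - 1) * real d + 4)) - 1 \<longrightarrow>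
         (\<forall>n. 2 \<le> n \<and> n \<le> d \<longrightarrow>
            w_star_exp emb av n \<xi> = ereal ((r - 1) / (real k + 1)) \<and>
            w_exp n \<xi> = ereal ((r - 1) / (real k + 1) + 1))) \<and>
         (2 * r * real d \<le> (r - 2 - A) * (r - real d - A) \<longrightarrow>
         (\<forall>n. 2 \<le> n \<and> n \<le> d \<longrightarrow>
            w_star_exp emb av n \<xi> = ereal (r - 1 - A) \<and>
            w_exp n \<xi> = ereal (r - B)))"
proof -
  define R where "R = CARD('a) ^ t"
  have rR: "r = real R" by (simp add: r_def R_def)
  have two: "2 - lam = lam" if "p = 2"
  proof -
    have "(2 :: 'a) = 0" using two_eq_0_if_card_even[where 'a = 'a, of s] assms(4) that by simp
    then have "lam + lam = 0" by (simp flip: mult_2)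
    then show ?thesis using \<open>(2 :: 'a) = 0\<close> by (simp add: eq_neg_iff_add_eq_0 flip: minus_equation_iff)
  qed
  have odd: "odd R" if "p \<noteq> 2"
    using assms(1) that prime_odd_nat[of p] prime_gt_1_nat[of p]
    by (simp add: R_def assms(4))
  have R2: "R \<ge> 2"
  proof -
    have "CARD('a) ^ 1 \<le> CARD('a) ^ t"
      using card_ge2[where 'a = 'a] assms(3) by (intro power_increasing) auto
    then show ?thesis using card_ge2[where 'a = 'a] by (simp add: R_def)
  qed
  have mu0: "2 - lam \<noteq> 0" using two assms(6,8) by (metis right_minus_eq)
  interpret theta_cf \<xi> "theta_pq p R k lam" "real CARD('a)" k R lam "2 - lam"
    "\<lambda>j. 1 + k + word_ends (\<lambda>j. concat (replicate (k + 1) (theta_unit p R lam (Suc j)))) j"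
    "theta_letter lam"
    using odd two R2 mu0 assms(6,7,9) by (intro theta_cf_theta_pq) (auto simp: R_def)
  have r2: "r \<ge> 2" using R2 by (simp add: rR)
  define K where "K = real k + 1"
  have K: "K \<ge> 1" by (simp add: K_def)
  have per_eq: "per = K / (r - 1)" by (simp add: per_def K_def rR)
  define N where "N = 2 * r * K + (r - 1) * (r - 2)"
  have N: "N > 0" using r2 K by (simp add: N_def add_pos_nonneg)
  have A_eq: "A = r * (r - 1) * (r - 4) / N" and B_eq: "B = r * (r - 1) * (r - 3) / N"
    by (simp_all only: A_def B_def N_def K_def)
  define A1 where "A1 = 2 * per * r"
  define B1 where "B1 = 2 * per * r + 2 * r"
  have A1: "A1 = 2 * K * r / (r - 1)" by (simp add: A1_def per_eq)
  have q1: "(B1 + 0) / A1 - 1 = (r - 1) / K" "B1 / A1 = (r - 1) / K + 1"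
    using r2 K by (simp_all add: A1_def B1_def per_eq field_simps)
  define A2 where "A2 = 2 * per * r\<^sup>2 + r\<^sup>2 - 2 * r"
  define B2 where "B2 = 2 * per * r ^ 3 + r\<^sup>2"
  \<comment> \<open>The common factor \<open>r / (r - 1)\<close> cancels in the quotients and leaves
    the denominator \<open>N\<close> of the theorem.\<close>
  have A2: "A2 = r / (r - 1) * N"
    using r2 by (simp add: A2_def N_def per_eq field_simps power2_eq_square)
  have B2: "B2 = r / (r - 1) * (2 * r\<^sup>2 * K + r * (r - 1))"
    using r2 by (simp add: B2_def per_eq field_simps power2_eq_square power3_eq_cube)
  have BD2: "B2 + r\<^sup>2 = r / (r - 1) * (2 * r\<^sup>2 * K + 2 * r * (r - 1))"
    using r2 by (simp add: B2_def per_eq field_simps power2_eq_square power3_eq_cube)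
  have c0: "r / (r - 1) \<noteq> 0" using r2 by simp
  have "B2 / A2 = (2 * r\<^sup>2 * K + r * (r - 1)) / N" unfolding A2 B2 using c0 by simp
  also have "2 * r\<^sup>2 * K + r * (r - 1) = r * N - r * (r - 1) * (r - 3)"
    by (simp add: N_def power2_eq_square algebra_simps)
  also have "\<dots> / N = r - B" using N by (simp add: B_eq diff_divide_distrib)
  finally have q2: "B2 / A2 = r - B" .
  have "(B2 + r\<^sup>2) / A2 - 1 = (2 * r\<^sup>2 * K + 2 * r * (r - 1)) / N - 1" unfolding A2 BD2 using c0 by simp
  also have "2 * r\<^sup>2 * K + 2 * r * (r - 1) = r * N - r * (r - 1) * (r - 4)"
    by (simp add: N_def power2_eq_square algebra_simps)
  also have "\<dots> / N - 1 = r - 1 - A" using N by (simp add: A_eq diff_divide_distrib)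
  finally have q2': "(B2 + r\<^sup>2) / A2 - 1 = r - 1 - A" .
  \<comment> \<open>Used below to read off the sign of \<open>r - d - A\<close> from a positive
    product, as \<open>r - 2 - A\<close> is then positive.\<close>
  have w1: "r - 1 - A > 1"
  proof -
    have "A < r - 2"
    proof -
      have "2 * r * K * (r - 2) \<ge> 0" using r2 K by simp
      then have "r * (r - 1) * (r - 4) < (r - 2) * N"
        using r2 by (simp add: N_def algebra_simps)
      then show ?thesis using N by (simp add: A_eq divide_less_eq)
    qed
    then show ?thesis by simp
  qed
  note ex1 = raw_quad_approx.exponents[OF const_quad_approx[OF assms(10)],
      folded rR, folded A1_def B1_def, unfolded q1]
  note ex2 = raw_quad_approx.exponents[OF period_quad_approx[OF assms(10)],
      folded rR, folded A2_def B2_def, unfolded q2 q2']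
  have main1: "w_star_exp emb av n \<xi> = ereal ((r - 1) / K) \<and> w_exp n \<xi> = ereal ((r - 1) / K + 1)"
    if hyp: "real k \<le> 2 * (r - 1) / (real d + sqrt ((real d)\<^sup>2 + 4 * (2 * r - 1) * real d + 4)) - 1"
      and n: "2 \<le> n" "n \<le> d" for n
  proof -
    \<comment> \<open>\<open>D\<close> is the discriminant of x^2 - d x + d - 1 - 2 r d, and the
      hypothesis places \<open>x = (r - 1) / K\<close> at or beyond its larger root. This is the
      inequality \<open>2 * r * d \<le> (x - 1) * (x + 1 - d)\<close>.\<close>
    define D where "D = (real d)\<^sup>2 + 4 * (2 * r - 1) * real d + 4"
    have D: "D > (real d)\<^sup>2" using r2 by (simp add: D_def add_nonneg_pos)
    define x where "x = (r - 1) / K"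
    have D0: "D \<ge> 0" using D zero_le_power2[of "real d"] by linarith
    have sq: "sqrt D > real d" using D by (simp add: real_less_rsqrt)
    have pos: "real d + sqrt D > 0" using sq by linarith
    have "K \<le> 2 * (r - 1) / (real d + sqrt D)" using hyp by (simp add: K_def D_def)
    then have "K * (real d + sqrt D) \<le> 2 * (r - 1)" using pos by (simp add: le_divide_eq)
    then have "real d + sqrt D \<le> 2 * x" using K by (simp add: x_def field_simps)
    then have le: "sqrt D \<le> 2 * x - real d" by simp
    have "D = (sqrt D)\<^sup>2" using D real_sqrt_pow2[of D] zero_le_power2[of "real d"] by linarith
    also have "\<dots> \<le> (2 * x - real d)\<^sup>2" using le D0 by (intro power_mono) auto
    finally have "2 * r * real d \<le> (x - 1) * (x + 1 - real d)"
      by (simp add: D_def power2_eq_square algebra_simps)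
    moreover have "x + 1 - real d > 0" using le sq by simp
    ultimately show ?thesis using ex1(3)[of d n] n by (simp add: x_def)
  qed
  have main2: "w_star_exp emb av n \<xi> = ereal (r - 1 - A) \<and> w_exp n \<xi> = ereal (r - B)"
    if hyp: "2 * r * real d \<le> (r - 2 - A) * (r - real d - A)" and n: "2 \<le> n" "n \<le> d" for n
  proof -
    have "2 * r * real d > 0" using r2 n by simp
    then have "(r - 2 - A) * (r - real d - A) > 0" using hyp by linarith
    then have "r - real d - A > 0" using w1 by (simp add: zero_less_mult_iff)
    then show ?thesis using ex2(3)[of d n] n hyp by (simp add: algebra_simps)
  qed
  have "w_star_exp emb av 2 \<xi> \<ge> ereal (max ((r - 1) / K) (r - 1 - A))"
    using ex1(1) ex2(1) by (simp add: max_def)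
  moreover have "w_exp 2 \<xi> \<ge> ereal (max ((r - 1) / K + 1) (r - B))"
    using ex1(2) ex2(2) by (simp add: max_def)
  ultimately show ?thesis using main1 main2 unfolding K_def by blast
qed

end
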